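(* Suppose $x\in (S_{\mathcal{M}_L})_{\geq0}$. Then the Le-coordinates of $x$ are the entries of the Le-tableau $T(x)\in\mathbf{T}_L$ defined below. That is, $\operatorname{Meas}_L(T(x))=x$, and $T(x)$ is the unique Le-tableau whose image under $\operatorname{Meas}_L$ is $x$. \[ T(x)_B= \begin{cases} 0 & \text{if $P_{M(B)}(x)=0$;}\\ \prod_{L_{C}=+}\left(\frac{P_{M(C)}(x)}{P_{M'(C)}(x)}\right)^{\mu(B,C)} & \text{if $P_{M(B)}(x)\neq 0$.} \end{cases} \]
   Context: $\operatorname{Gr}_{kn}$ is the Grassmannian of $k$-planes in $\mathbb{R}^n$ with Pl\"ucker coordinates $P_J$; $(\operatorname{Gr}_{kn})_{\geq0}$ its totally nonnegative part. A Le-diagram $L$ is a partition $\lambda$ in a $k\times(n-k)$ rectangle with boxes filled by $0$ and $+$ so that no $0$ has a $+$ above it in its column and a $+$ to its left in its row; a Le-tableau replaces the $+$ entries by positive reals (Le-coordinates), and $\mathbf{T}_L$ is the set of Le-tableaux with vanishing pattern $L$. Box $B=(r,c)$: $r$-th row from top, $c$-th column from right. Label the steps of the southeast border of $\lambda$ by $1,\dots,n$; south steps are sources $I=\{i_1<\dots<i_k\}$, west steps are sinks $j_1<\dots<j_{n-k}$. The $\Gamma$-graph $G_L$ consists of, for each $B=(r,c)$ with $L_B=+$, the $B$ hook with corner at the northwest corner of $B$, horizontal path directed from $i_r$ to the corner, vertical path directed from the corner to $j_c$. $\mathcal{M}_L$ is the set of $J$ reachable from $I$ by non-intersecting path collections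 in $G_L$, and $(S_{\mathcal{M}_L})_{\geq0}$ is the set of $x\in(\operatorname{Gr}_{kn})_{\geq0}$ with $P_J(x)\ne0$ iff $J\in\mathcal{M}_L$. For $T\in\mathbf{T}_L$, the $\Gamma$-network $N_T$ assigns weight $T_B$ to the face $F(B)$ of $G_L$ with northwest corner $B$ (one for each $+$ box) and weight $\prod 1/T_B$ to the remaining face bounded by the disk boundary. The boundary measurement map is $P_J(\operatorname{Meas}_L(T))=\sum_A \prod_{i\in I}\operatorname{wt}(A_i)$ over non-intersecting path families $A$ from $I$ to $J$ in $N_T$, where $\operatorname{wt}(A_i)$ is the product of weights of faces southeast of $A_i$; by Postnikov, $\operatorname{Meas}_L$ is a bijection onto $(S_{\mathcal{M}_L})_{\geq0}$. For a box $B=(r,c)$: $A_{r,c}=[n]\setminus\{i_r+1,\dots,j_c-1\}$, $M'(B)=\operatorname{lexmax}\{J\in\mathcal{M}_L: J\cap A_{r,c}=I\cap A_{r,c}\}$, $M(B)=(M'(B)\setminus\{i_r\})\cup\{j_c\}$. $\mu(B,C)=\mu_L(F(B),F(C))$ is the M\"obius function of the poset of faces indexed by $+$ entries of $L$, ordered by $F_1\leq F_2$ if the $F_1$ hook lies weakly northwest of the $F_2$ hook. *)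

theory Defs
  imports
    "Jordan_Normal_Form.VS_Connect"
    "Jordan_Normal_Form.DL_Submatrix"
    "HOL-Library.List_Lexorder"
    "HOL-Library.Disjoint_Sets"
begin

section \<open>The totally nonnegative Grassmannian\<close>

definition grassmannian :: "nat \<Rightarrow> nat \<Rightarrow> real vec set set" where
  "grassmannian k n =
     {x. VectorSpace.subspace class_ring x (module_vec TYPE(real) n) \<and>
         vectorspace.dim class_ring ((module_vec TYPE(real) n)\<lparr>carrier := x\<rparr>) = k}"

text \<open>
  Pluecker coordinates are homogeneous: \<open>P\<close> is a system of Pluecker coordinates of \<open>x\<close> if it is
  given by the maximal minors of some \<open>k \<times> n\<close> matrix with row space \<open>x\<close>. Columns are labelled
  \<open>1, \<dots>, n\<close>, whereas matrix indices start at \<open>0\<close>; this is the reason for \<open>Suc -` J\<close>.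
\<close>

definition plucker_coordinates ::
    "nat \<Rightarrow> nat \<Rightarrow> real vec set \<Rightarrow> (nat set \<Rightarrow> real) \<Rightarrow> bool" where
  "plucker_coordinates k n x P \<longleftrightarrow>
     (\<exists>A \<in> carrier_mat k n. vec_space.row_space n A = x \<and>
        (\<forall>J. J \<subseteq> {1..n} \<and> card J = k \<longrightarrow> P J = det (submatrix A UNIV (Suc -` J))))"

definition nonneg_grassmannian :: "nat \<Rightarrow> nat \<Rightarrow> real vec set set" where
  "nonneg_grassmannian k n =
     {x \<in> grassmannian k n. \<exists>P. plucker_coordinates k n x P \<and>
        (\<forall>J. J \<subseteq> {1..n} \<and> card J = k \<longrightarrow> 0 \<le> P J)}"

definition nonneg_cell :: "nat \<Rightarrow> nat \<Rightarrow> nat set set \<Rightarrow> real vec set set" where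
  "nonneg_cell k n M =
     {x \<in> nonneg_grassmannian k n. \<forall>P. plucker_coordinates k n x P \<longrightarrow>
        (\<forall>J. J \<subseteq> {1..n} \<and> card J = k \<longrightarrow> (P J \<noteq> 0 \<longleftrightarrow> J \<in> M))}"


section \<open>Le-diagrams and Le-tableaux\<close>

text \<open>
  \<open>shape L r\<close> is the part \<open>\<lambda>\<^sub>r\<close> of the partition, for \<open>1 \<le> r \<le> num_rows L\<close>. The filling is given
  by the set \<open>pluses L\<close> of boxes containing \<open>+\<close>; all other boxes contain \<open>0\<close>.
\<close>

record le_diagram =
  num_rows :: nat
  num_steps :: nat
  shape :: "nat \<Rightarrow> nat"
  pluses :: "(nat \<times> nat) set"

definition num_cols :: "le_diagram \<Rightarrow> nat" where
  "num_cols L = num_steps L - num_rows L"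

text \<open>
  Rows are counted from the top, columns from the right end of the \<open>k \<times> (n - k)\<close> rectangle.
  The diagram is left-justified, so row \<open>r\<close> consists of the columns \<open>c > n - k - \<lambda>\<^sub>r\<close>.
\<close>

definition boxes :: "le_diagram \<Rightarrow> (nat \<times> nat) set" where
  "boxes L = {(r, c). 1 \<le> r \<and> r \<le> num_rows L \<and> 1 \<le> c \<and> c \<le> num_cols L \<and>
                      num_cols L - shape L r < c}"

definition is_le_diagram :: "le_diagram \<Rightarrow> bool" where
  "is_le_diagram L \<longleftrightarrow>
     num_rows L \<le> num_steps L \<and>
     (\<forall>r \<in> {1..num_rows L}. shape L r \<le> num_cols L) \<and>
     (\<forall>r \<in> {1..num_rows L}. \<forall>s \<in> {1..num_rows L}. r \<le> s \<longrightarrow> shape L s \<le> shape L r) \<and>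
     pluses L \<subseteq> boxes L \<and>
     (\<forall>(r, c) \<in> boxes L - pluses L.
        \<not> ((\<exists>r' < r. (r', c) \<in> pluses L) \<and> (\<exists>c' > c. (r, c') \<in> pluses L)))"

text \<open>A Le-tableau is extended by \<open>0\<close> to all pairs that are not boxes of the diagram.\<close>

definition le_tableaux :: "le_diagram \<Rightarrow> (nat \<times> nat \<Rightarrow> real) set" where
  "le_tableaux L = {T. (\<forall>B \<in> pluses L. 0 < T B) \<and> (\<forall>B. B \<notin> pluses L \<longrightarrow> T B = 0)}"

text \<open>
  The southeast border runs from the northeast to the southwest corner of the rectangle. The south
  step in row \<open>r\<close> is preceded by \<open>r - 1\<close> south steps and \<open>n - k - \<lambda>\<^sub>r\<close> west steps; the west step in
  column \<open>c\<close> is preceded by \<open>c - 1\<close> west steps and as many south steps as column \<open>c\<close> has boxes.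
\<close>

definition source :: "le_diagram \<Rightarrow> nat \<Rightarrow> nat" where
  "source L r = (num_cols L - shape L r) + r"

definition col_height :: "le_diagram \<Rightarrow> nat \<Rightarrow> nat" where
  "col_height L c = card {r. (r, c) \<in> boxes L}"

definition sink :: "le_diagram \<Rightarrow> nat \<Rightarrow> nat" where
  "sink L c = c + col_height L c"

definition sources :: "le_diagram \<Rightarrow> nat set" where
  "sources L = source L ` {1..num_rows L}"


section \<open>\<open>\<Gamma>\<close>-graphs, \<open>\<Gamma>\<close>-networks and the boundary measurement map\<close>

text \<open>
  \<open>Corner B\<close> is the northwest corner of the box \<open>B\<close>. Each hook is cut into unit steps. The corner
  of a \<open>0\<close> box is then at most a subdivision point of a single horizontal or vertical line, since
  by the Le-condition hooks cross only at corners of \<open>+\<close> boxes.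
\<close>

datatype vertex = Boundary nat | Corner "nat \<times> nat"

fun hook :: "le_diagram \<Rightarrow> nat \<times> nat \<Rightarrow> vertex list" where
  "hook L (r, c) =
     [Boundary (source L r)] @
     map (\<lambda>d. Corner (r, d)) [num_cols L - shape L r + 1 ..< c + 1] @
     map (\<lambda>s. Corner (s, c)) [r + 1 ..< col_height L c + 1] @
     [Boundary (sink L c)]"

definition gamma_graph :: "le_diagram \<Rightarrow> (vertex \<times> vertex) set" where
  "gamma_graph L = (\<Union>B \<in> pluses L. set (zip (hook L B) (tl (hook L B))))"

definition gamma_path :: "le_diagram \<Rightarrow> vertex list \<Rightarrow> bool" where
  "gamma_path L p \<longleftrightarrow> p \<noteq> [] \<and> successively (\<lambda>u v. (u, v) \<in> gamma_graph L) p"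

text \<open>A source belonging to \<open>J\<close> is joined to itself by the path without edges.\<close>

definition path_families :: "le_diagram \<Rightarrow> nat set \<Rightarrow> (nat \<Rightarrow> vertex list) set" where
  "path_families L J =
     {A \<in> extensional (sources L).
        (\<forall>i \<in> sources L. gamma_path L (A i) \<and> hd (A i) = Boundary i) \<and>
        disjoint_family_on (\<lambda>i. set (A i)) (sources L) \<and>
        (\<lambda>i. last (A i)) ` sources L = Boundary ` J}"

definition positroid :: "le_diagram \<Rightarrow> nat set set" where
  "positroid L = {J. path_families L J \<noteq> {}}"

definition southeast :: "vertex list \<Rightarrow> (nat \<times> nat) set" where
  "southeast p = {(r, c). \<exists>r' c'. Corner (r', c') \<in> set p \<and> r' \<le> r \<and> c \<le> c'}"

text \<open>
  \<open>Face B\<close> is the face with northwest corner \<open>B\<close>. As the paths go west and south, it lies southeast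
  of a path iff its northwest corner is on the path or southeast of it. \<open>Outer\<close> is the face
  northwest of all hooks, which is never southeast of a path.
\<close>

datatype face = Face "nat \<times> nat" | Outer

definition faces :: "le_diagram \<Rightarrow> face set" where
  "faces L = insert Outer (Face ` pluses L)"

fun face_weight :: "le_diagram \<Rightarrow> (nat \<times> nat \<Rightarrow> real) \<Rightarrow> face \<Rightarrow> real" where
  "face_weight L T (Face B) = T B"
| "face_weight L T Outer = (\<Prod>B \<in> pluses L. 1 / T B)"

fun face_southeast :: "face \<Rightarrow> vertex list \<Rightarrow> bool" where
  "face_southeast (Face B) p \<longleftrightarrow> B \<in> southeast p"
| "face_southeast Outer p \<longleftrightarrow> False"

definition path_weight :: "le_diagram \<Rightarrow> (nat \<times> nat \<Rightarrow> real) \<Rightarrow> vertex list \<Rightarrow> real" where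
  "path_weight L T p = (\<Prod>F \<in> {F \<in> faces L. face_southeast F p}. face_weight L T F)"

definition measurement :: "le_diagram \<Rightarrow> (nat \<times> nat \<Rightarrow> real) \<Rightarrow> nat set \<Rightarrow> real" where
  "measurement L T J =
     (\<Sum>A \<in> path_families L J. \<Prod>i \<in> sources L. path_weight L T (A i))"

definition Meas :: "le_diagram \<Rightarrow> (nat \<times> nat \<Rightarrow> real) \<Rightarrow> real vec set" where
  "Meas L T = (THE x. x \<in> grassmannian (num_rows L) (num_steps L) \<and>
     plucker_coordinates (num_rows L) (num_steps L) x (measurement L T))"


section \<open>The Moebius function of the poset of faces\<close>

text \<open>The Moebius function of a finite partially ordered set \<open>E\<close>, with junk value \<open>0\<close> otherwise.\<close>

function moebius :: "'a set \<Rightarrow> ('a \<times> 'a) set \<Rightarrow> 'a \<Rightarrow> 'a \<Rightarrow> int" where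
  "moebius E R x y =
     (if finite E \<and> partial_order_on E R \<and> (x, y) \<in> R then
        (if x = y then 1
         else - (\<Sum>z \<in> {z \<in> E. (x, z) \<in> R \<and> (z, y) \<in> R \<and> z \<noteq> y}. moebius E R x z))
      else 0)"
  by pat_completeness auto
termination
proof (relation "measure (\<lambda>(E, R, x, y). card {w \<in> E. (w, y) \<in> R})", goal_cases)
  case 1
  show ?case by simp
next
  case (2 E R x y z)
  then have fin: "finite E" and po: "partial_order_on E R" and z: "z \<in> E" "(z, y) \<in> R" "z \<noteq> y"
    by auto
  from po have tr: "trans R" and an: "antisym R" and re: "R \<subseteq> E \<times> E" "refl_on E R"
    by (auto simp: partial_order_on_def preorder_on_def)
  have y: "y \<in> E" using re z by auto
  have "{w \<in> E. (w, z) \<in> R} \<subset> {w \<in> E. (w, y) \<in> R}"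
  proof (rule psubsetI)
    show "{w \<in> E. (w, z) \<in> R} \<subseteq> {w \<in> E. (w, y) \<in> R}"
      using transD [OF tr _ z(2)] by blast
    have "(y, y) \<in> R" using re y by (auto simp: refl_on_def)
    moreover have "(y, z) \<notin> R" using antisymD [OF an z(2)] z(3) by blast
    ultimately show "{w \<in> E. (w, z) \<in> R} \<noteq> {w \<in> E. (w, y) \<in> R}"
      using y by blast
  qed
  then have "card {w \<in> E. (w, z) \<in> R} < card {w \<in> E. (w, y) \<in> R}"
    using fin by (intro psubset_card_mono) simp_all
  then show ?case by simp
qed

declare moebius.simps [simp del]

text \<open>
  The face \<open>F(B)\<close> is represented by the box \<open>B\<close>. The hook of \<open>B\<close> is weakly northwest of the hook of
  \<open>C\<close> if every point of the latter is weakly southeast of the former.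
\<close>

definition face_order :: "le_diagram \<Rightarrow> ((nat \<times> nat) \<times> (nat \<times> nat)) set" where
  "face_order L = {(B, C). B \<in> pluses L \<and> C \<in> pluses L \<and>
     {D. Corner D \<in> set (hook L C)} \<subseteq> southeast (hook L B)}"

definition mu :: "le_diagram \<Rightarrow> nat \<times> nat \<Rightarrow> nat \<times> nat \<Rightarrow> int" where
  "mu L B C = moebius (pluses L) (face_order L) B C"

lemma finite_pluses:
  assumes "is_le_diagram L"
  shows "finite (pluses L)"
proof (rule finite_subset)
  show "pluses L \<subseteq> {1..num_rows L} \<times> {1..num_cols L}"
    using assms by (auto simp: is_le_diagram_def boxes_def)
qed simp

lemma face_order_iff:
  assumes "is_le_diagram L" and B: "(r, c) \<in> pluses L" and C: "(r', c') \<in> pluses L"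
  shows "((r, c), (r', c')) \<in> face_order L \<longleftrightarrow> r \<le> r' \<and> c' \<le> c"
proof -
  have lt: "num_cols L - shape L r < c" "num_cols L - shape L r' < c'"
    using assms by (auto simp: is_le_diagram_def boxes_def)
  have B_in: "Corner (r, c) \<in> set (hook L (r, c))" and C_in: "Corner (r', c') \<in> set (hook L (r', c'))"
    using lt by (auto simp: image_iff)
  show ?thesis
  proof
    assume "((r, c), (r', c')) \<in> face_order L"
    then have "(r', c') \<in> southeast (hook L (r, c))"
      using C_in unfolding face_order_def by blast
    then show "r \<le> r' \<and> c' \<le> c" by (auto simp: southeast_def)
  next
    assume "r \<le> r' \<and> c' \<le> c"
    moreover have "r' \<le> s \<and> d \<le> c'" if "Corner (s, d) \<in> set (hook L (r', c'))" for s d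
      using that by auto
    ultimately have "\<forall>D. Corner D \<in> set (hook L (r', c')) \<longrightarrow> D \<in> southeast (hook L (r, c))"
      unfolding southeast_def using B_in by (blast intro: order_trans)
    then show "((r, c), (r', c')) \<in> face_order L"
      using B C by (auto simp: face_order_def simp del: hook.simps)
  qed
qed

lemma face_order_partial_order:
  assumes "is_le_diagram L"
  shows "partial_order_on (pluses L) (face_order L)"
proof -
  note iff = face_order_iff [OF assms]
  have sub: "face_order L \<subseteq> pluses L \<times> pluses L"
    by (auto simp: face_order_def)
  have "refl_on (pluses L) (face_order L)"
    using iff by (auto simp: refl_on_def)
  moreover have "antisym (face_order L)"
  proof (rule antisymI)
    fix B C assume BC: "(B, C) \<in> face_order L" "(C, B) \<in> face_order L"
    then have "B \<in> pluses L" "C \<in> pluses L" using sub by auto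
    with BC show "B = C" by (cases B; cases C) (simp add: iff)
  qed
  moreover have "trans (face_order L)"
  proof (rule transI)
    fix B C D assume BCD: "(B, C) \<in> face_order L" "(C, D) \<in> face_order L"
    then have "B \<in> pluses L" "C \<in> pluses L" "D \<in> pluses L" using sub by auto
    with BCD show "(B, D) \<in> face_order L" by (cases B; cases C; cases D) (simp add: iff)
  qed
  ultimately show ?thesis
    using sub by (simp add: partial_order_on_def preorder_on_def)
qed


section \<open>The tableau \<open>T(x)\<close>\<close>

text \<open>Subsets are compared lexicographically as increasing sequences.\<close>

definition lexmax :: "nat set set \<Rightarrow> nat set" where
  "lexmax S = set (Max (sorted_list_of_set ` S))"

fun fixed_labels :: "le_diagram \<Rightarrow> nat \<times> nat \<Rightarrow> nat set" where
  "fixed_labels L (r, c) = {1..num_steps L} - {source L r <..< sink L c}"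

definition M' :: "le_diagram \<Rightarrow> nat \<times> nat \<Rightarrow> nat set" where
  "M' L B = lexmax {J \<in> positroid L.
     J \<inter> fixed_labels L B = sources L \<inter> fixed_labels L B}"

fun M :: "le_diagram \<Rightarrow> nat \<times> nat \<Rightarrow> nat set" where
  "M L (r, c) = (M' L (r, c) - {source L r}) \<union> {sink L c}"

text \<open>
  The entries are ratios of Pluecker coordinates, so they do not depend on the choice of the
  homogeneous coordinates \<open>P\<close>.
\<close>

definition tableau_of :: "le_diagram \<Rightarrow> (nat set \<Rightarrow> real) \<Rightarrow> nat \<times> nat \<Rightarrow> real" where
  "tableau_of L P B =
     (if B \<notin> boxes L then 0
      else if P (M L B) = 0 then 0
      else (\<Prod>C \<in> pluses L. (P (M L C) / P (M' L C)) powi mu L B C))"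

end

theory Submission
  imports Defs "Jordan_Normal_Form.DL_Rank_Submatrix"
begin

text \<open>
  Normalise a point of the cell so that the columns of the sources form the identity matrix. The
  minor \<open>M(B)\<close> is then linear in the entry at the box \<open>B\<close>, with cofactor \<open>\<plusminus>M'(B)\<close>, and otherwise
  involves only entries southeast of \<open>B\<close>. Hence a point with the zero pattern of the positroid is
  determined by the ratios \<open>P(M(B)) / P(M'(B))\<close>, and surjectivity of the boundary measurement map
  is not needed: it suffices to find a tableau with the given ratios.

  By the Lindstroem-Gessel-Viennot lemma the boundary measurements are the minors of a matrix, so the
  positroid has the exchange property. It implies that every path family of \<open>M(B)\<close> consists of the
  hook of \<open>B\<close> and a path family of \<open>M'(B)\<close>: otherwise the family would cross some label \<open>m\<close> more
  often than the longest chain of nested hooks allows, contradicting the maximality of \<open>M'(B)\<close>.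
  So the ratio of \<open>B\<close> is the product of the tableau entries southeast of \<open>B\<close>, and Moebius inversion
  recovers the tableau.
\<close>

section \<open>Determinants of functions\<close>

text \<open>The obstacle is that \<open>M'(B)\<close> is maximal lexicographically, while path
  families are geometric. Exchange turns the first into counting: among the members of the positroid
  that agree with the sources on the fixed labels, \<open>M'(B)\<close> has the most elements in the
  fixed labels together with \<open>{m..}\<close>, simultaneously for all \<open>m\<close>. The
  hooks of a chain southeast of \<open>B\<close> provide competitors, so the paths to
  \<open>M'(B)\<close> cross \<open>m\<close> at least as often as such a chain. A family of
  \<open>M(B)\<close> makes one more crossing, since the source of \<open>B\<close> also leaves and
  the sink of \<open>B\<close> is also reached; if none of its paths had \<open>B\<close> on it or
  to its southeast, planarity would bound the crossings at some \<open>m\<close> by a chain. As all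
  moved sources lie weakly below row \<open>r\<close> and all moved sinks weakly east of column
  \<open>c\<close>, a path over \<open>B\<close> can only be the hook of \<open>B\<close>.
  \<open>Meas\<close> is a definite description, so Pluecker coordinates must also be shown to
  determine the point; this is the same determinacy statement, applied to equal coordinates.\<close>

definition fdet :: "nat \<Rightarrow> (nat \<Rightarrow> nat \<Rightarrow> 'a) \<Rightarrow> 'a::comm_ring_1" where
  "fdet k f = det (mat k k (\<lambda>(i, j). f i j))"

lemma fdet_leibniz:
  "fdet k f = (\<Sum>p | p permutes {0..<k}. signof p * (\<Prod>i = 0..<k. f i (p i)))"
  unfolding fdet_def det_def
  by (auto intro!: sum.cong prod.cong simp: permutes_in_image)

lemma fdet_cong: "(\<And>i j. i < k \<Longrightarrow> j < k \<Longrightarrow> f i j = g i j) \<Longrightarrow> fdet k f = fdet k g"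
  unfolding fdet_def by (rule arg_cong[of _ _ det]) (auto intro!: eq_matI)

text \<open>Every Leibniz term contains exactly one entry of row \<open>i\<close>, so the expansion
  is linear in that row.\<close>

lemma fdet_row_sum:
  assumes i: "i < k" and f: "\<And>c. c < k \<Longrightarrow> f i c = (\<Sum>s\<in>S. a s * g s c)"
  shows "fdet k f = (\<Sum>s\<in>S. a s * fdet k (f(i := g s)))"
proof -
  have "signof p * (\<Prod>r = 0..<k. f r (p r)) =
      (\<Sum>s\<in>S. a s * (signof p * (\<Prod>r = 0..<k. (f(i := g s)) r (p r))))"
    if p: "p permutes {0..<k}" for p
  proof -
    have split: "(\<Prod>r = 0..<k. h r (p r)) = h i (p i) * (\<Prod>r\<in>{0..<k} - {i}. h r (p r))" for h :: "nat \<Rightarrow> nat \<Rightarrow> 'a"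
      using i by (simp add: prod.remove)
    have rest: "(\<Prod>r\<in>{0..<k} - {i}. (f(i := g s)) r (p r)) = (\<Prod>r\<in>{0..<k} - {i}. f r (p r))" for s
      by (intro prod.cong) auto
    have "p i < k" using p i permutes_in_image by fastforce
    then show ?thesis
      unfolding split rest f[OF \<open>p i < k\<close>] by (simp add: sum_distrib_left sum_distrib_right mult_ac)
  qed
  then have "fdet k f = (\<Sum>p | p permutes {0..<k}. \<Sum>s\<in>S. a s * (signof p * (\<Prod>r = 0..<k. (f(i := g s)) r (p r))))"
    unfolding fdet_leibniz by (intro sum.cong) auto
  also have "\<dots> = (\<Sum>s\<in>S. \<Sum>p | p permutes {0..<k}. a s * (signof p * (\<Prod>r = 0..<k. (f(i := g s)) r (p r))))"
    by (rule sum.swap)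
  also have "\<dots> = (\<Sum>s\<in>S. a s * fdet k (f(i := g s)))"
    unfolding fdet_leibniz sum_distrib_left ..
  finally show ?thesis .
qed

lemma fdet_identical_rows:
  assumes "i < k" "j < k" "i \<noteq> j" "\<And>c. c < k \<Longrightarrow> f i c = f j c"
  shows "fdet k f = 0"
proof -
  have "row (mat k k (\<lambda>(i, j). f i j)) i = row (mat k k (\<lambda>(i, j). f i j)) j"
  proof (rule eq_vecI)
    fix c assume "c < dim_vec (row (mat k k (\<lambda>(i, j). f i j)) j)"
    then have "c < k" by simp
    then show "row (mat k k (\<lambda>(i, j). f i j)) i $ c = row (mat k k (\<lambda>(i, j). f i j)) j $ c"
      using assms(1,2) assms(4)[OF \<open>c < k\<close>] by simp
  qed simp
  then show ?thesis
    unfolding fdet_def using assms(1-3) by (intro det_identical_rows[of _ k i j]) simp_all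
qed

lemma fdet_permute_cols:
  assumes "p permutes {0..<k}"
  shows "fdet k (\<lambda>i j. f i (p j)) = signof p * fdet k f"
proof -
  have tr: "fdet k h = fdet k (\<lambda>i j. h j i)" for h :: "nat \<Rightarrow> nat \<Rightarrow> 'a"
  proof -
    have "fdet k h = det (transpose_mat (mat k k (\<lambda>(i, j). h i j)))"
      unfolding fdet_def by (rule det_transpose[symmetric]) auto
    also have "transpose_mat (mat k k (\<lambda>(i, j). h i j)) = mat k k (\<lambda>(i, j). h j i)"
      by (auto intro!: eq_matI)
    finally show ?thesis by (simp add: fdet_def)
  qed
  have "fdet k (\<lambda>i j. f j (p i)) = signof p * fdet k (\<lambda>i j. f j i)"
  proof -
    have "mat k k (\<lambda>(i, j). f j (p i)) = mat k k (\<lambda>(i, j). mat k k (\<lambda>(i, j). f j i) $$ (p i, j))"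
    proof (rule eq_matI)
      fix i j assume "i < dim_row (mat k k (\<lambda>(i, j). mat k k (\<lambda>(i, j). f j i) $$ (p i, j)))"
        "j < dim_col (mat k k (\<lambda>(i, j). mat k k (\<lambda>(i, j). f j i) $$ (p i, j)))"
      then have ij: "i < k" "j < k" by simp_all
      then have "p i < k" using permutes_in_image[OF assms, of i] by simp
      with ij show "mat k k (\<lambda>(i, j). f j (p i)) $$ (i, j) =
          mat k k (\<lambda>(i, j). mat k k (\<lambda>(i, j). f j i) $$ (p i, j)) $$ (i, j)"
        by simp
    qed simp_all
    then show ?thesis
      using det_permute_rows[OF _ assms, of "mat k k (\<lambda>(i, j). f j i)"] by (simp add: fdet_def)
  qed
  then show ?thesis using tr[of f] tr[of "\<lambda>i j. f i (p j)"] by simp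
qed

lemma fdet_scale: "fdet k (\<lambda>i j. a i * b j * f i j) = (\<Prod>i<k. a i) * (\<Prod>j<k. b j) * fdet k f"
proof -
  have "(\<Prod>i = 0..<k. b (p i)) = (\<Prod>j<k. b j)" if "p permutes {0..<k}" for p
    using prod.permute[OF that, of b] by (simp add: atLeast0LessThan o_def)
  then show ?thesis
    unfolding fdet_leibniz sum_distrib_left
    by (intro sum.cong) (auto simp: prod.distrib atLeast0LessThan mult_ac)
qed

text \<open>A permutation contributes only if it sends every \<open>i\<close> in \<open>R\<close> to
  the column \<open>\<kappa> i\<close>, since otherwise that column is met in a row where it
  vanishes. Hence the rows in \<open>R\<close> may be altered freely outside these columns.\<close>

lemma fdet_unit_columns:
  assumes \<kappa>: "\<And>i. i \<in> R \<Longrightarrow> \<kappa> i < k"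
    and eq: "\<And>i. i < k \<Longrightarrow> i \<in> R \<Longrightarrow> f i (\<kappa> i) = g i (\<kappa> i)"
    and f0: "\<And>i i'. i \<in> R \<Longrightarrow> i' < k \<Longrightarrow> i' \<noteq> i \<Longrightarrow> f i' (\<kappa> i) = 0"
    and g0: "\<And>i i'. i \<in> R \<Longrightarrow> i' < k \<Longrightarrow> i' \<noteq> i \<Longrightarrow> g i' (\<kappa> i) = 0"
    and rest: "\<And>i j. i < k \<Longrightarrow> i \<notin> R \<Longrightarrow> j < k \<Longrightarrow> f i j = g i j"
    and R: "\<And>i. i \<in> R \<Longrightarrow> i < k"
  shows "fdet k f = fdet k g"
proof -
  have "(\<Prod>i = 0..<k. f i (p i)) = (\<Prod>i = 0..<k. g i (p i))" if p: "p permutes {0..<k}" for p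
  proof (cases "\<forall>i\<in>R. p i = \<kappa> i")
    case True
    show ?thesis
    proof (intro prod.cong refl)
      fix i assume "i \<in> {0..<k}"
      then show "f i (p i) = g i (p i)"
        using True eq rest permutes_in_image[OF p] by (cases "i \<in> R") auto
    qed
  next
    case False
    then obtain i where i: "i \<in> R" "p i \<noteq> \<kappa> i" by blast
    obtain i' where i': "i' < k" "p i' = \<kappa> i"
      using \<kappa>[OF i(1)] permutes_image[OF p] by (metis atLeastLessThan_iff imageE zero_le)
    then have "i' \<noteq> i" using i by auto
    then have "f i' (p i') = 0" "g i' (p i') = 0" using f0 g0 i i' by auto
    then have "(\<Prod>i = 0..<k. f i (p i)) = 0" "(\<Prod>i = 0..<k. g i (p i)) = 0"
      using i'(1) by (auto intro!: prod_zero)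
    then show ?thesis by simp
  qed
  then show ?thesis unfolding fdet_leibniz by (intro sum.cong) auto
qed

text \<open>Frobenius-Koenig: by pigeonhole every permutation sends some row of \<open>R\<close>
  into \<open>C\<close>, so each Leibniz term has a zero factor.\<close>

lemma fdet_zero_block:
  assumes R: "R \<subseteq> {0..<k}" and C: "C \<subseteq> {0..<k}" and card: "k < card R + card C"
    and zero: "\<And>i j. i \<in> R \<Longrightarrow> j \<in> C \<Longrightarrow> f i j = 0"
  shows "fdet k f = 0"
proof -
  have fin: "finite R" "finite C" using R C finite_subset by blast+
  have "(\<Prod>i = 0..<k. f i (p i)) = 0" if p: "p permutes {0..<k}" for p
  proof -
    have "\<not> p ` R \<subseteq> {0..<k} - C"
    proof
      assume "p ` R \<subseteq> {0..<k} - C"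
      then have "card (p ` R) \<le> k - card C"
        using C fin card_mono[of "{0..<k} - C"] by (simp add: card_Diff_subset)
      moreover have "card (p ` R) = card R"
        by (rule card_image) (use permutes_inj_on[OF p] in blast)
      moreover have "card C \<le> k" using C card_mono[of "{0..<k}" C] by simp
      ultimately show False using card by linarith
    qed
    then obtain i where "i \<in> R" "p i \<in> C" using R permutes_in_image[OF p] by blast
    then show ?thesis using zero R by (intro prod_zero) auto
  qed
  then show ?thesis unfolding fdet_leibniz by simp
qed

text \<open>The sign of the matching \<open>t\<close> is written as a product over inversions so
  that it can later be regrouped path by path.\<close>

lemma fdet_permutation:
  fixes t e :: "nat \<Rightarrow> 'b::linorder"
  assumes "inj_on t {..<k}" "strict_mono_on {..<k} e" "t ` {..<k} = e ` {..<k}"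
  shows "fdet k (\<lambda>i j. if t i = e j then 1 else 0) =
    (\<Prod>i<k. \<Prod>i'<i. if t i < t i' then - 1 else 1)"
  using assms
proof (induction k arbitrary: e)
  case 0
  then show ?case by (simp add: fdet_def)
next
  case (Suc k)
  let ?X = "mat (Suc k) (Suc k) (\<lambda>(i, j). if t i = e j then 1 else 0 :: 'a)"
  have inj_e: "inj_on e {..<Suc k}" using Suc.prems(2) by (rule strict_mono_on_imp_inj_on)
  obtain c where c: "c < Suc k" "t k = e c" using Suc.prems(3) by blast
  have only: "j = c" if "j < Suc k" "t k = e j" for j
    using inj_e c that by (metis inj_onD lessThan_iff)
  have mono: "e i < e j \<longleftrightarrow> i < j" if "i < Suc k" "j < Suc k" for i j
    using strict_mono_onD[OF Suc.prems(2)] that by (metis lessThan_iff linorder_neqE order.asym)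
  \<comment> \<open>\<open>e'\<close> lists the values of the columns that remain when column
    \<open>c\<close> is deleted.\<close>
  define e' where "e' = (\<lambda>j. e (if j < c then j else Suc j))"
  have sm': "strict_mono_on {..<k} e'"
    by (rule strict_mono_onI) (auto simp: e'_def mono)
  have "e' ` {..<k} = e ` ({..<Suc k} - {c})"
  proof -
    have "(\<lambda>j. if j < c then j else Suc j) ` {..<k} = {..<Suc k} - {c}"
    proof (intro equalityI subsetI)
      fix j assume "j \<in> {..<Suc k} - {c}"
      then show "j \<in> (\<lambda>j. if j < c then j else Suc j) ` {..<k}"
        using c by (intro image_eqI[of _ _ "if j < c then j else j - 1"]) auto
    qed (use c in auto)
    then show ?thesis unfolding e'_def by (metis image_image)
  qed
  also have "\<dots> = t ` {..<Suc k} - {t k}"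
    using inj_e c Suc.prems(3) by (subst inj_on_image_set_diff[of e "{..<Suc k}"]) auto
  also have "\<dots> = t ` {..<k}"
    using Suc.prems(1) by (auto simp: lessThan_Suc inj_on_def)
  finally have img': "t ` {..<k} = e' ` {..<k}" ..
  \<comment> \<open>The earlier values exceeding \<open>t k\<close> correspond to the columns right
    of \<open>c\<close>, so the cofactor sign accounts for exactly the inversions with the last
    row.\<close>
  have "card {i\<in>{..<k}. t k < t i} = card {j\<in>{..<Suc k}. c < j}"
  proof -
    have inj: "inj_on t {i\<in>{..<k}. t k < t i}" "inj_on e {j\<in>{..<Suc k}. c < j}"
      using Suc.prems(1) inj_e by (auto simp: inj_on_def)
    have "t ` {i\<in>{..<k}. t k < t i} = {x \<in> t ` {..<Suc k}. t k < x}"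
      by (auto simp: less_Suc_eq)
    also have "\<dots> = e ` {j\<in>{..<Suc k}. c < j}"
      unfolding Suc.prems(3) c(2) using c mono by auto
    finally show ?thesis using card_image[OF inj(1)] card_image[OF inj(2)] by simp
  qed
  also have "{j\<in>{..<Suc k}. c < j} = {Suc c..<Suc k}" by auto
  finally have inv: "card {i\<in>{..<k}. t k < t i} = k - c" by simp
  have "fdet (Suc k) (\<lambda>i j. if t i = e j then 1 else 0) = (\<Sum>j<Suc k. ?X $$ (k, j) * cofactor ?X k j)"
    unfolding fdet_def by (rule laplace_expansion_row) auto
  also have "\<dots> = (\<Sum>j<Suc k. if j = c then cofactor ?X k j else 0)"
    by (intro sum.cong refl) (use only c in auto)
  also have "\<dots> = cofactor ?X k c" using c by (simp del: sum.lessThan_Suc)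
  also have "\<dots> = (-1) ^ (k + c) * fdet k (\<lambda>i j. if t i = e' j then 1 else 0)"
  proof -
    have "mat_delete ?X k c = mat k k (\<lambda>(i, j). if t i = e' j then 1 else 0)"
      by (auto intro!: eq_matI simp: mat_delete_def e'_def)
    then show ?thesis by (simp add: cofactor_def fdet_def)
  qed
  also have "fdet k (\<lambda>i j. if t i = e' j then 1 else 0 :: 'a) =
      (\<Prod>i<k. \<Prod>i'<i. if t i < t i' then - 1 else 1)"
    by (rule Suc.IH) (use Suc.prems(1) sm' img' in \<open>auto simp: inj_on_def\<close>)
  also have "(-1) ^ (k + c) = (\<Prod>i'<k. if t k < t i' then - 1 else 1 :: 'a)"
  proof -
    have "(-1::'a) ^ (k + c) = (-1) ^ (k - c)"
      using c by (simp add: minus_one_power_iff)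
    also have "\<dots> = (\<Prod>i'\<in>{i\<in>{..<k}. t k < t i}. - 1)" using inv by simp
    also have "\<dots> = (\<Prod>i'<k. if t k < t i' then - 1 else 1)"
      by (rule prod.inter_filter) simp
    finally show ?thesis .
  qed
  finally show ?case by (simp add: mult.commute)
qed

lemma fdet_mult:
  "fdet k (\<lambda>i j. \<Sum>l<k. f i l * g l j) = fdet k f * fdet k g"
proof -
  have "fdet k f * fdet k g = det (mat k k (\<lambda>(i, j). f i j) * mat k k (\<lambda>(i, j). g i j))"
    unfolding fdet_def by (rule det_mult[symmetric]) auto
  also have "mat k k (\<lambda>(i, j). f i j) * mat k k (\<lambda>(i, j). g i j) = mat k k (\<lambda>(i, j). \<Sum>l<k. f i l * g l j)"
    by (auto intro!: eq_matI simp: scalar_prod_def atLeast0LessThan)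
  finally show ?thesis by (simp add: fdet_def)
qed

section \<open>The Lindstroem-Gessel-Viennot lemma\<close>

fun walk_weight :: "('v \<Rightarrow> 'v \<Rightarrow> 'a) \<Rightarrow> 'v list \<Rightarrow> 'a::comm_monoid_mult" where
  "walk_weight w (u # v # p) = w u v * walk_weight w (v # p)"
| "walk_weight w p = 1"

definition walks :: "('v \<times> 'v) set \<Rightarrow> 'v set \<Rightarrow> 'v \<Rightarrow> 'v list set" where
  "walks E Z u = {p. p \<noteq> [] \<and> hd p = u \<and> successively (\<lambda>a b. (a, b) \<in> E) p \<and> last p \<in> Z}"

text \<open>Endpoints need only lie in \<open>Z\<close>; disjointness keeps them distinct. Which
  walk ends where is left open, so the sign of the matching has to be recovered separately.\<close>

definition walk_families ::
    "('v \<times> 'v) set \<Rightarrow> 'v set \<Rightarrow> 'i set \<Rightarrow> ('i \<Rightarrow> 'v) \<Rightarrow> ('i \<Rightarrow> 'v list) set" where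
  "walk_families E Z I u = {A \<in> extensional I.
     (\<forall>i\<in>I. A i \<in> walks E Z (u i)) \<and> disjoint_family_on (\<lambda>i. set (A i)) I}"

lemma walks_start: "p \<in> walks E Z u \<Longrightarrow> u \<in> set p"
  unfolding walks_def using hd_in_set by fastforce

lemma walks_step:
  "walks E Z u = (if u \<in> Z then {[u]} else {}) \<union> (\<Union>v\<in>{v. (u, v) \<in> E}. Cons u ` walks E Z v)"
proof (intro equalityI subsetI)
  fix p assume p: "p \<in> walks E Z u"
  then obtain q where q: "p = u # q" by (cases p) (auto simp: walks_def)
  show "p \<in> (if u \<in> Z then {[u]} else {}) \<union> (\<Union>v\<in>{v. (u, v) \<in> E}. Cons u ` walks E Z v)"
  proof (cases q)
    case Nil
    then show ?thesis using p q by (auto simp: walks_def)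
  next
    case (Cons v q')
    then have "(u, v) \<in> E" "q \<in> walks E Z v" using p q by (auto simp: walks_def)
    then show ?thesis using q by auto
  qed
next
  fix p assume "p \<in> (if u \<in> Z then {[u]} else {}) \<union> (\<Union>v\<in>{v. (u, v) \<in> E}. Cons u ` walks E Z v)"
  then show "p \<in> walks E Z u"
    by (auto simp: walks_def successively_Cons split: if_splits)
qed

text \<open>The decreasing rank excludes cycles; with finite branching it makes the set of walks
  finite and supports induction on the rank of the start.\<close>

locale ranked_digraph =
  fixes E :: "('v \<times> 'v) set" and rk :: "'v \<Rightarrow> nat"
  assumes finite_succ: "finite {v. (u, v) \<in> E}"
    and rk_less: "(u, v) \<in> E \<Longrightarrow> rk v < rk u"
begin

lemma finite_walks: "finite (walks E Z u)"
proof (induction "rk u" arbitrary: u rule: less_induct)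
  case less
  then show ?case
    by (subst walks_step) (auto intro!: finite_UN_I finite_succ rk_less)
qed

lemma walk_rk: "p \<in> walks E Z u \<Longrightarrow> x \<in> set p \<Longrightarrow> x = u \<or> rk x < rk u"
proof (induction p arbitrary: u)
  case Nil
  then show ?case by simp
next
  case (Cons a p)
  from Cons.prems(1) have a: "a = u" by (auto simp: walks_def)
  show ?case
  proof (cases p)
    case Nil
    then show ?thesis using Cons.prems a by simp
  next
    case (Cons b q)
    then have "p \<in> walks E Z b" "(u, b) \<in> E" using Cons.prems(1) a by (auto simp: walks_def)
    then show ?thesis using Cons.IH[of b] Cons.prems(2) a rk_less[of u b] by auto
  qed
qed

lemma finite_walk_families:
  assumes "finite I"
  shows "finite (walk_families E Z I u)"
proof (rule finite_subset)
  show "walk_families E Z I u \<subseteq> PiE I (\<lambda>i. walks E Z (u i))"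
    by (auto simp: walk_families_def PiE_def Pi_def)
  show "finite (PiE I (\<lambda>i. walks E Z (u i)))"
    using assms finite_walks by (intro finite_PiE) auto
qed

end

locale terminal_digraph = ranked_digraph +
  fixes Z :: "'v set"
  assumes terminal: "(u, v) \<in> E \<Longrightarrow> u \<notin> Z"
begin

lemma walks_terminal: "u \<in> Z \<Longrightarrow> walks E Z u = {[u]}"
  using terminal by (subst walks_step) auto

text \<open>Prepending \<open>u i\<close> creates no intersection: ranks decrease along walks and
  starts are distinct, so another walk through \<open>u i\<close> would start at a nonterminal
  vertex of larger rank, against \<open>max\<close>.\<close>

lemma walk_families_step:
  assumes I: "i \<in> I" "u i \<notin> Z" and v: "(u i, v) \<in> E"
    and B: "B \<in> walk_families E Z I (u(i := v))"
    and inj: "inj_on u I" and max: "\<And>j. j \<in> I \<Longrightarrow> u j \<notin> Z \<Longrightarrow> rk (u j) \<le> rk (u i)"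
  shows "B(i := u i # B i) \<in> walk_families E Z I u"
proof -
  have Bw: "B j \<in> walks E Z ((u(i := v)) j)" if "j \<in> I" for j
    using B that by (simp add: walk_families_def)
  have Bi: "B i \<in> walks E Z v" using Bw[OF I(1)] by simp
  have dis: "set (B j) \<inter> set (B j') = {}" if "j \<in> I" "j' \<in> I" "j \<noteq> j'" for j j'
    using B that by (auto simp: walk_families_def disjoint_family_on_def)
  have notin: "u i \<notin> set (B j)" if j: "j \<in> I" "j \<noteq> i" for j
  proof
    assume mem: "u i \<in> set (B j)"
    have Bj: "B j \<in> walks E Z (u j)" using Bw[OF j(1)] j(2) by simp
    have ne: "u i \<noteq> u j" using inj I(1) j by (auto dest: inj_onD)
    then have "rk (u i) < rk (u j)" using walk_rk[OF Bj mem] by simp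
    moreover have "u j \<notin> Z"
      using Bj mem ne walks_terminal[of "u j"] by (cases "u j \<in> Z") auto
    ultimately show False using max[OF j(1)] by simp
  qed
  have "u i # B i \<in> walks E Z (u i)" using Bi v walks_step[of E Z "u i"] by blast
  moreover have "disjoint_family_on (\<lambda>j. set ((B(i := u i # B i)) j)) I"
    unfolding disjoint_family_on_def
  proof (intro ballI impI)
    fix j j' assume j: "j \<in> I" "j' \<in> I" "j \<noteq> j'"
    consider "j = i" | "j' = i" | "j \<noteq> i" "j' \<noteq> i" by blast
    then show "set ((B(i := u i # B i)) j) \<inter> set ((B(i := u i # B i)) j') = {}"
      using j dis[OF j] notin[OF j(1)] notin[OF j(2)] by cases auto
  qed
  moreover have "B(i := u i # B i) \<in> extensional I"
    using B I(1) by (auto simp: walk_families_def extensional_def)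
  moreover have "B j \<in> walks E Z (u j)" if "j \<in> I" "j \<noteq> i" for j
    using Bw[OF that(1)] that(2) by simp
  ultimately show ?thesis by (simp add: walk_families_def)
qed

lemma walk_families_tl:
  assumes I: "i \<in> I" "u i \<notin> Z" and A: "A \<in> walk_families E Z I u"
  shows "(u i, hd (tl (A i))) \<in> E" "A(i := tl (A i)) \<in> walk_families E Z I (u(i := hd (tl (A i))))"
    "A i = u i # tl (A i)" "tl (A i) \<noteq> []"
proof -
  have "A i \<in> walks E Z (u i)" using A I(1) by (simp add: walk_families_def)
  then obtain v q where v: "(u i, v) \<in> E" "q \<in> walks E Z v" "A i = u i # q"
    using walks_step[of E Z "u i"] I(2) by auto
  have "hd q = v" "q \<noteq> []" using v(2) by (auto simp: walks_def)
  then show "(u i, hd (tl (A i))) \<in> E" "A i = u i # tl (A i)" "tl (A i) \<noteq> []" using v by auto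
  have "disjoint_family_on (\<lambda>j. set ((A(i := tl (A i))) j)) I"
    using A v(3) by (fastforce simp: walk_families_def disjoint_family_on_def)
  then show "A(i := tl (A i)) \<in> walk_families E Z I (u(i := hd (tl (A i))))"
    using A v \<open>hd q = v\<close> I(1) by (auto simp: walk_families_def extensional_def)
qed

text \<open>
  Induction on the total rank of the starting points: expanding the row of a nonterminal starting
  point of maximal rank moves it to a successor, and no other path can return to the vertex it left.
  This avoids the usual sign-reversing involution.
\<close>

theorem lgv:
  fixes w :: "'v \<Rightarrow> 'v \<Rightarrow> 'a::comm_ring_1" and \<phi> :: "'v \<Rightarrow> nat \<Rightarrow> 'a"
  assumes \<kappa>: "bij_betw \<kappa> {..<k} I"
    and \<phi>: "\<And>u c. u \<notin> Z \<Longrightarrow> c < k \<Longrightarrow> \<phi> u c = (\<Sum>v | (u, v) \<in> E. w u v * \<phi> v c)"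
  shows "fdet k (\<lambda>r. \<phi> (u (\<kappa> r))) =
    (\<Sum>A\<in>walk_families E Z I u. (\<Prod>i\<in>I. walk_weight w (A i)) * fdet k (\<lambda>r. \<phi> (last (A (\<kappa> r)))))"
proof (induction "\<Sum>i\<in>I. rk (u i)" arbitrary: u rule: less_induct)
  case less
  have finI: "finite I" using \<kappa> bij_betw_finite by blast
  have \<kappa>I: "r < k \<Longrightarrow> \<kappa> r \<in> I" for r using \<kappa> by (auto dest: bij_betwE)
  consider (coll) "\<not> inj_on u I" | (ends) "inj_on u I" "\<forall>i\<in>I. u i \<in> Z" | (step) "inj_on u I" "\<exists>i\<in>I. u i \<notin> Z" by blast
  then show ?case
  proof cases
    \<comment> \<open>Equal starting points give equal rows, and no two walks from one vertex are
      disjoint: both sides vanish.\<close>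
    case coll
    then obtain i j where ij: "i \<in> I" "j \<in> I" "i \<noteq> j" "u i = u j" by (auto simp: inj_on_def)
    obtain r s where rs: "r < k" "s < k" "\<kappa> r = i" "\<kappa> s = j"
      using ij(1,2) \<kappa> by (auto simp: bij_betw_def)
    have "fdet k (\<lambda>r. \<phi> (u (\<kappa> r))) = 0"
      by (rule fdet_identical_rows[of r k s]) (use rs ij in auto)
    moreover have "walk_families E Z I u = {}"
    proof (rule equals0I)
      fix A assume A: "A \<in> walk_families E Z I u"
      then have "A i \<in> walks E Z (u i)" "A j \<in> walks E Z (u i)" using ij by (auto simp: walk_families_def)
      then have "u i \<in> set (A i) \<inter> set (A j)" by (auto dest: walks_start)
      then show False using A ij by (auto simp: walk_families_def disjoint_family_on_def)
    qed
    ultimately show ?thesis by simp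
  next
    case ends
    have "walk_families E Z I u = {\<lambda>i\<in>I. [u i]}"
    proof (intro equalityI subsetI)
      fix A assume "A \<in> walk_families E Z I u"
      then have "A = (\<lambda>i\<in>I. [u i])"
        using ends walks_terminal by (intro extensionalityI[of _ I]) (auto simp: walk_families_def)
      then show "A \<in> {\<lambda>i\<in>I. [u i]}" by simp
    next
      fix A assume "A \<in> {\<lambda>i\<in>I. [u i]}"
      then show "A \<in> walk_families E Z I u"
        using ends walks_terminal
        by (auto simp: walk_families_def disjoint_family_on_def inj_on_def)
    qed
    moreover have "(\<Prod>i\<in>I. walk_weight w ((\<lambda>i\<in>I. [u i]) i)) = 1" by (intro prod.neutral) auto
    moreover have "fdet k (\<lambda>r. \<phi> (last ((\<lambda>i\<in>I. [u i]) (\<kappa> r)))) = fdet k (\<lambda>r. \<phi> (u (\<kappa> r)))"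
      using \<kappa>I by (intro fdet_cong) auto
    ultimately show ?thesis by simp
  next
    case step
    let ?N = "{i\<in>I. u i \<notin> Z}"
    have "finite ?N" "?N \<noteq> {}" using finI step(2) by auto
    then have "Max ((\<lambda>i. rk (u i)) ` ?N) \<in> (\<lambda>i. rk (u i)) ` ?N" by (intro Max_in) blast+
    then obtain i where i0: "i \<in> ?N" "Max ((\<lambda>i. rk (u i)) ` ?N) = rk (u i)" by (elim imageE)
    then have i: "i \<in> I" "u i \<notin> Z" by auto
    have max: "rk (u j) \<le> rk (u i)" if "j \<in> I" "u j \<notin> Z" for j
      using Max_ge[of "(\<lambda>i. rk (u i)) ` ?N" "rk (u j)"] \<open>finite ?N\<close> that i0(2) by auto
    obtain r where r: "r < k" "\<kappa> r = i" using i(1) \<kappa> by (auto simp: bij_betw_def)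
    let ?S = "{v. (u i, v) \<in> E}"
    let ?F = "\<lambda>u. walk_families E Z I u"
    let ?wt = "\<lambda>A. \<Prod>i\<in>I. walk_weight w (A i)"
    let ?d = "\<lambda>A. fdet k (\<lambda>r. \<phi> (last (A (\<kappa> r))))"
    have upd: "((\<lambda>r. \<phi> (u (\<kappa> r)))(r := \<phi> v)) s c = \<phi> ((u(i := v)) (\<kappa> s)) c" if "s < k" for v s c
      using that r \<kappa> by (auto simp: bij_betw_def inj_on_def)
    have "fdet k (\<lambda>r. \<phi> (u (\<kappa> r))) = (\<Sum>v\<in>?S. w (u i) v * fdet k ((\<lambda>r. \<phi> (u (\<kappa> r)))(r := \<phi> v)))"
      by (rule fdet_row_sum) (use r i \<phi> in auto)
    also have "\<dots> = (\<Sum>v\<in>?S. w (u i) v * fdet k (\<lambda>r. \<phi> ((u(i := v)) (\<kappa> r))))"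
      by (intro sum.cong refl arg_cong2[of _ _ _ _ "(*)"] fdet_cong) (simp only: upd)
    also have "\<dots> = (\<Sum>v\<in>?S. w (u i) v * (\<Sum>A\<in>?F (u(i := v)). ?wt A * ?d A))"
    proof (intro sum.cong refl arg_cong2[of _ _ _ _ "(*)"])
      fix v assume v: "v \<in> ?S"
      have "(\<Sum>j\<in>I. rk ((u(i := v)) j)) < (\<Sum>j\<in>I. rk (u j))"
        using finI i(1) v rk_less by (intro sum_strict_mono_ex1) (auto intro: less_imp_le)
      then show "fdet k (\<lambda>r. \<phi> ((u(i := v)) (\<kappa> r))) = (\<Sum>A\<in>?F (u(i := v)). ?wt A * ?d A)"
        by (rule less)
    qed
    also have "\<dots> = (\<Sum>v\<in>?S. \<Sum>A\<in>?F (u(i := v)). w (u i) v * (?wt A * ?d A))"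
      by (simp add: sum_distrib_left)
    also have "\<dots> = (\<Sum>(v, A)\<in>(SIGMA v:?S. ?F (u(i := v))). w (u i) v * (?wt A * ?d A))"
      by (rule sum.Sigma) (use finite_succ finite_walk_families finI in auto)
    \<comment> \<open>The bijection restores or detaches the first vertex of walk \<open>i\<close>;
      its first edge carries the factor \<open>w (u i) v\<close>.\<close>
    also have "\<dots> = (\<Sum>A\<in>?F u. ?wt A * ?d A)"
    proof (rule sum.reindex_bij_witness[where
        i = "\<lambda>A. (hd (tl (A i)), A(i := tl (A i)))" and j = "\<lambda>(v, A). A(i := u i # A i)"], goal_cases)
      case (1 a)
      then obtain v B where a: "a = (v, B)" "(u i, v) \<in> E" "B \<in> ?F (u(i := v))" by auto
      then have "B i \<in> walks E Z v" using i(1) by (auto simp: walk_families_def)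
      then show ?case using a by (auto simp: walks_def)
    next
      case (2 a)
      then obtain v B where a: "a = (v, B)" "(u i, v) \<in> E" "B \<in> ?F (u(i := v))" by auto
      then show ?case using walk_families_step[OF i a(2,3) step(1) max] by simp
    next
      case (3 A)
      then show ?case using walk_families_tl(3)[OF i 3] by auto
    next
      case (4 A)
      then show ?case using walk_families_tl(1,2)[OF i 4] by auto
    next
      case (5 a)
      then obtain v B where a: "a = (v, B)" "(u i, v) \<in> E" "B \<in> ?F (u(i := v))" by auto
      then have "B i \<in> walks E Z v" using i(1) by (auto simp: walk_families_def)
      then obtain q where q: "B i = v # q" by (cases "B i") (auto simp: walks_def)
      have "?wt (B(i := u i # B i)) = w (u i) v * ?wt B"
        using finI i(1) by (simp add: prod.remove q mult.assoc)
      moreover have "?d (B(i := u i # B i)) = ?d B"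
        using q by (intro fdet_cong) auto
      ultimately show ?case using a(1) by (simp add: mult.assoc)
    qed
    finally show ?thesis .
  qed
qed

end

section \<open>Le-diagrams\<close>

lemma down_closed_interval:
  fixes S :: "nat set"
  assumes "finite S" "0 \<notin> S" "\<And>r s. s \<in> S \<Longrightarrow> 1 \<le> r \<Longrightarrow> r \<le> s \<Longrightarrow> r \<in> S"
  shows "S = {1..card S}"
proof (cases "S = {}")
  case False
  have "S = {1..Max S}"
    using assms Max_in[OF assms(1) False] Max_ge[OF assms(1)]
    by (auto simp: Suc_le_eq intro: gr0I)
  then show ?thesis by (metis card_atLeastAtMost diff_Suc_1 One_nat_def)
qed simp

lemma pairs_append:
  assumes "xs \<noteq> []" "ys \<noteq> []"
  shows "set (zip (xs @ ys) (tl (xs @ ys))) =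
    set (zip xs (tl xs)) \<union> {(last xs, hd ys)} \<union> set (zip ys (tl ys))"
  using assms(1)
proof (induction xs rule: list_nonempty_induct)
  case (single x)
  then show ?case using assms(2) by (cases ys) auto
next
  case (cons x xs)
  then show ?case by (cases xs) auto
qed

lemma pairs_map_upt: "set (zip (map f [a..<b]) (tl (map f [a..<b]))) = {(f i, f (Suc i)) |i. a \<le> i \<and> Suc i < b}"
proof (cases "a < b")
  case True
  have "set (zip [a..<b] (tl [a..<b])) = {(i, Suc i) |i. a \<le> i \<and> Suc i < b}"
    using True
  proof (induction "b - a" arbitrary: a)
    case (Suc m)
    show ?case
    proof (cases "Suc a < b")
      case True
      then have "[a..<b] = a # Suc a # [Suc (Suc a)..<b]" by (simp add: upt_conv_Cons)
      moreover have "set (zip [Suc a..<b] (tl [Suc a..<b])) = {(i, Suc i) |i. Suc a \<le> i \<and> Suc i < b}"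
        using Suc True by (intro Suc(1)) auto
      moreover have "[Suc a..<b] = Suc a # [Suc (Suc a)..<b]" using True by (simp add: upt_conv_Cons)
      ultimately have "set (zip [a..<b] (tl [a..<b])) = insert (a, Suc a) {(i, Suc i) |i. Suc a \<le> i \<and> Suc i < b}"
        by simp
      also have "\<dots> = {(i, Suc i) |i. a \<le> i \<and> Suc i < b}"
        using True by (auto simp: Suc_le_eq le_less)
      finally show ?thesis .
    next
      case False
      then have "[a..<b] = [a]" using Suc by (simp add: upt_conv_Cons)
      then show ?thesis using False by auto
    qed
  qed simp
  then have "(\<lambda>(x, y). (f x, f y)) ` set (zip [a..<b] (tl [a..<b])) = {(f i, f (Suc i)) |i. a \<le> i \<and> Suc i < b}"
    by force
  then show ?thesis by (simp add: map_tl[symmetric] zip_map_map del: map_tl)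
qed simp

section \<open>Shape and border labels of a fixed Le-diagram\<close>

locale le_filling =
  fixes L :: le_diagram
  assumes le: "is_le_diagram L"
begin

text \<open>Columns are numbered from the right, so this is the rightmost box of row
  \<open>r\<close>, where hooks enter from the source. For an empty row it is one more than the
  number of columns.\<close>

definition first_col :: "nat \<Rightarrow> nat" where
  "first_col r = Suc (num_cols L - shape L r)"

lemma box_iff:
  "(r, c) \<in> boxes L \<longleftrightarrow> r \<in> {1..num_rows L} \<and> c \<in> {1..num_cols L} \<and> first_col r \<le> c"
  by (auto simp: boxes_def first_col_def)

lemma plus_box: "B \<in> pluses L \<Longrightarrow> B \<in> boxes L"
  using le by (auto simp: is_le_diagram_def)

lemma first_col_mono: "1 \<le> r \<Longrightarrow> r \<le> s \<Longrightarrow> s \<le> num_rows L \<Longrightarrow> first_col r \<le> first_col s"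
proof -
  assume "1 \<le> r" "r \<le> s" "s \<le> num_rows L"
  then have "shape L s \<le> shape L r" using le by (auto simp: is_le_diagram_def)
  then show ?thesis unfolding first_col_def by simp
qed

lemma boxes_northwest:
  "(s, d) \<in> boxes L \<Longrightarrow> 1 \<le> r \<Longrightarrow> r \<le> s \<Longrightarrow> d \<le> c \<Longrightarrow> c \<le> num_cols L \<Longrightarrow> (r, c) \<in> boxes L"
  using first_col_mono[of r s] by (auto simp: box_iff)

text \<open>The Le-condition in the form used below: where a column line coming from a
  \<open>+\<close> meets a row line leading to a \<open>+\<close>, there is a
  \<open>+\<close>.\<close>

lemma plus_corner:
  assumes "(s, d) \<in> boxes L" "(r, d) \<in> pluses L" "r \<le> s" "(s, c) \<in> pluses L" "d \<le> c"
  shows "(s, d) \<in> pluses L"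
proof (rule ccontr)
  assume n: "(s, d) \<notin> pluses L"
  then have "r \<noteq> s" "d \<noteq> c" using assms by auto
  then have "r < s" "d < c" using assms by auto
  then show False using n assms(1,2,4) le unfolding is_le_diagram_def by blast
qed

lemma col_height_set:
  assumes "c \<in> {1..num_cols L}"
  shows "{r. (r, c) \<in> boxes L} = {1..col_height L c}"
  unfolding col_height_def
proof (rule down_closed_interval)
  show "finite {r. (r, c) \<in> boxes L}"
    by (rule finite_subset[of _ "{1..num_rows L}"]) (auto simp: box_iff)
  show "0 \<notin> {r. (r, c) \<in> boxes L}" by (simp add: box_iff)
  fix r s assume "s \<in> {r. (r, c) \<in> boxes L}" "1 \<le> r" "r \<le> s"
  then show "r \<in> {r. (r, c) \<in> boxes L}"
    using boxes_northwest[of s c r c] by (auto simp: box_iff)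
qed

lemma box_col_height:
  "(r, c) \<in> boxes L \<longleftrightarrow> c \<in> {1..num_cols L} \<and> r \<in> {1..col_height L c}"
proof (cases "c \<in> {1..num_cols L}")
  case True
  have "r \<in> {r. (r, c) \<in> boxes L} \<longleftrightarrow> r \<in> {1..col_height L c}"
    by (simp only: col_height_set[OF True])
  then show ?thesis using True by simp
qed (auto simp: box_iff)

lemma col_height_le: "c \<in> {1..num_cols L} \<Longrightarrow> col_height L c \<le> num_rows L"
proof -
  assume c: "c \<in> {1..num_cols L}"
  show ?thesis
  proof (cases "col_height L c = 0")
    case False
    then have "(col_height L c, c) \<in> boxes L" using c box_col_height by auto
    then show ?thesis by (simp add: box_iff)
  qed simp
qed

lemma col_height_mono:
  assumes "1 \<le> c" "c \<le> d" "d \<le> num_cols L"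
  shows "col_height L c \<le> col_height L d"
proof (cases "col_height L c = 0")
  case False
  then have "(col_height L c, c) \<in> boxes L" using assms box_col_height by auto
  then have "(col_height L c, d) \<in> boxes L"
    using assms boxes_northwest[of _ c] by (auto simp: box_iff)
  then show ?thesis by (simp add: box_col_height)
qed simp

lemma rows_cols: "num_rows L + num_cols L = num_steps L"
  using le by (auto simp: is_le_diagram_def num_cols_def)

lemma source_eq: "Suc (source L r) = first_col r + r"
  by (simp add: source_def first_col_def)

lemma source_less: "1 \<le> r \<Longrightarrow> r < s \<Longrightarrow> s \<le> num_rows L \<Longrightarrow> source L r < source L s"
  using first_col_mono[of r s] source_eq[of r] source_eq[of s] by linarith

lemma sink_less: "1 \<le> c \<Longrightarrow> c < d \<Longrightarrow> d \<le> num_cols L \<Longrightarrow> sink L c < sink L d"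
  using col_height_mono[of c d] by (simp add: sink_def)

lemma source_less_iff:
  "r \<in> {1..num_rows L} \<Longrightarrow> s \<in> {1..num_rows L} \<Longrightarrow> source L r < source L s \<longleftrightarrow> r < s"
  using source_less[of r s] source_less[of s r] by (cases r s rule: linorder_cases) auto

lemma sink_less_iff:
  "c \<in> {1..num_cols L} \<Longrightarrow> d \<in> {1..num_cols L} \<Longrightarrow> sink L c < sink L d \<longleftrightarrow> c < d"
  using sink_less[of c d] sink_less[of d c] by (cases c d rule: linorder_cases) auto

lemma source_eq_iff:
  "r \<in> {1..num_rows L} \<Longrightarrow> s \<in> {1..num_rows L} \<Longrightarrow> source L r = source L s \<longleftrightarrow> r = s"
  using source_less[of r s] source_less[of s r] by (cases r s rule: linorder_cases) auto

lemma sink_eq_iff: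
  "c \<in> {1..num_cols L} \<Longrightarrow> d \<in> {1..num_cols L} \<Longrightarrow> sink L c = sink L d \<longleftrightarrow> c = d"
  using sink_less[of c d] sink_less[of d c] by (cases c d rule: linorder_cases) auto

lemma box_source_sink:
  assumes "r \<in> {1..num_rows L}" "c \<in> {1..num_cols L}"
  shows "(r, c) \<in> boxes L \<longleftrightarrow> source L r < sink L c"
    and "(r, c) \<notin> boxes L \<longleftrightarrow> sink L c < source L r"
proof -
  have 1: "source L r < sink L c" if "(r, c) \<in> boxes L"
  proof -
    have "first_col r \<le> c" "r \<le> col_height L c" using that box_iff[of r c] box_col_height[of r c] by simp_all
    then show ?thesis using source_eq[of r] by (simp add: sink_def)
  qed
  have 2: "sink L c < source L r" if "(r, c) \<notin> boxes L"
  proof -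
    have "c < first_col r" "col_height L c < r" using that assms box_iff[of r c] box_col_height[of r c] by simp_all
    then show ?thesis using source_eq[of r] by (simp add: sink_def)
  qed
  show "(r, c) \<in> boxes L \<longleftrightarrow> source L r < sink L c" "(r, c) \<notin> boxes L \<longleftrightarrow> sink L c < source L r"
    using 1 2 by fastforce+
qed

lemma source_neq_sink: "r \<in> {1..num_rows L} \<Longrightarrow> c \<in> {1..num_cols L} \<Longrightarrow> source L r \<noteq> sink L c"
  using box_source_sink[of r c] by auto

lemma source_inj: "inj_on (source L) {1..num_rows L}"
  by (simp add: inj_on_def source_eq_iff)

lemma sink_inj: "inj_on (sink L) {1..num_cols L}"
  by (simp add: inj_on_def sink_eq_iff)

lemma finite_sources: "finite (sources L)" by (simp add: sources_def)

lemma card_sources: "card (sources L) = num_rows L"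
  unfolding sources_def by (subst card_image[OF source_inj]) simp

lemma sink_not_source: "c \<in> {1..num_cols L} \<Longrightarrow> sink L c \<notin> sources L"
  using source_neq_sink by (fastforce simp: sources_def)

text \<open>Both labellings are injective with disjoint images, so \<open>k + (n - k)\<close> labels
  fill \<open>{1..n}\<close>.\<close>

lemma sources_sinks: "sources L \<union> sink L ` {1..num_cols L} = {1..num_steps L}"
proof (rule card_subset_eq)
  have "source L r \<in> {1..num_steps L}" if "r \<in> {1..num_rows L}" for r
    using that rows_cols by (auto simp: source_def)
  moreover have "sink L c \<in> {1..num_steps L}" if "c \<in> {1..num_cols L}" for c
    using that rows_cols col_height_le[OF that] by (auto simp: sink_def)
  ultimately show "sources L \<union> sink L ` {1..num_cols L} \<subseteq> {1..num_steps L}"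
    by (auto simp: sources_def)
  have "card (sources L \<union> sink L ` {1..num_cols L}) = num_rows L + num_cols L"
    using sink_not_source by (subst card_Un_disjoint)
      (auto simp: finite_sources card_sources card_image[OF sink_inj[unfolded One_nat_def]])
  then show "card (sources L \<union> sink L ` {1..num_cols L}) = card {1..num_steps L}"
    using rows_cols by simp
qed simp

lemma label_cases:
  assumes "j \<in> {1..num_steps L}"
  obtains (source) r where "r \<in> {1..num_rows L}" "j = source L r"
    | (sink) c where "c \<in> {1..num_cols L}" "j = sink L c" "j \<notin> sources L"
proof -
  have "j \<in> sources L \<union> sink L ` {1..num_cols L}" using assms sources_sinks by simp
  then show thesis using that sink_not_source unfolding sources_def by blast
qed

section \<open>Paths in the \<open>\<Gamma>\<close>-graph\<close>

text \<open>The unit steps between boxes that lie on some hook, with the hook quantified away: a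
  west step needs a \<open>+\<close> strictly further west, a south step a \<open>+\<close> weakly
  above. Column numbers grow to the west.\<close>

definition box_step :: "nat \<times> nat \<Rightarrow> nat \<times> nat \<Rightarrow> bool" where
  "box_step x y \<longleftrightarrow>
     (first_col (fst x) \<le> snd x \<and> y = (fst x, Suc (snd x)) \<and> (\<exists>c > snd x. (fst x, c) \<in> pluses L)) \<or>
     (fst x < col_height L (snd x) \<and> y = (Suc (fst x), snd x) \<and> (\<exists>r \<le> fst x. (r, snd x) \<in> pluses L))"

lemma hook_edges:
  assumes "(r, c) \<in> pluses L"
  shows "set (zip (hook L (r, c)) (tl (hook L (r, c)))) =
    {(Boundary (source L r), Corner (r, first_col r))} \<union>
    {(Corner (r, d), Corner (r, Suc d)) |d. first_col r \<le> d \<and> d < c} \<union>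
    {(Corner (s, c), Corner (Suc s, c)) |s. r \<le> s \<and> s < col_height L c} \<union>
    {(Corner (col_height L c, c), Boundary (sink L c))}"
proof -
  let ?f = "\<lambda>d. Corner (r, d)" and ?g = "\<lambda>s. Corner (s, c)"
  let ?xs = "map ?f [first_col r..<Suc c]" and ?h = "col_height L c"
  let ?ys = "map ?g [Suc r..<Suc ?h]"
  have b: "first_col r \<le> c" "r \<le> ?h"
    using plus_box[OF assms] box_iff[of r c] box_col_height[of r c] by simp_all
  then have xs: "?xs \<noteq> []" "hd ?xs = ?f (first_col r)" "last ?xs = ?f c"
    by (simp_all add: hd_map hd_append hd_upt)
  have hk: "hook L (r, c) = [Boundary (source L r)] @ ?xs @ ?ys @ [Boundary (sink L c)]"
    by (simp add: first_col_def)
  have zy: "set (zip (?ys @ [Boundary (sink L c)]) (tl (?ys @ [Boundary (sink L c)]))) \<union>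
      {(?f c, hd (?ys @ [Boundary (sink L c)]))} =
    {(?g s, ?g (Suc s)) |s. r \<le> s \<and> s < ?h} \<union> {(?g ?h, Boundary (sink L c))}"
  proof (cases "r < ?h")
    case True
    then have ys: "?ys \<noteq> []" "hd ?ys = ?g (Suc r)" "last ?ys = ?g ?h"
      by (simp_all add: hd_map hd_append hd_upt)
    have "set (zip (?ys @ [Boundary (sink L c)]) (tl (?ys @ [Boundary (sink L c)]))) =
      {(?g s, ?g (Suc s)) |s. Suc r \<le> s \<and> Suc s < Suc ?h} \<union> {(?g ?h, Boundary (sink L c))}"
      by (subst pairs_append[OF ys(1)]) (simp_all only: pairs_map_upt ys, simp_all)
    moreover have "hd (?ys @ [Boundary (sink L c)]) = ?g (Suc r)" using ys by simp
    ultimately show ?thesis using True by (auto simp: Suc_le_eq le_less)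
  next
    case False
    then show ?thesis using b by auto
  qed
  have "set (zip (hook L (r, c)) (tl (hook L (r, c)))) =
     {(Boundary (source L r), ?f (first_col r))} \<union>
     ({(?f d, ?f (Suc d)) |d. first_col r \<le> d \<and> Suc d < Suc c} \<union>
      ({(?f c, hd (?ys @ [Boundary (sink L c)]))} \<union>
      set (zip (?ys @ [Boundary (sink L c)]) (tl (?ys @ [Boundary (sink L c)])))))"
    unfolding hk
    apply (subst pairs_append, simp, simp)
    apply (subst pairs_append, use xs in simp, simp)
    apply (simp only: pairs_map_upt xs)
    using xs by simp
  also have "{(?f c, hd (?ys @ [Boundary (sink L c)]))} \<union>
      set (zip (?ys @ [Boundary (sink L c)]) (tl (?ys @ [Boundary (sink L c)]))) =
    {(?g s, ?g (Suc s)) |s. r \<le> s \<and> s < ?h} \<union> {(?g ?h, Boundary (sink L c))}"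
    using zy by (simp only: Un_commute)
  finally show ?thesis by (simp only: Suc_less_eq Un_assoc)
qed

lemma gamma_graph_iff:
  "(u, v) \<in> gamma_graph L \<longleftrightarrow>
    (\<exists>r c. (r, c) \<in> pluses L \<and> u = Boundary (source L r) \<and> v = Corner (r, first_col r)) \<or>
    (\<exists>x y. box_step x y \<and> u = Corner x \<and> v = Corner y) \<or>
    (\<exists>r c. (r, c) \<in> pluses L \<and> u = Corner (col_height L c, c) \<and> v = Boundary (sink L c))"
  (is "?l = ?r")
proof
  assume ?l
  then obtain r c where "(r, c) \<in> pluses L" "(u, v) \<in> set (zip (hook L (r, c)) (tl (hook L (r, c))))"
    by (auto simp: gamma_graph_def simp del: hook.simps)
  then consider "u = Boundary (source L r)" "v = Corner (r, first_col r)"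
    | d where "first_col r \<le> d" "d < c" "u = Corner (r, d)" "v = Corner (r, Suc d)"
    | s where "r \<le> s" "s < col_height L c" "u = Corner (s, c)" "v = Corner (Suc s, c)"
    | "u = Corner (col_height L c, c)" "v = Boundary (sink L c)"
    unfolding hook_edges[OF \<open>(r, c) \<in> pluses L\<close>] by blast
  then show ?r
  proof cases
    case (2 d)
    then have "box_step (r, d) (r, Suc d)" using \<open>(r, c) \<in> pluses L\<close> by (auto simp: box_step_def)
    then show ?thesis using 2 by blast
  next
    case (3 s)
    then have "box_step (s, c) (Suc s, c)" using \<open>(r, c) \<in> pluses L\<close> by (auto simp: box_step_def)
    then show ?thesis using 3 by blast
  qed (use \<open>(r, c) \<in> pluses L\<close> in blast)+
next
  assume ?r
  then consider
      (enter) r c where "(r, c) \<in> pluses L" "u = Boundary (source L r)" "v = Corner (r, first_col r)"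
    | (west) r d c where "(r, c) \<in> pluses L" "d < c" "first_col r \<le> d" "u = Corner (r, d)" "v = Corner (r, Suc d)"
    | (south) r s c where "(r, c) \<in> pluses L" "r \<le> s" "s < col_height L c" "u = Corner (s, c)" "v = Corner (Suc s, c)"
    | (exit) r c where "(r, c) \<in> pluses L" "u = Corner (col_height L c, c)" "v = Boundary (sink L c)"
    unfolding box_step_def by force
  then obtain r c where "(r, c) \<in> pluses L" "(u, v) \<in> set (zip (hook L (r, c)) (tl (hook L (r, c))))"
  proof cases
    case (enter r c)
    then show ?thesis using that[of r c] hook_edges[of r c] by simp
  next
    case (west r d c)
    then show ?thesis using that[of r c] hook_edges[of r c] by simp
  next
    case (south r s c)
    then show ?thesis using that[of r c] hook_edges[of r c] by simp
  next
    case (exit r c)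
    then show ?thesis using that[of r c] hook_edges[of r c] by simp
  qed
  then show ?l unfolding gamma_graph_def by blast
qed

text \<open>The boxes of a path from anywhere inside the diagram to the sink of column
  \<open>b\<close>. The final column is a parameter and the start is extended backwards, so
  induction follows the path from its end.\<close>

inductive run :: "nat \<Rightarrow> (nat \<times> nat) list \<Rightarrow> bool" for b where
  run_end: "(r, b) \<in> pluses L \<Longrightarrow> run b [(col_height L b, b)]"
| run_step: "box_step x y \<Longrightarrow> run b (y # xs) \<Longrightarrow> run b (x # y # xs)"

definition se :: "(nat \<times> nat) list \<Rightarrow> (nat \<times> nat) set" where
  "se xs = {(r, c). \<exists>r' c'. (r', c') \<in> set xs \<and> r' \<le> r \<and> c \<le> c'}"

section \<open>Monotonicity, convexity and planarity of runs\<close>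

lemma box_step_cases:
  assumes "box_step x y"
  obtains (west) r d c where "x = (r, d)" "y = (r, Suc d)" "first_col r \<le> d" "d < c" "(r, c) \<in> pluses L"
    | (south) s d r where "x = (s, d)" "y = (Suc s, d)" "s < col_height L d" "r \<le> s" "(r, d) \<in> pluses L"
  using assms unfolding box_step_def by (cases x) auto

lemma box_step_boxes: "box_step x y \<Longrightarrow> x \<in> boxes L \<and> y \<in> boxes L"
proof (elim box_step_cases)
  fix r d c assume a: "x = (r, d)" "y = (r, Suc d)" "first_col r \<le> d" "d < c" "(r, c) \<in> pluses L"
  have "(r, c) \<in> boxes L" using plus_box a by blast
  moreover have "1 \<le> d" using a(3) by (simp add: first_col_def)
  ultimately show ?thesis using a by (simp add: box_iff)
next
  fix s d r assume a: "x = (s, d)" "y = (Suc s, d)" "s < col_height L d" "r \<le> s" "(r, d) \<in> pluses L"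
  have "(r, d) \<in> boxes L" using plus_box a by blast
  then show ?thesis using a by (simp add: box_col_height)
qed

lemma run_nonempty: "run b xs \<Longrightarrow> xs \<noteq> []"
  by (auto elim: run.cases)

lemma run_boxes: "run b xs \<Longrightarrow> x \<in> set xs \<Longrightarrow> x \<in> boxes L"
proof (induction rule: run.induct)
  case (run_end r)
  then have "(r, b) \<in> boxes L" using plus_box by blast
  then show ?case using run_end by (simp add: box_col_height)
qed (auto dest: box_step_boxes)

lemma run_last: "run b xs \<Longrightarrow> (col_height L b, b) \<in> set xs"
  by (induction rule: run.induct) auto

lemma run_col: "run b xs \<Longrightarrow> b \<in> {1..num_cols L}"
  using run_boxes[OF _ run_last] by (auto simp: box_iff)

lemma run_bounds:
  "run b xs \<Longrightarrow> y \<in> set xs \<Longrightarrow> fst (hd xs) \<le> fst y \<and> snd (hd xs) \<le> snd y \<and> snd y \<le> b"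
proof (induction arbitrary: y rule: run.induct)
  case (run_step x z xs)
  have z: "fst x \<le> fst z" "snd x \<le> snd z" using run_step(1) by (auto simp: box_step_def)
  show ?case
  proof (cases "y = x")
    case True
    then show ?thesis using z run_step.IH[of z] by simp
  next
    case False
    then show ?thesis using z run_step.IH[of y] run_step.prems by simp
  qed
qed simp

lemma run_comparable:
  "run b xs \<Longrightarrow> x \<in> set xs \<Longrightarrow> y \<in> set xs \<Longrightarrow>
    (fst x \<le> fst y \<and> snd x \<le> snd y) \<or> (fst y \<le> fst x \<and> snd y \<le> snd x)"
proof (induction rule: run.induct)
  case (run_step z w xs)
  have "run b (z # w # xs)" using run_step run.run_step by blast
  then have min: "fst z \<le> fst v \<and> snd z \<le> snd v" if "v \<in> set (z # w # xs)" for v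
    using run_bounds[of b "z # w # xs" v] that by simp
  consider "x = z" | "y = z" | "x \<in> set (w # xs)" "y \<in> set (w # xs)"
    using run_step.prems by auto
  then show ?case using run_step.IH run_step.prems min[of x] min[of y] by cases simp_all
qed simp

lemma run_col_convex:
  "run b xs \<Longrightarrow> (r, c) \<in> set xs \<Longrightarrow> (t, c) \<in> set xs \<Longrightarrow> r \<le> s \<Longrightarrow> s \<le> t \<Longrightarrow> (s, c) \<in> set xs"
proof (induction arbitrary: r rule: run.induct)
  case (run_step z w xs)
  show ?case
  proof (cases "(r, c) = z \<and> s \<noteq> r")
    case True
    then have z: "z = (r, c)" and rs: "r < s" using run_step.prems by auto
    then have t: "(t, c) \<in> set (w # xs)" using run_step.prems by auto
    have w: "snd w \<le> c" using run_bounds[OF run_step(2) t] by simp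
    have "w = (Suc r, c)" using run_step(1) w z by (auto simp: box_step_def)
    then show ?thesis using run_step.IH[of "Suc r"] t rs run_step.prems by auto
  next
    case False
    show ?thesis
    proof (cases "s = r")
      case True
      then show ?thesis using run_step.prems by simp
    next
      case s: False
      then have r: "(r, c) \<in> set (w # xs)" using False run_step.prems by auto
      then have "fst w \<le> r" using run_bounds[OF run_step(2) r] by simp
      moreover have "fst z \<le> fst w" using run_step(1) by (auto simp: box_step_def)
      ultimately have "(t, c) \<noteq> z" using s run_step.prems by auto
      then show ?thesis using run_step.IH[OF r] run_step.prems by auto
    qed
  qed
qed auto

lemma run_row_convex:
  "run b xs \<Longrightarrow> (r, c) \<in> set xs \<Longrightarrow> (r, e) \<in> set xs \<Longrightarrow> c \<le> d \<Longrightarrow> d \<le> e \<Longrightarrow> (r, d) \<in> set xs"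
proof (induction arbitrary: c rule: run.induct)
  case (run_step z w xs)
  show ?case
  proof (cases "(r, c) = z \<and> d \<noteq> c")
    case True
    then have z: "z = (r, c)" and cd: "c < d" using run_step.prems by auto
    then have t: "(r, e) \<in> set (w # xs)" using run_step.prems by auto
    have w: "fst w \<le> r" using run_bounds[OF run_step(2) t] by simp
    have "w = (r, Suc c)" using run_step(1) w z by (auto simp: box_step_def)
    then show ?thesis using run_step.IH[of "Suc c"] t cd run_step.prems by auto
  next
    case False
    show ?thesis
    proof (cases "d = c")
      case True
      then show ?thesis using run_step.prems by simp
    next
      case s: False
      then have r: "(r, c) \<in> set (w # xs)" using False run_step.prems by auto
      then have "snd w \<le> c" using run_bounds[OF run_step(2) r] by simp
      moreover have "snd z \<le> snd w" using run_step(1) by (auto simp: box_step_def)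
      ultimately have "(r, e) \<noteq> z" using s run_step.prems by auto
      then show ?thesis using run_step.IH[OF r] run_step.prems by auto
    qed
  qed
qed auto

lemma run_next:
  "run b xs \<Longrightarrow> (r, d) \<in> set xs \<Longrightarrow>
    (r = col_height L d \<and> d = b) \<or> (Suc r, d) \<in> set xs \<or> (r, Suc d) \<in> set xs"
proof (induction rule: run.induct)
  case (run_step z w xs)
  then show ?case by (cases "(r, d) = z") (auto simp: box_step_def)
qed simp

text \<open>Above row \<open>s\<close> the run can leave column \<open>d\<close> only by a west
  step, and it cannot end there because the column still has a box in row \<open>s\<close>.\<close>

lemma run_descend:
  assumes run: "run b xs" and s: "(s, d) \<in> boxes L"
  shows "(r, d) \<in> set xs \<Longrightarrow> r \<le> s \<Longrightarrow> (s, d) \<in> set xs \<or> (\<exists>r' \<le> s. (r', Suc d) \<in> set xs)"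
proof (induction "s - r" arbitrary: r)
  case (Suc m)
  then have "r < s" by simp
  moreover have "s \<le> col_height L d" using s by (simp add: box_col_height)
  ultimately consider "(Suc r, d) \<in> set xs" | "(r, Suc d) \<in> set xs"
    using run_next[OF run Suc.prems(1)] by auto
  then show ?case
  proof cases
    case 1
    then show ?thesis using Suc(1)[of "Suc r"] Suc(2) \<open>r < s\<close> by simp
  next
    case 2
    then show ?thesis using \<open>r < s\<close> by auto
  qed
qed auto

text \<open>As long as the next box is in a row up to \<open>a\<close>, the claim passes to the
  tail. A step from row \<open>a\<close> to the row below leaves from a box \<open>(a, d)\<close> of
  the diagram, so \<open>first_col a \<le> d\<close>; if the run ends first, it ends in column
  \<open>b\<close>.\<close>

lemma run_se_start:
  assumes a: "a \<in> {1..num_rows L}"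
  shows "run b xs \<Longrightarrow> fst (hd xs) \<le> a \<Longrightarrow> first_col a \<le> b \<Longrightarrow> (a, first_col a) \<in> se xs"
proof (induction rule: run.induct)
  case (run_end r)
  then show ?case by (auto simp: se_def)
next
  case (run_step x y xs)
  show ?case
  proof (cases "fst y \<le> a")
    case True
    then have "(a, first_col a) \<in> se (y # xs)" using run_step by simp
    then show ?thesis by (auto simp: se_def)
  next
    case False
    with run_step(1) show ?thesis
    proof (cases rule: box_step_cases)
      case (west r d c)
      then show ?thesis using False run_step.prems by simp
    next
      case (south s d r)
      then have "s = a" using False run_step.prems by simp
      moreover have "(a, d) \<in> boxes L" using box_step_boxes[OF run_step(1)] south \<open>s = a\<close> by simp
      ultimately have "x = (a, d)" "first_col a \<le> d" using south by (simp_all add: box_iff)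
      then show ?thesis by (auto simp: se_def)
    qed
  qed
qed

text \<open>Planarity: only a west step can leave the region. If the witness on \<open>ps\<close> is
  in the same column, then \<open>ps\<close>, which avoids the current box, must itself turn west
  above it.\<close>

lemma run_stays_se:
  assumes p: "run b ps"
  shows "run b' qs \<Longrightarrow> set ps \<inter> set qs = {} \<Longrightarrow> hd qs \<in> se ps \<Longrightarrow> set qs \<subseteq> se ps"
proof (induction rule: run.induct)
  case (run_step x y xs)
  have "y \<in> se ps"
    using run_step(1)
  proof (cases rule: box_step_cases)
    case (west s d c)
    obtain r' c' where rc: "(r', c') \<in> set ps" "r' \<le> s" "d \<le> c'"
      using run_step.prems(2) west by (auto simp: se_def)
    show ?thesis
    proof (cases "c' = d")
      case True
      have "(s, d) \<in> boxes L" using box_step_boxes[OF run_step(1)] west by simp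
      moreover have "(s, d) \<notin> set ps" using run_step.prems(1) west by auto
      ultimately show ?thesis
        using run_descend[OF p _ rc(1)[unfolded True] rc(2)] west by (auto simp: se_def)
    next
      case False
      then have "(r', c') \<in> set ps \<and> r' \<le> s \<and> Suc d \<le> c'" using rc by simp
      then show ?thesis unfolding se_def west by blast
    qed
  next
    case (south s d r)
    then show ?thesis using run_step.prems(2) unfolding se_def by (auto intro: le_SucI)
  qed
  then show ?case using run_step by auto
qed simp

text \<open>That \<open>(a', b)\<close> is a box means that the source of row \<open>a'\<close>
  precedes the sink of column \<open>b\<close>, so the second run starts under the first; planarity
  then keeps it there.\<close>

lemma run_nested:
  assumes p: "run b ps" "hd ps = (a, first_col a)" and q: "run b' qs" "hd qs = (a', first_col a')"
    and dis: "set ps \<inter> set qs = {}" and less: "a < a'" "(a', b) \<in> boxes L"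
  shows "set qs \<subseteq> se ps" "b' < b" "set ps \<inter> se qs = {}"
proof -
  have a': "a' \<in> {1..num_rows L}" "first_col a' \<le> b" using less(2) by (simp_all add: box_iff)
  have "(a', first_col a') \<in> se ps" using run_se_start[OF a'(1) p(1)] p(2) less(1) a'(2) by simp
  then show se: "set qs \<subseteq> se ps" using run_stays_se[OF p(1) q(1) dis] q(2) by simp
  have "(col_height L b', b') \<in> se ps" using run_last[OF q(1)] se by blast
  then have "b' \<le> b" using run_bounds[OF p(1)] by (fastforce simp: se_def)
  moreover have "b' \<noteq> b" using run_last[OF q(1)] run_last[OF p(1)] dis by auto
  ultimately show "b' < b" by simp
  show "set ps \<inter> se qs = {}"
  proof (rule equals0I)
    fix V assume V: "V \<in> set ps \<inter> se qs"
    obtain s d where sd: "V = (s, d)" by (cases V)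
    obtain r c where rc: "(r, c) \<in> set qs" "r \<le> s" "d \<le> c" using V sd by (auto simp: se_def)
    then obtain r' c' where rc': "(r', c') \<in> set ps" "r' \<le> r" "c \<le> c'" using se by (force simp: se_def)
    have V': "(s, d) \<in> set ps" using V sd by simp
    \<comment> \<open>The boxes \<open>(s, d)\<close> and \<open>(r', c')\<close> of
      \<open>ps\<close> satisfy \<open>r' \<le> r \<le> s\<close> and
      \<open>d \<le> c \<le> c'\<close>. Comparability along a run forces a common row or column,
      and convexity puts \<open>(r, c)\<close> between them.\<close>
    have "(r, c) \<in> set ps"
      using run_comparable[OF p(1) V' rc'(1)]
    proof
      assume "fst (s, d) \<le> fst (r', c') \<and> snd (s, d) \<le> snd (r', c')"
      then have "s = r" "r' = r" using rc(2) rc'(2) by simp_all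
      then show ?thesis using run_row_convex[OF p(1), of r d c' c] V' rc' rc by simp
    next
      assume "fst (r', c') \<le> fst (s, d) \<and> snd (r', c') \<le> snd (s, d)"
      then have "d = c" "c' = c" using rc(3) rc'(3) by simp_all
      then show ?thesis using run_col_convex[OF p(1), of r' c s r] V' rc' rc by simp
    qed
    then show False using dis rc by auto
  qed
qed

text \<open>West steps stay in a row with a \<open>+\<close> further west. The first south step, or
  the end of the run, happens at a box with a \<open>+\<close> weakly above and one weakly west,
  hence at a \<open>+\<close>.\<close>

lemma run_turn:
  "run b xs \<Longrightarrow> (fst (hd xs), e) \<in> pluses L \<Longrightarrow> snd (hd xs) \<le> e \<Longrightarrow> \<exists>V\<in>set xs. V \<in> pluses L"
proof (induction arbitrary: e rule: run.induct)
  case (run_end r)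
  have b: "(r, b) \<in> boxes L" using run_end plus_box by blast
  then have "(col_height L b, b) \<in> boxes L" "r \<le> col_height L b" by (simp_all add: box_col_height)
  then show ?case using plus_corner[of "col_height L b" b r e] run_end by simp
next
  case (run_step x y xs)
  from run_step(1) show ?case
  proof (cases rule: box_step_cases)
    case (west r d c)
    then show ?thesis using run_step.IH[of c] by auto
  next
    case (south s d r)
    then have "(s, d) \<in> pluses L"
      using plus_corner[of s d r e] box_step_boxes[OF run_step(1)] run_step.prems by simp
    then show ?thesis using south by auto
  qed
qed

text \<open>Since the run ends further west, it leaves its first column by a west step, and the box
  where it does so has a \<open>+\<close> weakly above and one to the west.\<close>

lemma run_turn_west:
  "run b xs \<Longrightarrow> r \<le> fst (hd xs) \<Longrightarrow> (r, snd (hd xs)) \<in> pluses L \<Longrightarrow> snd (hd xs) < b \<Longrightarrow> 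
    \<exists>V\<in>set xs. V \<in> pluses L \<and> snd V = snd (hd xs)"
proof (induction rule: run.induct)
  case (run_step x y xs)
  from run_step(1) show ?case
  proof (cases rule: box_step_cases)
    case (west s d c)
    then have "(s, d) \<in> pluses L"
      using plus_corner[of s d r c] box_step_boxes[OF run_step(1)] run_step.prems by simp
    then show ?thesis using west by auto
  next
    case (south s d r')
    then show ?thesis using run_step by auto
  qed
qed simp

text \<open>A run that reaches column \<open>c\<close> without \<open>(r, c)\<close> on it or to its
  southeast must first sink below row \<open>r\<close>. Its next turn to the west, still east of
  column \<open>c\<close>, is a \<open>+\<close>.\<close>

lemma run_turn_around:
  "run b xs \<Longrightarrow> fst (hd xs) \<le> r \<Longrightarrow> snd (hd xs) < c \<Longrightarrow> c \<le> b \<Longrightarrow> (r, c) \<notin> se xs \<Longrightarrow>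
    \<exists>V\<in>set xs. V \<in> pluses L \<and> r < fst V \<and> snd V < c"
proof (induction rule: run.induct)
  case (run_step x y xs)
  have n: "(r, c) \<notin> se (y # xs)" using run_step.prems by (auto simp: se_def)
  from run_step(1) show ?case
  proof (cases rule: box_step_cases)
    case (west s d e)
    have "(s, Suc d) \<in> set (y # xs)" using west by simp
    then have "\<not> c \<le> Suc d" using n run_step.prems(1) west by (auto simp: se_def)
    then show ?thesis using run_step west n by auto
  next
    case (south s d t)
    show ?thesis
    proof (cases "Suc s \<le> r")
      case True
      then show ?thesis using run_step south n by auto
    next
      case False
      have "\<exists>V\<in>set (y # xs). V \<in> pluses L \<and> snd V = snd (hd (y # xs))"
        by (rule run_turn_west[OF run_step(2), of t]) (use south run_step.prems in auto)
      then obtain V where V: "V \<in> set (y # xs)" "V \<in> pluses L" "snd V = snd (hd (y # xs))" by blast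
      moreover have "Suc s \<le> fst V" using run_bounds[OF run_step(2) V(1)] south by simp
      ultimately show ?thesis using False run_step.prems south by auto
    qed
  qed
qed simp

section \<open>Paths from sources to sinks as runs\<close>

definition path_of :: "nat \<Rightarrow> nat \<Rightarrow> (nat \<times> nat) list \<Rightarrow> vertex list" where
  "path_of a b xs = Boundary (source L a) # map Corner xs @ [Boundary (sink L b)]"

text \<open>The last conjunct says that row \<open>a\<close> contains a \<open>+\<close>; exactly
  then the edge leaving its source exists.\<close>

definition full_run :: "nat \<Rightarrow> nat \<Rightarrow> (nat \<times> nat) list \<Rightarrow> bool" where
  "full_run a b xs \<longleftrightarrow> run b xs \<and> hd xs = (a, first_col a) \<and> (\<exists>d \<ge> first_col a. (a, d) \<in> pluses L)"

lemma sink_no_edge: "c \<in> {1..num_cols L} \<Longrightarrow> (Boundary (sink L c), v) \<notin> gamma_graph L"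
proof
  assume c: "c \<in> {1..num_cols L}" and "(Boundary (sink L c), v) \<in> gamma_graph L"
  then obtain r d where "(r, d) \<in> pluses L" "sink L c = source L r"
    unfolding gamma_graph_iff by auto
  moreover have "r \<in> {1..num_rows L}" using plus_box[OF \<open>(r, d) \<in> pluses L\<close>] by (simp add: box_iff)
  ultimately show False using source_neq_sink[OF _ c] by metis
qed

lemma plus_col: "(r, c) \<in> pluses L \<Longrightarrow> c \<in> {1..num_cols L}"
  and plus_row: "(r, c) \<in> pluses L \<Longrightarrow> r \<in> {1..num_rows L}"
  using plus_box by (auto simp: box_iff)

lemma gamma_path_suffix:
  "gamma_path L q \<Longrightarrow> hd q = Corner x \<Longrightarrow> last q = Boundary j \<Longrightarrow>
    \<exists>b xs. j = sink L b \<and> run b xs \<and> hd xs = x \<and> q = map Corner xs @ [Boundary (sink L b)]"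
proof (induction q arbitrary: x)
  case Nil
  then show ?case by (simp add: gamma_path_def)
next
  case (Cons u q)
  then obtain v q' where q: "q = v # q'" by (cases q) auto
  have u: "u = Corner x" using Cons.prems by simp
  have e: "(Corner x, v) \<in> gamma_graph L" and g: "gamma_path L q"
    using Cons.prems u q by (auto simp: gamma_path_def)
  from e consider (step) y where "box_step x y" "v = Corner y"
    | (exit) r c where "(r, c) \<in> pluses L" "x = (col_height L c, c)" "v = Boundary (sink L c)"
    unfolding gamma_graph_iff by auto
  then show ?case
  proof cases
    case step
    then obtain b xs where IH: "j = sink L b" "run b xs" "hd xs = y" "q = map Corner xs @ [Boundary (sink L b)]"
      using Cons.IH[OF g] Cons.prems(3) q by auto
    then obtain xs' where "xs = y # xs'" using run_nonempty by (cases xs) auto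
    then have "run b (x # xs)" using IH step run_step by simp
    then show ?thesis using IH u by (intro exI[of _ b] exI[of _ "x # xs"]) auto
  next
    case exit
    have "q' = []"
    proof (rule ccontr)
      assume "q' \<noteq> []"
      then obtain v' where "(v, v') \<in> gamma_graph L" using g q by (cases q') (auto simp: gamma_path_def)
      then show False using sink_no_edge[OF plus_col] exit by blast
    qed
    then show ?thesis
      using exit u q Cons.prems(3) run_end
      by (intro exI[of _ c] exI[of _ "[x]"]) auto
  qed
qed

lemma gamma_graph_edges:
  shows "box_step x y \<Longrightarrow> (Corner x, Corner y) \<in> gamma_graph L"
    and "(r, c) \<in> pluses L \<Longrightarrow> (Corner (col_height L c, c), Boundary (sink L c)) \<in> gamma_graph L"
    and "(r, c) \<in> pluses L \<Longrightarrow> (Boundary (source L r), Corner (r, first_col r)) \<in> gamma_graph L"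
  unfolding gamma_graph_iff by blast+

lemma run_gamma_path: "run b xs \<Longrightarrow> gamma_path L (map Corner xs @ [Boundary (sink L b)])"
proof (induction rule: run.induct)
  case (run_end r)
  then show ?case using gamma_graph_edges(2) by (auto simp: gamma_path_def)
next
  case (run_step x y xs)
  then show ?case using gamma_graph_edges(1) by (auto simp: gamma_path_def)
qed

lemma gamma_path_cases:
  assumes p: "gamma_path L p" "hd p = Boundary (source L a)" "last p = Boundary j" and a: "a \<in> {1..num_rows L}"
  obtains (trivial) "j = source L a" "p = [Boundary (source L a)]"
    | (run) b xs where "j = sink L b" "b \<in> {1..num_cols L}" "full_run a b xs" "p = path_of a b xs"
proof (cases "tl p")
  case Nil
  then have "p = [Boundary (source L a)]" using p by (cases p) (auto simp: gamma_path_def)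
  then show thesis using p trivial by simp
next
  case (Cons v q)
  then have pq: "p = Boundary (source L a) # v # q" using p by (cases p) (auto simp: gamma_path_def)
  then have e: "(Boundary (source L a), v) \<in> gamma_graph L" and g: "gamma_path L (v # q)"
    using p by (auto simp: gamma_path_def)
  from e obtain r c where rc: "(r, c) \<in> pluses L" "source L r = source L a" "v = Corner (r, first_col r)"
    unfolding gamma_graph_iff by auto
  then have "r = a" using source_eq_iff[OF plus_row a] by blast
  have "hd (v # q) = Corner (a, first_col a)" "last (v # q) = Boundary j"
    using rc(3) \<open>r = a\<close> p(3) pq by auto
  from gamma_path_suffix[OF g this]
  obtain b xs where b: "j = sink L b" "run b xs" "hd xs = (a, first_col a)" "v # q = map Corner xs @ [Boundary (sink L b)]"
    by blast
  moreover have "first_col a \<le> c" using plus_box rc(1) \<open>r = a\<close> by (auto simp: box_iff)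
  ultimately show thesis
    using run[of b xs] run_col rc(1) \<open>r = a\<close> pq by (auto simp: full_run_def path_of_def)
qed

lemma full_run_gamma_path:
  assumes "full_run a b xs"
  shows "gamma_path L (path_of a b xs)"
proof -
  have "run b xs" "hd xs = (a, first_col a)" using assms by (auto simp: full_run_def)
  then obtain ys where "xs = (a, first_col a) # ys" using run_nonempty by (cases xs) auto
  moreover have "(Boundary (source L a), Corner (a, first_col a)) \<in> gamma_graph L"
    using assms gamma_graph_edges(3) by (auto simp: full_run_def)
  ultimately show ?thesis using run_gamma_path[OF \<open>run b xs\<close>] by (simp add: gamma_path_def path_of_def)
qed

lemma southeast_path_of: "southeast (path_of a b xs) = se xs"
  by (auto simp: southeast_def se_def path_of_def)

lemma southeast_trivial: "southeast [Boundary i] = {}"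
  by (simp add: southeast_def)

definition chain :: "(nat \<times> nat) set \<Rightarrow> bool" where
  "chain C \<longleftrightarrow> (\<forall>x\<in>C. \<forall>y\<in>C. x = y \<or> (fst x < fst y \<and> snd y < snd x) \<or> (fst y < fst x \<and> snd x < snd y))"

text \<open>
  If an outermost path among those not passing over \<open>(r, c)\<close> contains a \<open>+\<close> strictly southeast of
  \<open>(r, c)\<close>, then that box extends a chain obtained by recursion. Otherwise no such path crosses the
  label \<open>m\<close> following the last sink reached by them from the rows up to \<open>r\<close>.
\<close>

lemma crossing_bound:
  assumes Q: "Q \<subseteq> {1..num_rows L}" and X: "\<And>a. a \<in> Q \<Longrightarrow> full_run a (S a) (X a)"
    and dis: "\<And>a a'. a \<in> Q \<Longrightarrow> a' \<in> Q \<Longrightarrow> a \<noteq> a' \<Longrightarrow> set (X a) \<inter> set (X a') = {}"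
  shows "(r, c) \<in> boxes L \<Longrightarrow>
    \<exists>m C. source L r < m \<and> m \<le> sink L c \<and> C \<subseteq> pluses L \<and> chain C \<and>
      (\<forall>(s, d)\<in>C. r < s \<and> d < c \<and> source L s < m \<and> m \<le> sink L d) \<and>
      card {a \<in> Q. source L a < m \<and> m \<le> sink L (S a) \<and> (r, c) \<notin> se (X a)} \<le> card C"
proof (induction "num_rows L - r" arbitrary: r c rule: less_induct)
  case less
  have rc: "r \<in> {1..num_rows L}" "c \<in> {1..num_cols L}" using less.prems by (auto simp: box_iff)
  have finQ: "finite Q" using Q finite_subset by blast
  have runX: "run (S a) (X a)" "hd (X a) = (a, first_col a)" "S a \<in> {1..num_cols L}" "a \<in> {1..num_rows L}"
    if "a \<in> Q" for a
    using X[OF that] run_col that Q by (auto simp: full_run_def)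
  have nested: "S a' < S a \<and> set (X a) \<inter> se (X a') = {}"
    if "a \<in> Q" "a' \<in> Q" "a < a'" "source L a' < sink L (S a)" for a a'
    using run_nested[of "S a" "X a" a "S a'" "X a'" a'] runX[OF that(1)] runX[OF that(2)] dis[of a a'] that
      box_source_sink(1)[of a' "S a"] by simp
  define G where "G = {a \<in> Q. (r, c) \<notin> se (X a)}"
  define outer where "outer a \<longleftrightarrow> a \<in> G \<and> (\<forall>a'\<in>G. a' \<le> a \<and> S a \<le> S a' \<longrightarrow> a' = a)" for a
  have GQ: "a \<in> Q" if "a \<in> G" for a using that by (simp add: G_def)
  have ex_outer: "\<exists>a'. outer a' \<and> a' \<le> a \<and> S a \<le> S a'" if "a \<in> G" for a
  proof -
    let ?P = "\<lambda>a'. a' \<in> G \<and> a' \<le> a \<and> S a \<le> S a'"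
    have P: "?P (Least ?P)" by (rule LeastI[of ?P a]) (use that in simp)
    have "outer (Least ?P)" unfolding outer_def
    proof (intro conjI ballI impI)
      fix a' assume "a' \<in> G" "a' \<le> Least ?P \<and> S (Least ?P) \<le> S a'"
      then have "?P a'" using P by auto
      then have "Least ?P \<le> a'" by (rule Least_le)
      then show "a' = Least ?P" using \<open>a' \<le> Least ?P \<and> S (Least ?P) \<le> S a'\<close> by simp
    qed (use P in simp)
    then show ?thesis using P by blast
  qed
  show ?case
  proof (cases "\<exists>q s d. outer q \<and> (s, d) \<in> set (X q) \<and> (s, d) \<in> pluses L \<and> r < s \<and> d < c")
    case True
    then obtain q s d where q: "outer q" and V: "(s, d) \<in> set (X q)" "(s, d) \<in> pluses L" "r < s" "d < c" by blast
    have qQ: "q \<in> Q" "q \<in> G" using q GQ by (auto simp: outer_def)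
    have sd: "s \<in> {1..num_rows L}" "d \<in> {1..num_cols L}" using plus_row plus_col V(2) by blast+
    have q_bounds: "q \<le> s" "d \<le> S q" using run_bounds[OF runX(1)[OF qQ(1)] V(1)] runX(2)[OF qQ(1)] by auto
    have "num_rows L - s < num_rows L - r" using V(3) sd rc by auto
    from less.hyps[OF this plus_box[OF V(2)]] obtain m C where
      m: "source L s < m" "m \<le> sink L d" and C: "C \<subseteq> pluses L" "chain C"
        "\<forall>(s', d')\<in>C. s < s' \<and> d' < d \<and> source L s' < m \<and> m \<le> sink L d'"
      and card_le: "card {a \<in> Q. source L a < m \<and> m \<le> sink L (S a) \<and> (s, d) \<notin> se (X a)} \<le> card C"
      by blast
    have fC: "finite C" using C(1) finite_pluses[OF le] finite_subset by blast
    have qm: "source L q < m" "m \<le> sink L (S q)"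
      using m q_bounds source_less_iff[of s q] sink_less_iff[of "S q" d] runX[OF qQ(1)] sd by linarith+
    \<comment> \<open>Passing from \<open>(s, d)\<close> to \<open>(r, c)\<close> adds only
      \<open>q\<close>. A path crossing \<open>m\<close> that starts above \<open>q\<close> encloses
      \<open>q\<close>, contradicting that \<open>q\<close> is outermost; one that starts below is
      nested under \<open>q\<close>, so the box \<open>(s, d)\<close> of \<open>q\<close> is not
      southeast of it.\<close>
    have "{a \<in> Q. source L a < m \<and> m \<le> sink L (S a) \<and> (r, c) \<notin> se (X a)} \<subseteq>
        insert q {a \<in> Q. source L a < m \<and> m \<le> sink L (S a) \<and> (s, d) \<notin> se (X a)}"
    proof
      fix a assume a: "a \<in> {a \<in> Q. source L a < m \<and> m \<le> sink L (S a) \<and> (r, c) \<notin> se (X a)}"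
      show "a \<in> insert q {a \<in> Q. source L a < m \<and> m \<le> sink L (S a) \<and> (s, d) \<notin> se (X a)}"
      proof (cases a q rule: linorder_cases)
        case less
        then have "S q < S a" using nested[of a q] a qQ qm by simp
        then have "a = q" using q a less by (auto simp: outer_def G_def)
        then show ?thesis by simp
      next
        case greater
        then have "(s, d) \<notin> se (X a)" using nested[of q a] a qQ qm V(1) by auto
        then show ?thesis using a by simp
      qed simp
    qed
    then have "card {a \<in> Q. source L a < m \<and> m \<le> sink L (S a) \<and> (r, c) \<notin> se (X a)} \<le>
        card (insert q {a \<in> Q. source L a < m \<and> m \<le> sink L (S a) \<and> (s, d) \<notin> se (X a)})"
      using finQ by (intro card_mono) auto
    also have "\<dots> \<le> Suc (card {a \<in> Q. source L a < m \<and> m \<le> sink L (S a) \<and> (s, d) \<notin> se (X a)})"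
      by (rule card_insert_le_m1) (auto simp: finQ)
    also have "\<dots> \<le> Suc (card C)" using card_le by simp
    also have "\<dots> = card (insert (s, d) C)" using C(3) fC by (subst card_insert_disjoint) auto
    finally have "card {a \<in> Q. source L a < m \<and> m \<le> sink L (S a) \<and> (r, c) \<notin> se (X a)} \<le> card (insert (s, d) C)" .
    moreover have "chain (insert (s, d) C)" using C(2,3) by (fastforce simp: chain_def)
    moreover have "source L r < m" using m(1) source_less_iff[of r s] rc sd V(3) by linarith
    moreover have "m \<le> sink L c" using m(2) sink_less_iff[of d c] rc sd V(4) by linarith
    moreover have "\<forall>(s', d')\<in>insert (s, d) C. r < s' \<and> d' < c \<and> source L s' < m \<and> m \<le> sink L d'"
      using C(3) m V by auto
    ultimately show ?thesis using C(1) V(2) by blast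
  next
    case False
    define H where "H = {a \<in> G. a \<le> r}"
    have finH: "finite H" using finQ by (auto simp: H_def G_def)
    \<comment> \<open>Otherwise an outermost path enclosing \<open>a\<close> passes around
      \<open>(r, c)\<close> and so contains a \<open>+\<close> strictly southeast of it, which this
      case excludes.\<close>
    have H: "S a < c" if aH: "a \<in> H" for a
    proof (rule ccontr)
      assume n: "\<not> S a < c"
      obtain a' where a': "outer a'" "a' \<le> a" "S a \<le> S a'" using ex_outer[of a] aH by (auto simp: H_def)
      have a'G: "a' \<in> G" "a' \<in> Q" "(r, c) \<notin> se (X a')" using a'(1) by (auto simp: outer_def G_def)
      have "a' \<le> r" using a' aH by (simp add: H_def)
      moreover have "(a', first_col a') \<in> set (X a')"
        using runX(1,2)[OF a'G(2)] run_nonempty hd_in_set by metis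
      ultimately have "first_col a' < c"
        using a'G(3) unfolding se_def by (metis (mono_tags, lifting) case_prodI mem_Collect_eq not_le)
      then have "\<exists>V\<in>set (X a'). V \<in> pluses L \<and> r < fst V \<and> snd V < c"
        using run_turn_around[OF runX(1)[OF a'G(2)]] runX(2)[OF a'G(2)] \<open>a' \<le> r\<close> n a' a'G by auto
      then show False using False a'(1) by auto
    qed
    \<comment> \<open>Including the source of row \<open>r\<close> covers the case of empty
      \<open>H\<close>; the successor makes all paths of \<open>H\<close> end before
      \<open>m\<close>.\<close>
    define m where "m = Suc (Max (insert (source L r) ((\<lambda>a. sink L (S a)) ` H)))"
    have m_in: "m - 1 = source L r \<or> (\<exists>a\<in>H. m - 1 = sink L (S a))"
      using Max_in[of "insert (source L r) ((\<lambda>a. sink L (S a)) ` H)"] finH unfolding m_def by auto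
    have m_gt: "source L r < m" "\<And>a. a \<in> H \<Longrightarrow> sink L (S a) < m"
      using finH unfolding m_def by (auto simp: less_Suc_eq_le)
    have m_le: "m \<le> sink L c"
    proof -
      have "sink L (S a) < sink L c" if "a \<in> H" for a
        using H[OF that] sink_less_iff[of "S a" c] runX[of a] GQ that rc by (auto simp: H_def)
      then have "m - 1 < sink L c" using m_in less.prems box_source_sink(1)[OF rc] by auto
      then show ?thesis by simp
    qed
    \<comment> \<open>An outermost path \<open>q\<close> over such an \<open>a\<close> starts below
      row \<open>r\<close>. If it ends east of column \<open>c\<close>, its first \<open>+\<close>
      lies strictly southeast of \<open>(r, c)\<close>. Otherwise its source precedes the sink
      \<open>m - 1\<close> of some path of \<open>H\<close>, which by planarity encloses it although
      that sink lies east of column \<open>c\<close>.\<close>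
    have "{a \<in> Q. source L a < m \<and> m \<le> sink L (S a) \<and> (r, c) \<notin> se (X a)} = {}"
    proof (rule equals0I)
      fix a assume a: "a \<in> {a \<in> Q. source L a < m \<and> m \<le> sink L (S a) \<and> (r, c) \<notin> se (X a)}"
      then have "a \<in> G" by (simp add: G_def)
      then obtain q where q: "outer q" "q \<le> a" "S a \<le> S q" using ex_outer by blast
      have qQ: "q \<in> Q" "q \<in> G" using q GQ by (auto simp: outer_def)
      have aQ: "a \<in> Q" using a by simp
      have qm: "source L q < m" "m \<le> sink L (S q)"
        using a q source_less_iff[of a q] sink_less_iff[of "S q" "S a"] runX[OF qQ(1)] runX[OF aQ] by auto
      have rq: "r < q" using m_gt(2)[of q] qm qQ by (cases "q \<le> r") (auto simp: H_def)
      show False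
      proof (cases "S q < c")
        case True
        obtain e where "first_col q \<le> e" "(q, e) \<in> pluses L" using X[OF qQ(1)] by (auto simp: full_run_def)
        then obtain s d where V: "(s, d) \<in> set (X q)" "(s, d) \<in> pluses L"
          using run_turn[OF runX(1)[OF qQ(1)], of e] runX(2)[OF qQ(1)] by auto
        then show False
          using False q(1) True rq run_bounds[OF runX(1)[OF qQ(1)] V(1)] runX(2)[OF qQ(1)] by fastforce
      next
        case geq: False
        have "source L r < source L q" using source_less_iff[of r q] rq rc runX(4)[OF qQ(1)] by simp
        then have "m - 1 \<noteq> source L r" using qm by simp
        then obtain a' where a': "a' \<in> H" "m - 1 = sink L (S a')" using m_in by blast
        then have a'Q: "a' \<in> Q" "a' < q" using rq GQ by (auto simp: H_def)
        have "source L q \<noteq> sink L (S a')" using source_neq_sink runX qQ a'Q by blast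
        then have "S q < S a'" using nested[OF a'Q(1) qQ(1) a'Q(2)] qm a' by simp
        then show False using H[OF a'(1)] geq by simp
      qed
    qed
    then have "card {a \<in> Q. source L a < m \<and> m \<le> sink L (S a) \<and> (r, c) \<notin> se (X a)} \<le> card ({} :: (nat \<times> nat) set)"
      by (simp only: card.empty order_refl)
    moreover have "chain {}" by (simp add: chain_def)
    ultimately show ?thesis using m_gt(1) m_le by blast
  qed
qed

section \<open>Hooks as runs\<close>

fun hook_boxes :: "nat \<times> nat \<Rightarrow> (nat \<times> nat) list" where
  "hook_boxes (r, c) =
     map (\<lambda>d. (r, d)) [first_col r..<Suc c] @ map (\<lambda>s. (s, c)) [Suc r..<Suc (col_height L c)]"

lemma hook_path_of: "hook L (r, c) = path_of r c (hook_boxes (r, c))"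
  by (simp add: path_of_def first_col_def)

lemma run_vertical:
  "run b xs \<Longrightarrow> hd xs = (s, b) \<Longrightarrow> xs = map (\<lambda>s. (s, b)) [s..<Suc (col_height L b)]"
proof (induction arbitrary: s rule: run.induct)
  case (run_step x y xs)
  have "snd y \<le> b" using run_bounds[OF run_step(2), of y] by simp
  with run_step have y: "y = (Suc s, b)" "s < col_height L b" by (auto simp: box_step_def)
  then have "y # xs = map (\<lambda>s. (s, b)) [Suc s..<Suc (col_height L b)]" using run_step by simp
  then show ?case using y(2) run_step.prems by (simp add: upt_conv_Cons del: upt_Suc)
qed simp

text \<open>Having left row \<open>a\<close> the run cannot return, so it goes straight west to
  column \<open>b\<close>; this is its last column, so only south steps remain. The corner is a
  \<open>+\<close> by the Le-condition.\<close>

lemma run_hook: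
  "run b xs \<Longrightarrow> hd xs = (a, d) \<Longrightarrow> (a, b) \<in> set xs \<Longrightarrow> d \<le> e \<Longrightarrow> (a, e) \<in> pluses L \<Longrightarrow>
    xs = map (\<lambda>d. (a, d)) [d..<Suc b] @ map (\<lambda>s. (s, b)) [Suc a..<Suc (col_height L b)] \<and> (a, b) \<in> pluses L"
proof (induction arbitrary: d e rule: run.induct)
  case (run_end r)
  have r: "(r, b) \<in> boxes L" using run_end plus_box by blast
  then have "(col_height L b, b) \<in> boxes L" "r \<le> col_height L b" by (simp_all add: box_col_height)
  then show ?case using plus_corner[of "col_height L b" b r e] run_end by simp
next
  case (run_step x y xs)
  have x: "x = (a, d)" using run_step.prems by simp
  have run: "run b (x # y # xs)" using run_step run.run_step by blast
  have db: "d \<le> b" using run_bounds[OF run, of x] x by simp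
  from run_step(1) show ?case
  proof (cases rule: box_step_cases)
    case (west r d' c)
    then have y: "y = (a, Suc d)" "d < c" "(a, c) \<in> pluses L" using x by auto
    have "Suc d \<le> b" using run_bounds[OF run_step(2), of y] y by simp
    then have "(a, b) \<in> set (y # xs)" using run_step.prems x by auto
    then have "y # xs = map (\<lambda>d. (a, d)) [Suc d..<Suc b] @ map (\<lambda>s. (s, b)) [Suc a..<Suc (col_height L b)] \<and> (a, b) \<in> pluses L"
      using run_step.IH[of "Suc d" c] y by simp
    then show ?thesis using x \<open>Suc d \<le> b\<close> by (simp add: upt_conv_Cons del: upt_Suc)
  next
    case (south s d' r)
    then have y: "y = (Suc a, d)" "r \<le> a" "(r, d) \<in> pluses L" "a < col_height L d" using x by auto
    have "(a, b) \<notin> set (y # xs)" using run_bounds[OF run_step(2), of "(a, b)"] y by auto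
    then have bd: "b = d" using run_step.prems x by auto
    have "(a, d) \<in> pluses L"
      using plus_corner[of a d r e] box_step_boxes[OF run_step(1)] x y run_step.prems by simp
    moreover have "y # xs = map (\<lambda>s. (s, b)) [Suc a..<Suc (col_height L b)]"
      using run_vertical[OF run_step(2)] y bd by simp
    ultimately show ?thesis using x bd by simp
  qed
qed

lemma full_run_hook:
  assumes "full_run a b xs" "(a, b) \<in> set xs"
  shows "xs = hook_boxes (a, b)" "(a, b) \<in> pluses L"
  using run_hook[of b xs a "first_col a"] assms by (auto simp: full_run_def)

lemma hook_full_run:
  assumes B: "(r, c) \<in> pluses L"
  shows "full_run r c (hook_boxes (r, c))"
proof -
  have b: "first_col r \<le> c" "r \<le> col_height L c"
    using plus_box[OF B] box_iff[of r c] box_col_height[of r c] by simp_all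
  have vertical: "run c (map (\<lambda>s. (s, c)) [s..<Suc (col_height L c)])"
    if "r \<le> s" "s \<le> col_height L c" for s
    using that
  proof (induction "col_height L c - s" arbitrary: s)
    case 0
    then show ?case using run_end[OF B] by simp
  next
    case (Suc m)
    then have s: "s < col_height L c" by simp
    have "box_step (s, c) (Suc s, c)" using s Suc.prems B by (auto simp: box_step_def)
    moreover have "run c (map (\<lambda>s. (s, c)) [Suc s..<Suc (col_height L c)])" using Suc s by simp
    ultimately show ?case using s by (simp add: upt_conv_Cons run_step del: upt_Suc)
  qed
  have "run c (map (\<lambda>d. (r, d)) [d..<Suc c] @ map (\<lambda>s. (s, c)) [Suc r..<Suc (col_height L c)])"
    if "first_col r \<le> d" "d \<le> c" for d
    using that
  proof (induction "c - d" arbitrary: d)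
    case 0
    then show ?case using vertical[of r] b by (simp add: upt_conv_Cons del: upt_Suc)
  next
    case (Suc m)
    then have d: "d < c" by simp
    have "box_step (r, d) (r, Suc d)" using d Suc.prems B by (auto simp: box_step_def)
    moreover have "run c (map (\<lambda>d. (r, d)) [Suc d..<Suc c] @ map (\<lambda>s. (s, c)) [Suc r..<Suc (col_height L c)])"
      using Suc d by simp
    ultimately show ?case using d by (simp add: upt_conv_Cons run_step del: upt_Suc)
  qed
  then have "run c (hook_boxes (r, c))" using b by simp
  moreover have "hd (hook_boxes (r, c)) = (r, first_col r)"
    using b by (simp add: upt_conv_Cons del: upt_Suc)
  ultimately show ?thesis using B b by (auto simp: full_run_def simp del: hook_boxes.simps)
qed

lemma hook_boxes_set:
  assumes "(r, c) \<in> pluses L"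
  shows "set (hook_boxes (r, c)) = {(r, d) |d. first_col r \<le> d \<and> d \<le> c} \<union> {(s, c) |s. r \<le> s \<and> s \<le> col_height L c}"
proof -
  have "first_col r \<le> c" "r \<le> col_height L c"
    using plus_box[OF assms] box_iff[of r c] box_col_height[of r c] by simp_all
  then show ?thesis by (auto simp: less_Suc_eq_le Suc_le_eq le_less image_iff)
qed

lemma hook_boxes_se:
  assumes "(r, c) \<in> pluses L"
  shows "se (hook_boxes (r, c)) = {(s, d). r \<le> s \<and> d \<le> c}"
proof -
  have "first_col r \<le> c" "r \<le> col_height L c"
    using plus_box[OF assms] box_iff[of r c] box_col_height[of r c] by simp_all
  then show ?thesis unfolding se_def hook_boxes_set[OF assms] by auto
qed

subsection \<open>Weights\<close>

text \<open>
  A path is weighted by its horizontal steps: entering column \<open>d\<close> at row \<open>r\<close> puts exactly the boxes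
  \<open>(s, d)\<close> with \<open>r \<le> s\<close> to the southeast.
\<close>

definition row_weight :: "(nat \<times> nat \<Rightarrow> real) \<Rightarrow> nat \<times> nat \<Rightarrow> real" where
  "row_weight T x = (\<Prod>B\<in>{B \<in> pluses L. fst x \<le> fst B \<and> snd B = snd x}. T B)"

fun edge_weight :: "(nat \<times> nat \<Rightarrow> real) \<Rightarrow> vertex \<Rightarrow> vertex \<Rightarrow> real" where
  "edge_weight T (Boundary i) (Corner y) = row_weight T y"
| "edge_weight T (Corner x) (Corner y) = (if fst x = fst y then row_weight T y else 1)"
| "edge_weight T u (Boundary j) = 1"

lemma path_weight_eq: "path_weight L T p = (\<Prod>B\<in>pluses L \<inter> southeast p. T B)"
proof -
  have "{F \<in> faces L. face_southeast F p} = Face ` (pluses L \<inter> southeast p)"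
    by (auto simp: faces_def)
  then show ?thesis unfolding path_weight_def
    by (simp add: prod.reindex inj_on_def)
qed

lemma se_Cons: "se ((r, d) # xs) = {(s, c). r \<le> s \<and> c \<le> d} \<union> se xs"
  by (auto simp: se_def)

text \<open>The extra factor is the weight southeast of the first box alone: the boxes in its column
  and further east that no later west step adds.\<close>

lemma run_weight:
  "run b xs \<Longrightarrow> hd xs = x \<Longrightarrow> (\<Prod>B\<in>pluses L \<inter> se xs. T B) =
    (\<Prod>B\<in>{B \<in> pluses L. fst x \<le> fst B \<and> snd B \<le> snd x}. T B) *
    walk_weight (edge_weight T) (map Corner xs @ [Boundary (sink L b)])"
proof (induction arbitrary: x rule: run.induct)
  case (run_end r)
  have "pluses L \<inter> se [(col_height L b, b)] = {B \<in> pluses L. fst x \<le> fst B \<and> snd B \<le> snd x}"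
    using run_end by (auto simp: se_def)
  then show ?case using run_end by simp
next
  case (run_step z y xs)
  let ?W = "walk_weight (edge_weight T) (Corner y # map Corner xs @ [Boundary (sink L b)])"
  have fin: "finite (pluses L)" using finite_pluses[OF le] .
  have z: "z = x" using run_step.prems by simp
  have hy: "y \<in> set (y # xs)" by simp
  have IH: "(\<Prod>B\<in>pluses L \<inter> se (y # xs). T B) =
    (\<Prod>B\<in>{B \<in> pluses L. fst y \<le> fst B \<and> snd B \<le> snd y}. T B) * ?W"
    using run_step.IH[of y] by simp
  from run_step(1) show ?case
  proof (cases rule: box_step_cases)
    case (west r d c)
    have "se (z # y # xs) = se (y # xs)" using west by (auto simp: se_Cons)
    moreover have "{B \<in> pluses L. fst y \<le> fst B \<and> snd B \<le> snd y} =
        {B \<in> pluses L. fst x \<le> fst B \<and> snd B \<le> snd x} \<union> {B \<in> pluses L. fst y \<le> fst B \<and> snd B = snd y}"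
      using west z by auto
    moreover have "(\<Prod>B\<in>\<dots>. T B) = (\<Prod>B\<in>{B \<in> pluses L. fst x \<le> fst B \<and> snd B \<le> snd x}. T B) * row_weight T y"
      unfolding row_weight_def using fin west z by (subst prod.union_disjoint) auto
    ultimately show ?thesis using IH west by simp
  next
    case (south s d r)
    have rows0: "Suc s \<le> fst v" if "v \<in> set (y # xs)" for v
      using run_bounds[OF run_step(2) that] south by simp
    have rows: "Suc s \<le> fst B" if B: "B \<in> se (y # xs)" for B
    proof -
      obtain r' c' where "(r', c') \<in> set (y # xs)" "r' \<le> fst B"
        using B by (cases B) (auto simp: se_def simp del: list.set)
      then show ?thesis using rows0[of "(r', c')"] by simp
    qed
    have "{(s', c). Suc s \<le> s' \<and> c \<le> d} \<subseteq> se (y # xs)" using south by (simp add: se_Cons)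
    moreover have "{(s', c). s \<le> s' \<and> c \<le> d} = {(s', c). Suc s \<le> s' \<and> c \<le> d} \<union> {B. fst B = s \<and> snd B \<le> d}"
      by auto
    ultimately have "se (z # y # xs) = se (y # xs) \<union> {B. fst B = s \<and> snd B \<le> d}"
      unfolding south(1) se_Cons[of s d "y # xs"] by blast
    then have "pluses L \<inter> se (z # y # xs) =
        (pluses L \<inter> se (y # xs)) \<union> {B \<in> pluses L. fst B = s \<and> snd B \<le> d}" by auto
    moreover have "(pluses L \<inter> se (y # xs)) \<inter> {B \<in> pluses L. fst B = s \<and> snd B \<le> d} = {}"
      using rows by force
    ultimately have 1: "(\<Prod>B\<in>pluses L \<inter> se (z # y # xs). T B) =
        (\<Prod>B\<in>pluses L \<inter> se (y # xs). T B) * (\<Prod>B\<in>{B \<in> pluses L. fst B = s \<and> snd B \<le> d}. T B)"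
      using fin by (simp add: prod.union_disjoint)
    have "{B \<in> pluses L. fst x \<le> fst B \<and> snd B \<le> snd x} =
        {B \<in> pluses L. fst y \<le> fst B \<and> snd B \<le> snd y} \<union> {B \<in> pluses L. fst B = s \<and> snd B \<le> d}"
      using south z by auto
    moreover have "{B \<in> pluses L. fst y \<le> fst B \<and> snd B \<le> snd y} \<inter> {B \<in> pluses L. fst B = s \<and> snd B \<le> d} = {}"
      using south by auto
    ultimately have 2: "(\<Prod>B\<in>{B \<in> pluses L. fst x \<le> fst B \<and> snd B \<le> snd x}. T B) =
        (\<Prod>B\<in>{B \<in> pluses L. fst y \<le> fst B \<and> snd B \<le> snd y}. T B) * (\<Prod>B\<in>{B \<in> pluses L. fst B = s \<and> snd B \<le> d}. T B)"
      using fin by (simp add: prod.union_disjoint)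
    have "fst z \<noteq> fst y" using south by simp
    then have 3: "walk_weight (edge_weight T) (map Corner (z # y # xs) @ [Boundary (sink L b)]) = ?W"
      by simp
    show ?thesis unfolding 1 2 3 IH by (simp only: mult_ac)
  qed
qed

lemma path_of_weight:
  assumes "full_run a b xs"
  shows "walk_weight (edge_weight T) (path_of a b xs) = path_weight L T (path_of a b xs)"
proof -
  have run: "run b xs" "hd xs = (a, first_col a)" using assms by (auto simp: full_run_def)
  then obtain ys where xs: "xs = (a, first_col a) # ys" using run_nonempty by (cases xs) auto
  then have "(a, first_col a) \<in> boxes L" using run_boxes[OF run(1)] by simp
  then have a: "1 \<le> a" by (simp add: box_iff)
  \<comment> \<open>No lower row has a box east of \<open>first_col a\<close>, so the extra factor
    of \<open>run_weight\<close> is exactly the weight of the edge entering the diagram.\<close>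
  have "{B \<in> pluses L. a \<le> fst B \<and> snd B \<le> first_col a} = {B \<in> pluses L. a \<le> fst B \<and> snd B = first_col a}"
  proof -
    have "first_col a \<le> snd B" if "B \<in> pluses L" "a \<le> fst B" for B
      using plus_box[OF that(1)] first_col_mono[of a "fst B"] that(2) a by (cases B) (auto simp: box_iff)
    then show ?thesis by fastforce
  qed
  then have "row_weight T (a, first_col a) = (\<Prod>B\<in>{B \<in> pluses L. a \<le> fst B \<and> snd B \<le> first_col a}. T B)"
    by (simp add: row_weight_def)
  then show ?thesis
    using run_weight[OF run] unfolding path_weight_eq southeast_path_of
    by (simp add: path_of_def xs)
qed

end

lemma successively_butlast:
  "successively P xs \<Longrightarrow> (\<And>x. x \<in> set (butlast xs) \<Longrightarrow> R x) \<Longrightarrow> successively (\<lambda>a b. P a b \<and> R a) xs"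
  by (induction xs rule: induct_list012) auto

context ranked_digraph begin

text \<open>The recursion required of \<open>\<phi>\<close> in \<open>lgv\<close>.\<close>

lemma walk_sum_step:
  assumes "u \<notin> Z"
  shows "(\<Sum>p\<in>walks E Z u. walk_weight w p) =
    (\<Sum>v | (u, v) \<in> E. w u v * (\<Sum>p\<in>walks E Z v. walk_weight w p) :: 'a::comm_semiring_1)"
proof -
  have "walks E Z u = (\<Union>v\<in>{v. (u, v) \<in> E}. Cons u ` walks E Z v)"
    using walks_step[of E Z u] by (simp only: assms if_False Un_empty_left)
  moreover have "(\<Sum>p\<in>(\<Union>v\<in>{v. (u, v) \<in> E}. Cons u ` walks E Z v). walk_weight w p) =
      (\<Sum>v | (u, v) \<in> E. \<Sum>p\<in>Cons u ` walks E Z v. walk_weight w p)"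
    using finite_succ finite_walks by (intro sum.UNION_disjoint) (auto simp: walks_def)
  moreover have "(\<Sum>p\<in>Cons u ` walks E Z v. walk_weight w p) = w u v * (\<Sum>p\<in>walks E Z v. walk_weight w p)" for v
  proof -
    have "(\<Sum>p\<in>Cons u ` walks E Z v. walk_weight w p) = (\<Sum>p\<in>walks E Z v. walk_weight w (u # p))"
      by (subst sum.reindex) (auto simp: inj_on_def)
    also have "\<dots> = (\<Sum>p\<in>walks E Z v. w u v * walk_weight w p)"
    proof (intro sum.cong refl)
      fix p assume "p \<in> walks E Z v"
      then obtain q where "p = v # q" by (cases p) (auto simp: walks_def)
      then show "walk_weight w (u # p) = w u v * walk_weight w p" by simp
    qed
    finally show ?thesis by (simp add: sum_distrib_left)
  qed
  ultimately show ?thesis by simp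
qed

end

section \<open>Path families and their planarity\<close>

context le_filling begin

lemma edge_into_boundary: "(u, Boundary j) \<in> gamma_graph L \<Longrightarrow> \<exists>c\<in>{1..num_cols L}. j = sink L c"
  unfolding gamma_graph_iff using plus_col by auto

lemma full_run_box: "full_run a b xs \<Longrightarrow> (a, b) \<in> boxes L"
proof -
  assume "full_run a b xs"
  then have r: "run b xs" "hd xs = (a, first_col a)" by (auto simp: full_run_def)
  then have "(a, first_col a) \<in> set xs" using hd_in_set[OF run_nonempty] by metis
  then show ?thesis using run_boxes[OF r(1)] run_bounds[OF r(1)] run_col[OF r(1)] by (fastforce simp: box_iff)
qed

lemma full_run_less: "full_run a b xs \<Longrightarrow> source L a < sink L b"
  using full_run_box box_source_sink(1) by (metis box_iff)

lemma last_path_of: "last (path_of a b xs) = Boundary (sink L b)"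
  by (simp add: path_of_def)

lemma corner_path_of: "Corner x \<in> set (path_of a b xs) \<longleftrightarrow> x \<in> set xs"
  by (auto simp: path_of_def)

lemma family_cases:
  assumes A: "A \<in> path_families L J" and a: "a \<in> {1..num_rows L}"
  obtains (trivial) "source L a \<in> J" "A (source L a) = [Boundary (source L a)]"
    | (run) b xs where "source L a \<notin> J" "b \<in> {1..num_cols L}" "sink L b \<in> J" "full_run a b xs"
        "A (source L a) = path_of a b xs"
proof -
  have s: "source L r \<in> sources L" if "r \<in> {1..num_rows L}" for r using that by (auto simp: sources_def)
  have g: "gamma_path L (A (source L r))" "hd (A (source L r)) = Boundary (source L r)"
    "last (A (source L r)) \<in> Boundary ` J" if "r \<in> {1..num_rows L}" for r
    using A s[OF that] by (auto simp: path_families_def)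
  obtain j where j: "last (A (source L a)) = Boundary j" "j \<in> J" using g(3)[OF a] by blast
  from g(1,2)[OF a] j(1) a show thesis
  proof (cases rule: gamma_path_cases)
    case trivial
    then show thesis using that(1) j by simp
  next
    case (run b xs)
    \<comment> \<open>Otherwise some path of the family ends at this source. No edge enters a
      source, so that path would be the trivial one starting there.\<close>
    have "source L a \<notin> J"
    proof
      assume "source L a \<in> J"
      then have "Boundary (source L a) \<in> (\<lambda>i. last (A i)) ` sources L"
        using A by (auto simp: path_families_def)
      then obtain r where r: "r \<in> {1..num_rows L}" "last (A (source L r)) = Boundary (source L a)"
        by (auto simp: sources_def)
      from g(1,2)[OF r(1)] r(2,1) show False
      proof (cases rule: gamma_path_cases)
        case trivial
        then have "r = a" using source_eq_iff r a by metis
        then show False using trivial run by (simp add: path_of_def)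
      next
        case (run b' xs')
        then show False using source_neq_sink[OF a] by blast
      qed
    qed
    then show thesis using that(2) run j by simp
  qed
qed

lemma family_disjoint:
  assumes A: "A \<in> path_families L J" and a: "a \<in> {1..num_rows L}" "a' \<in> {1..num_rows L}" "a \<noteq> a'"
    and "A (source L a) = path_of a b xs" "A (source L a') = path_of a' b' xs'"
  shows "set xs \<inter> set xs' = {}"
proof -
  have "set (A (source L a)) \<inter> set (A (source L a')) = {}"
    using A a source_eq_iff[OF a(1,2)] by (auto simp: path_families_def disjoint_family_on_def sources_def)
  then show ?thesis using assms(5,6) corner_path_of by (metis disjoint_iff)
qed

text \<open>If the path from \<open>a\<close> ends beyond the source of \<open>a'\<close>, the other
  path starts under it and ends before it. Otherwise the targets are separated by the source of
  \<open>a'\<close>.\<close>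

lemma family_noncrossing:
  assumes A: "A \<in> path_families L J" and a: "a \<in> {1..num_rows L}" "a' \<in> {1..num_rows L}" "a < a'"
    and j: "last (A (source L a)) = Boundary j" "last (A (source L a')) = Boundary j'"
  shows "j' < j \<longleftrightarrow> source L a' < j"
proof -
  have less: "source L a < source L a'" using source_less_iff a by simp
  from A a(1) show ?thesis
  proof (cases rule: family_cases)
    case trivial
    then have "j = source L a" using j by simp
    moreover have "source L a' \<le> j'"
      using A a(2) by (cases rule: family_cases) (use j full_run_less in \<open>auto simp: last_path_of less_imp_le\<close>)
    ultimately show ?thesis using less by simp
  next
    case (run b xs)
    then have jb: "j = sink L b" using j by (simp add: last_path_of)
    from A a(2) show ?thesis
    proof (cases rule: family_cases)
      case trivial
      then show ?thesis using j jb by simp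
    next
      case run': (run b' xs')
      then have jb': "j' = sink L b'" using j by (simp add: last_path_of)
      have "sink L b' < sink L b" if "source L a' < sink L b"
      proof -
        have "set xs \<inter> set xs' = {}" using family_disjoint[OF A a(1,2)] a(3) run run' by blast
        then have "b' < b"
          using run_nested(2)[of b xs a b' xs' a'] run run' a(3) that box_source_sink(1)[OF a(2) run(2)]
          by (simp add: full_run_def)
        then show ?thesis using sink_less_iff run(2) run'(2) by simp
      qed
      then show ?thesis using full_run_less[OF run'(4)] jb jb' by auto
    qed
  qed
qed

text \<open>Every inner step raises row plus column by one. The constants put sources above all
  corners and sinks below them.\<close>

definition vrank :: "vertex \<Rightarrow> nat" where
  "vrank v = (case v of
     Boundary i \<Rightarrow> (if i \<in> sources L then Suc (Suc (num_rows L + num_cols L)) else 0)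
   | Corner x \<Rightarrow> Suc (num_rows L + num_cols L - (fst x + snd x)))"

lemma gamma_graph_rank:
  assumes "(u, v) \<in> gamma_graph L"
  shows "vrank v < vrank u"
  using assms unfolding gamma_graph_iff
proof (elim disjE exE conjE)
  fix r c assume "(r, c) \<in> pluses L" "u = Boundary (source L r)" "v = Corner (r, first_col r)"
  then show ?thesis using plus_row by (auto simp: vrank_def sources_def)
next
  fix x y assume xy: "box_step x y" "u = Corner x" "v = Corner y"
  then have "fst y + snd y \<le> num_rows L + num_cols L" using box_step_boxes[OF xy(1)] by (cases y) (auto simp: box_iff)
  moreover have "fst y + snd y = Suc (fst x + snd x)" using xy(1) by (auto simp: box_step_def)
  ultimately show ?thesis using xy by (simp add: vrank_def)
next
  fix r c assume "(r, c) \<in> pluses L" "u = Corner (col_height L c, c)" "v = Boundary (sink L c)"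
  then show ?thesis using sink_not_source[OF plus_col] by (auto simp: vrank_def)
qed

lemma finite_gamma_succ: "finite {v. (u, v) \<in> gamma_graph L}"
proof (rule finite_subset)
  show "{v. (u, v) \<in> gamma_graph L} \<subseteq> snd ` gamma_graph L" by force
  show "finite (snd ` gamma_graph L)"
    unfolding gamma_graph_def using finite_pluses[OF le] by auto
qed

text \<open>
  A source in \<open>J\<close> is the end of its own path, so its outgoing edges are removed to make all elements
  of \<open>J\<close> terminal.
\<close>

definition stopped_graph :: "nat set \<Rightarrow> (vertex \<times> vertex) set" where
  "stopped_graph J = {(u, v). (u, v) \<in> gamma_graph L \<and> u \<notin> Boundary ` J}"

lemma stopped_digraph: "terminal_digraph (stopped_graph J) vrank (Boundary ` J)"
proof unfold_locales
  show "finite {v. (u, v) \<in> stopped_graph J}" for u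
    by (rule finite_subset[OF _ finite_gamma_succ[of u]]) (auto simp: stopped_graph_def)
qed (auto simp: stopped_graph_def gamma_graph_rank)

lemma path_of_stopped:
  assumes "full_run a b xs" "source L a \<notin> J"
  shows "successively (\<lambda>u v. (u, v) \<in> stopped_graph J) (path_of a b xs)"
proof -
  have "successively (\<lambda>u v. (u, v) \<in> gamma_graph L \<and> u \<notin> Boundary ` J) (path_of a b xs)"
    using full_run_gamma_path[OF assms(1)] assms(2)
    by (intro successively_butlast) (auto simp: gamma_path_def path_of_def butlast_append split: if_splits)
  then show ?thesis by (simp add: stopped_graph_def)
qed

text \<open>Disjointness makes the endpoints distinct, so \<open>k\<close> walks ending in a set of
  \<open>k\<close> labels exhaust it.\<close>

lemma path_families_walks:
  assumes J: "finite J" "card J = num_rows L"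
  shows "path_families L J = walk_families (stopped_graph J) (Boundary ` J) (sources L) Boundary"
proof (intro equalityI subsetI)
  fix A assume A: "A \<in> path_families L J"
  have "A i \<in> walks (stopped_graph J) (Boundary ` J) (Boundary i)" if "i \<in> sources L" for i
  proof -
    obtain a where a: "a \<in> {1..num_rows L}" "i = source L a" using \<open>i \<in> sources L\<close> by (auto simp: sources_def)
    from A a(1) show ?thesis
    proof (cases rule: family_cases)
      case trivial
      then show ?thesis using a by (auto simp: walks_def)
    next
      case (run b xs)
      then show ?thesis using a path_of_stopped[OF run(4,1)] by (auto simp: walks_def last_path_of) (simp add: path_of_def)+
    qed
  qed
  then show "A \<in> walk_families (stopped_graph J) (Boundary ` J) (sources L) Boundary"
    using A by (auto simp: path_families_def walk_families_def)
next
  fix A assume A: "A \<in> walk_families (stopped_graph J) (Boundary ` J) (sources L) Boundary"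
  have w: "A i \<in> walks (stopped_graph J) (Boundary ` J) (Boundary i)" if "i \<in> sources L" for i
    using A that by (simp add: walk_families_def)
  have "gamma_path L (A i) \<and> hd (A i) = Boundary i \<and> last (A i) \<in> Boundary ` J" if "i \<in> sources L" for i
    using w[OF that] unfolding walks_def gamma_path_def stopped_graph_def
    by (auto elim: successively_mono)
  moreover have dis: "disjoint_family_on (\<lambda>i. set (A i)) (sources L)"
    using A by (simp add: walk_families_def)
  have "inj_on (\<lambda>i. last (A i)) (sources L)"
  proof (rule inj_onI, rule ccontr)
    fix i j assume ij: "i \<in> sources L" "j \<in> sources L" "last (A i) = last (A j)" "i \<noteq> j"
    have "A i \<noteq> []" "A j \<noteq> []" using w ij by (auto simp: walks_def)
    then have "last (A i) \<in> set (A i) \<inter> set (A j)" using ij(3) last_in_set by (metis IntI)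
    then show False using dis ij by (auto simp: disjoint_family_on_def)
  qed
  then have "card ((\<lambda>i. last (A i)) ` sources L) = card (Boundary ` J)"
    using J by (simp add: card_image card_sources inj_on_def)
  ultimately have "(\<lambda>i. last (A i)) ` sources L = Boundary ` J"
    using J by (intro card_subset_eq) auto
  then show "A \<in> path_families L J"
    using A dis \<open>\<And>i. i \<in> sources L \<Longrightarrow> gamma_path L (A i) \<and> hd (A i) = Boundary i \<and> last (A i) \<in> Boundary ` J\<close>
    by (auto simp: path_families_def walk_families_def)
qed

subsection \<open>Boundary measurements as minors\<close>

text \<open>
  For a sink \<open>j\<close>, \<open>flip i * flip j\<close> is \<open>-1\<close> to the number of sources \<open>i'\<close> with \<open>i < i' < j\<close>, the sign
  that makes the minors subtraction-free.
\<close>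

definition flip :: "nat \<Rightarrow> real" where
  "flip m = (-1) ^ card {i \<in> sources L. i \<le> m}"

definition walk_sum :: "(nat \<times> nat \<Rightarrow> real) \<Rightarrow> nat \<Rightarrow> nat \<Rightarrow> real" where
  "walk_sum T i j = (\<Sum>p\<in>walks (gamma_graph L) {Boundary j} (Boundary i). walk_weight (edge_weight T) p)"

text \<open>The source columns form the identity, since \<open>flip i * flip i = 1\<close>; the
  remaining columns hold signed path sums.\<close>

definition meas_entry :: "(nat \<times> nat \<Rightarrow> real) \<Rightarrow> nat \<Rightarrow> nat \<Rightarrow> real" where
  "meas_entry T i j = flip i * flip j * (if j \<in> sources L then (if j = i then 1 else 0) else walk_sum T i j)"

lemma row_bij: "bij_betw (\<lambda>r. source L (Suc r)) {..<num_rows L} (sources L)"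
proof -
  have "bij_betw Suc {..<num_rows L} {1..num_rows L}"
    by (rule bij_betwI[of _ _ _ "\<lambda>r. r - 1"]) auto
  moreover have "bij_betw (source L) {1..num_rows L} (sources L)"
    using source_inj by (simp add: bij_betw_def sources_def)
  ultimately show ?thesis using bij_betw_trans[of Suc _ "{1..num_rows L}" "source L"] by (simp add: o_def)
qed

lemma row_mono: "r < num_rows L \<Longrightarrow> s < num_rows L \<Longrightarrow> source L (Suc r) < source L (Suc s) \<longleftrightarrow> r < s"
  using source_less_iff[of "Suc r" "Suc s"] by simp

lemma walks_to_source:
  assumes "j \<in> sources L" "E \<subseteq> gamma_graph L"
  shows "walks E {Boundary j} u = (if u = Boundary j then {[u]} else {})"
proof -
  have only: "p = [Boundary j]" if p: "p \<in> walks E {Boundary j} u" for p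
  proof (cases p rule: rev_cases)
    case (snoc q v)
    then have v: "v = Boundary j" using p by (auto simp: walks_def)
    show ?thesis
    proof (cases q rule: rev_cases)
      case (snoc q' v')
      then have "(v', Boundary j) \<in> gamma_graph L"
        using p \<open>p = q @ [v]\<close> v assms(2) by (auto simp: walks_def successively_append_iff)
      then show ?thesis using edge_into_boundary assms(1) sink_not_source by blast
    qed (use snoc v in simp)
  qed (use p in \<open>simp add: walks_def\<close>)
  have iff: "[Boundary j] \<in> walks E {Boundary j} u \<longleftrightarrow> u = Boundary j" by (auto simp: walks_def)
  show ?thesis
  proof (cases "u = Boundary j")
    case True
    have "p \<in> walks E {Boundary j} u \<longleftrightarrow> p = [Boundary j]" for p
      using only[of p] iff True by metis
    then show ?thesis using True by (simp add: set_eq_iff)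
  next
    case False
    have "p \<notin> walks E {Boundary j} u" for p using only[of p] iff False by metis
    then show ?thesis using False by (simp add: set_eq_iff)
  qed
qed

text \<open>No edge enters a source and none leaves a sink, so a nontrivial path meets boundary
  vertices only at its two ends and stopping at \<open>J\<close> removes nothing.\<close>

lemma walks_stopped_eq:
  assumes i: "i \<in> sources L" "i \<notin> J" and j: "j \<notin> sources L"
  shows "walks (stopped_graph J) {Boundary j} (Boundary i) = walks (gamma_graph L) {Boundary j} (Boundary i)"
proof (intro equalityI subsetI)
  fix p assume "p \<in> walks (stopped_graph J) {Boundary j} (Boundary i)"
  then show "p \<in> walks (gamma_graph L) {Boundary j} (Boundary i)"
    unfolding walks_def stopped_graph_def by (auto elim: successively_mono)
next
  fix p assume p: "p \<in> walks (gamma_graph L) {Boundary j} (Boundary i)"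
  obtain a where a: "a \<in> {1..num_rows L}" "i = source L a" using i by (auto simp: sources_def)
  have "gamma_path L p" "hd p = Boundary (source L a)" "last p = Boundary j"
    using p a by (auto simp: walks_def gamma_path_def)
  from this a(1) show "p \<in> walks (stopped_graph J) {Boundary j} (Boundary i)"
  proof (cases rule: gamma_path_cases)
    case trivial
    then show ?thesis using i j a by simp
  next
    case (run b xs)
    then show ?thesis using path_of_stopped[OF run(3)] i a p by (simp add: walks_def)
  qed
qed

lemma family_weight:
  assumes "A \<in> path_families L J"
  shows "(\<Prod>i\<in>sources L. walk_weight (edge_weight T) (A i)) = (\<Prod>i\<in>sources L. path_weight L T (A i))"
proof (intro prod.cong refl)
  fix i assume "i \<in> sources L"
  then obtain a where a: "a \<in> {1..num_rows L}" "i = source L a" by (auto simp: sources_def)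
  from assms a(1) show "walk_weight (edge_weight T) (A i) = path_weight L T (A i)"
  proof (cases rule: family_cases)
    case trivial
    then show ?thesis using a by (simp add: path_weight_eq southeast_trivial)
  next
    case (run b xs)
    then show ?thesis using a path_of_weight by simp
  qed
qed

definition target :: "(nat \<Rightarrow> vertex list) \<Rightarrow> nat \<Rightarrow> nat" where
  "target A i = (case last (A i) of Boundary j \<Rightarrow> j)"

lemma family_target:
  assumes A: "A \<in> path_families L J"
  shows "i \<in> sources L \<Longrightarrow> last (A i) = Boundary (target A i)" "bij_betw (target A) (sources L) J"
    "i \<in> sources L \<Longrightarrow> i \<le> target A i" "i \<in> sources L \<Longrightarrow> target A i \<in> sources L \<Longrightarrow> target A i = i"
proof -
  have last: "last (A i) = Boundary (target A i)" if "i \<in> sources L" for i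
  proof -
    have "last (A i) \<in> Boundary ` J" using A that by (auto simp: path_families_def)
    then show ?thesis by (auto simp: target_def)
  qed
  then show "i \<in> sources L \<Longrightarrow> last (A i) = Boundary (target A i)" by blast
  have "Boundary ` target A ` sources L = Boundary ` J"
    using A last by (auto simp: path_families_def image_image)
  then have img: "target A ` sources L = J" by (simp add: inj_image_eq_iff inj_def)
  have "inj_on (target A) (sources L)"
  proof (rule inj_onI, rule ccontr)
    fix i j assume ij: "i \<in> sources L" "j \<in> sources L" "target A i = target A j" "i \<noteq> j"
    have "A i \<noteq> []" "A j \<noteq> []" using A ij by (auto simp: path_families_def gamma_path_def)
    then have "last (A i) \<in> set (A i) \<inter> set (A j)" using last ij last_in_set by (metis IntI)
    then show False using A ij by (auto simp: path_families_def disjoint_family_on_def)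
  qed
  with img show "bij_betw (target A) (sources L) J" by (simp add: bij_betw_def)
  have *: "i \<le> target A i \<and> (target A i \<in> sources L \<longrightarrow> target A i = i)" if i: "i \<in> sources L" for i
  proof -
    obtain a where a: "a \<in> {1..num_rows L}" "i = source L a" using i by (auto simp: sources_def)
    from A a(1) show ?thesis
    proof (cases rule: family_cases)
      case trivial
      then show ?thesis using last[OF i] a by simp
    next
      case (run b xs)
      then show ?thesis using last[OF i] a full_run_less[OF run(4)] sink_not_source[OF run(2)]
        by (simp add: last_path_of)
    qed
  qed
  then show "i \<in> sources L \<Longrightarrow> i \<le> target A i" "i \<in> sources L \<Longrightarrow> target A i \<in> sources L \<Longrightarrow> target A i = i"
    by blast+
qed

lemma flip_square: "flip m * flip m = 1"
  by (simp add: flip_def flip: power_mult_distrib)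

text \<open>
  Disjoint paths from \<open>i < i'\<close> are nested iff \<open>i'\<close> lies below the target of \<open>i\<close>, so the inversions of
  the matching are counted by the sources passed over by the individual paths.
\<close>

lemma family_inversions:
  assumes A: "A \<in> path_families L J" and s: "s < num_rows L"
  defines "\<kappa> \<equiv> \<lambda>r. source L (Suc r)"
  shows "(\<Prod>r<num_rows L. if s < r \<and> target A (\<kappa> r) < target A (\<kappa> s) then - 1 else 1) =
    flip (\<kappa> s) * flip (target A (\<kappa> s))"
proof -
  let ?k = "num_rows L"
  let ?t = "target A (\<kappa> s)"
  have \<kappa>: "\<kappa> r \<in> sources L" if "r < ?k" for r
    using that by (auto simp: \<kappa>_def sources_def)
  have cross: "target A (\<kappa> r) < ?t \<longleftrightarrow> \<kappa> r < ?t" if "s < r" "r < ?k" for r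
    using family_noncrossing[OF A, of "Suc s" "Suc r"] that s family_target(1)[OF A \<kappa>] by (simp add: \<kappa>_def)
  have "(\<Prod>r<?k. if s < r \<and> target A (\<kappa> r) < ?t then - 1 else 1) =
      (\<Prod>r<?k. if s < r \<and> \<kappa> r < ?t then - 1 else (1 :: real))"
    using cross by (intro prod.cong) auto
  also have "\<dots> = (\<Prod>r\<in>{r \<in> {..<?k}. s < r \<and> \<kappa> r < ?t}. - 1)"
    by (rule prod.inter_filter[symmetric]) simp
  also have "\<dots> = (-1) ^ card {r \<in> {..<?k}. s < r \<and> \<kappa> r < ?t}" by simp
  also have "card {r \<in> {..<?k}. s < r \<and> \<kappa> r < ?t} = card {i \<in> sources L. \<kappa> s < i \<and> i < ?t}"
  proof (rule bij_betw_same_card)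
    have "\<kappa> ` {r \<in> {..<?k}. s < r \<and> \<kappa> r < ?t} = {i \<in> sources L. \<kappa> s < i \<and> i < ?t}"
    proof (intro equalityI subsetI)
      fix i assume "i \<in> {i \<in> sources L. \<kappa> s < i \<and> i < ?t}"
      then obtain r where "r < ?k" "i = \<kappa> r" "\<kappa> s < \<kappa> r" "\<kappa> r < ?t"
        using row_bij by (auto simp: bij_betw_def \<kappa>_def)
      then show "i \<in> \<kappa> ` {r \<in> {..<?k}. s < r \<and> \<kappa> r < ?t}" using row_mono s by (auto simp: \<kappa>_def)
    qed (use \<kappa> s row_mono in \<open>auto simp: \<kappa>_def\<close>)
    moreover have "inj_on \<kappa> {r \<in> {..<?k}. s < r \<and> \<kappa> r < ?t}"
      using row_bij unfolding \<kappa>_def bij_betw_def by (auto intro: inj_on_subset)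
    ultimately show "bij_betw \<kappa> {r \<in> {..<?k}. s < r \<and> \<kappa> r < ?t} {i \<in> sources L. \<kappa> s < i \<and> i < ?t}"
      by (simp add: bij_betw_def)
  qed
  also have "{i \<in> sources L. \<kappa> s < i \<and> i < ?t} = {i \<in> sources L. \<kappa> s < i \<and> i \<le> ?t}"
    using family_target(4)[OF A \<kappa>[OF s]] by (auto simp: le_less)
  also have "(-1) ^ card {i \<in> sources L. \<kappa> s < i \<and> i \<le> ?t} = flip (\<kappa> s) * flip ?t"
  proof -
    have "{i \<in> sources L. i \<le> ?t} = {i \<in> sources L. i \<le> \<kappa> s} \<union> {i \<in> sources L. \<kappa> s < i \<and> i \<le> ?t}"
      using family_target(3)[OF A \<kappa>[OF s]] by auto
    then have "card {i \<in> sources L. i \<le> ?t} =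
        card {i \<in> sources L. i \<le> \<kappa> s} + card {i \<in> sources L. \<kappa> s < i \<and> i \<le> ?t}"
      using finite_sources by (simp add: card_Un_disjoint[symmetric] disjoint_iff)
    then have "flip ?t = flip (\<kappa> s) * (-1) ^ card {i \<in> sources L. \<kappa> s < i \<and> i \<le> ?t}"
      by (simp add: flip_def power_add)
    then have "flip (\<kappa> s) * flip ?t = (flip (\<kappa> s) * flip (\<kappa> s)) * (-1) ^ card {i \<in> sources L. \<kappa> s < i \<and> i \<le> ?t}"
      by (simp only: mult.assoc)
    then show ?thesis by (simp only: flip_square mult_1)
  qed
  finally show ?thesis .
qed

text \<open>In the stopped graph every family for \<open>J\<close> has a matching of the same sign,
  the product of all flips of rows and columns. The scaling in \<open>meas_entry\<close> contributes
  the same product once more, and its square is \<open>1\<close>.\<close>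

theorem measurement_minor:
  assumes J: "J \<subseteq> {1..num_steps L}" "card J = num_rows L"
    and e: "strict_mono_on {..<num_rows L} e" "e ` {..<num_rows L} = J"
  shows "fdet (num_rows L) (\<lambda>r c. meas_entry T (source L (Suc r)) (e c)) = measurement L T J"
proof -
  let ?k = "num_rows L" and ?Z = "Boundary ` J"
  let ?\<kappa> = "\<lambda>r. source L (Suc r)"
  have finJ: "finite J" using J finite_subset by blast
  have \<kappa>: "?\<kappa> r \<in> sources L" if "r < ?k" for r
    using that by (auto simp: sources_def)
  have \<kappa>_inj: "?\<kappa> r = ?\<kappa> s \<longleftrightarrow> r = s" if "r < ?k" "s < ?k" for r s
    using that source_eq_iff[of "Suc r" "Suc s"] by simp
  have eJ: "e c \<in> J" if "c < ?k" for c using e(2) that by auto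
  interpret S: terminal_digraph "stopped_graph J" vrank ?Z by (rule stopped_digraph)
  define \<phi> where "\<phi> v c = (\<Sum>p\<in>walks (stopped_graph J) {Boundary (e c)} v. walk_weight (edge_weight T) p)" for v c
  have \<phi>_step: "\<phi> u c = (\<Sum>v | (u, v) \<in> stopped_graph J. edge_weight T u v * \<phi> v c)"
    if "u \<notin> ?Z" "c < ?k" for u c
    unfolding \<phi>_def using that eJ by (intro S.walk_sum_step) auto
  have \<phi>_end: "\<phi> (Boundary j) c = (if j = e c then 1 else 0)" if "j \<in> J" for j c
  proof -
    have "{v. (Boundary j, v) \<in> stopped_graph J} = {}" using that by (auto simp: stopped_graph_def)
    then have "walks (stopped_graph J) {Boundary (e c)} (Boundary j) = (if j = e c then {[Boundary j]} else {})"
      using walks_step[of "stopped_graph J" "{Boundary (e c)}" "Boundary j"] by (simp only: UN_empty Un_empty_right) simp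
    then show ?thesis by (simp add: \<phi>_def)
  qed
  have fam: "walk_families (stopped_graph J) ?Z (sources L) Boundary = path_families L J"
    using path_families_walks[OF finJ J(2)] ..
  have lgv: "fdet ?k (\<lambda>r. \<phi> (Boundary (?\<kappa> r))) =
    (\<Sum>A\<in>path_families L J. (\<Prod>i\<in>sources L. walk_weight (edge_weight T) (A i)) *
       fdet ?k (\<lambda>r. \<phi> (last (A (?\<kappa> r)))))"
    using S.lgv[OF row_bij, of \<phi> "edge_weight T" Boundary] \<phi>_step fam by simp
  let ?sign = "(\<Prod>r<?k. flip (?\<kappa> r)) * (\<Prod>c<?k. flip (e c))"
  have sign: "fdet ?k (\<lambda>r. \<phi> (last (A (?\<kappa> r)))) = ?sign" if A: "A \<in> path_families L J" for A
  proof -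
    let ?t = "\<lambda>r. target A (?\<kappa> r)"
    have bij: "bij_betw ?t {..<?k} J"
      using bij_betw_trans[OF row_bij family_target(2)[OF A]] by (simp add: o_def)
    then have tJ: "?t r \<in> J" if "r < ?k" for r using that by (auto dest: bij_betwE)
    have "fdet ?k (\<lambda>r. \<phi> (last (A (?\<kappa> r)))) = fdet ?k (\<lambda>r c. if ?t r = e c then 1 else 0)"
      by (intro fdet_cong) (simp add: family_target(1)[OF A \<kappa>] \<phi>_end tJ)
    also have "\<dots> = (\<Prod>r<?k. \<Prod>s<r. if ?t r < ?t s then - 1 else 1)"
      by (rule fdet_permutation) (use bij e in \<open>auto simp: bij_betw_def\<close>)
    \<comment> \<open>The triangle of index pairs is completed to a square with factors
      \<open>1\<close>, so that inversions can be collected by their first member as in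
      \<open>family_inversions\<close>.\<close>
    also have "\<dots> = (\<Prod>r<?k. \<Prod>s<?k. if s < r \<and> ?t r < ?t s then - 1 else 1)"
    proof (rule prod.cong[OF refl])
      fix r assume "r \<in> {..<?k}"
      then have "{..<r} = {s \<in> {..<?k}. s < r}" by auto
      then have "(\<Prod>s<r. if ?t r < ?t s then - 1 else (1 :: real)) =
          (\<Prod>s<?k. if s < r then (if ?t r < ?t s then - 1 else 1) else 1)"
        by (simp only: prod.inter_filter[OF finite_lessThan])
      also have "\<dots> = (\<Prod>s<?k. if s < r \<and> ?t r < ?t s then - 1 else 1)" by (intro prod.cong) auto
      finally show "(\<Prod>s<r. if ?t r < ?t s then - 1 else (1 :: real)) =
          (\<Prod>s<?k. if s < r \<and> ?t r < ?t s then - 1 else 1)" .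
    qed
    also have "\<dots> = (\<Prod>s<?k. \<Prod>r<?k. if s < r \<and> ?t r < ?t s then - 1 else 1)" by (rule prod.swap)
    also have "\<dots> = (\<Prod>s<?k. flip (?\<kappa> s) * flip (?t s))"
      by (intro prod.cong refl family_inversions[OF A]) simp
    also have "\<dots> = (\<Prod>r<?k. flip (?\<kappa> r)) * (\<Prod>r<?k. flip (?t r))" by (rule prod.distrib)
    also have "(\<Prod>r<?k. flip (?t r)) = (\<Prod>j\<in>J. flip j)" by (rule prod.reindex_bij_betw[OF bij])
    also have "\<dots> = (\<Prod>c<?k. flip (e c))"
      using e strict_mono_on_imp_inj_on by (intro prod.reindex_bij_betw[symmetric]) (auto simp: bij_betw_def)
    finally show ?thesis .
  qed
  have sq: "?sign * ?sign = 1"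
  proof -
    have "?sign * ?sign = (\<Prod>r<?k. flip (?\<kappa> r) * flip (?\<kappa> r)) * (\<Prod>c<?k. flip (e c) * flip (e c))"
      by (simp only: prod.distrib mult_ac)
    then show ?thesis by (simp only: flip_square prod.neutral_const mult_1)
  qed
  let ?X = "\<lambda>r c. if e c \<in> sources L then (if e c = ?\<kappa> r then 1 else 0) else walk_sum T (?\<kappa> r) (e c)"
  \<comment> \<open>Stopping changes the rows of the sources in \<open>J\<close>. The columns of
    these sources are unit columns in both matrices, so the determinant does not see the
    change.\<close>
  have X: "fdet ?k ?X = fdet ?k (\<lambda>r. \<phi> (Boundary (?\<kappa> r)))"
  proof -
    have "\<forall>r. \<exists>c. r < ?k \<and> ?\<kappa> r \<in> J \<longrightarrow> c < ?k \<and> e c = ?\<kappa> r"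
      using e(2) by (metis imageE lessThan_iff)
    then obtain col where col: "\<And>r. r < ?k \<Longrightarrow> ?\<kappa> r \<in> J \<Longrightarrow> col r < ?k \<and> e (col r) = ?\<kappa> r" by metis
    have sub: "stopped_graph J \<subseteq> gamma_graph L" by (auto simp: stopped_graph_def)
    have to_source: "\<phi> (Boundary i) c = (if i = e c then 1 else 0)" if "e c \<in> sources L" for i c
      unfolding \<phi>_def walks_to_source[OF that sub] by simp
    show ?thesis
    proof (rule fdet_unit_columns[where R = "{r. r < ?k \<and> ?\<kappa> r \<in> J}" and \<kappa> = col])
      fix r c assume r: "r < ?k" "r \<notin> {r. r < ?k \<and> ?\<kappa> r \<in> J}" and c: "c < ?k"
      show "?X r c = \<phi> (Boundary (?\<kappa> r)) c"
      proof (cases "e c \<in> sources L")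
        case True
        then show ?thesis using to_source by simp
      next
        case False
        then show ?thesis
          using walks_stopped_eq[OF \<kappa>[OF r(1)], of J "e c"] r by (simp add: \<phi>_def walk_sum_def)
      qed
    qed (use col \<kappa> \<kappa>_inj to_source in auto)
  qed
  have "fdet ?k (\<lambda>r c. meas_entry T (?\<kappa> r) (e c)) = ?sign * fdet ?k ?X"
    unfolding meas_entry_def by (rule fdet_scale)
  also have "\<dots> = ?sign * (\<Sum>A\<in>path_families L J. (\<Prod>i\<in>sources L. path_weight L T (A i)) * ?sign)"
    unfolding X lgv by (intro arg_cong2[of _ _ _ _ "(*)"] refl sum.cong) (simp_all only: sign family_weight)
  also have "\<dots> = (?sign * ?sign) * (\<Sum>A\<in>path_families L J. (\<Prod>i\<in>sources L. path_weight L T (A i)))"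
    by (simp only: sum_distrib_right[symmetric]) (simp only: mult_ac)
  finally show ?thesis by (simp only: sq measurement_def mult_1)
qed

end

section \<open>Bases of a matrix and lexicographic maximality\<close>

definition minor :: "nat \<Rightarrow> (nat \<Rightarrow> nat \<Rightarrow> 'a) \<Rightarrow> nat set \<Rightarrow> 'a::comm_ring_1" where
  "minor k a J = fdet k (\<lambda>r c. a r (sorted_list_of_set J ! c))"

lemma enum_sorted:
  fixes J :: "nat set"
  assumes "finite J" "card J = k"
  shows "strict_mono_on {..<k} (nth (sorted_list_of_set J))" "nth (sorted_list_of_set J) ` {..<k} = J"
    "bij_betw (nth (sorted_list_of_set J)) {..<k} J"
proof -
  have len: "length (sorted_list_of_set J) = k" using assms by simp
  show mono: "strict_mono_on {..<k} (nth (sorted_list_of_set J))"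
    using len by (intro strict_mono_onI) (simp add: sorted_wrt_nth_less[OF strict_sorted_list_of_set])
  have "nth (sorted_list_of_set J) ` {..<k} = set (sorted_list_of_set J)"
    unfolding set_conv_nth len by auto
  then show img: "nth (sorted_list_of_set J) ` {..<k} = J" using assms by simp
  show "bij_betw (nth (sorted_list_of_set J)) {..<k} J"
    using img strict_mono_on_imp_inj_on[OF mono] by (simp add: bij_betw_def)
qed

text \<open>The factor \<open>s\<close> is the sign of the permutation relating the two
  enumerations.\<close>

lemma fdet_reenumerate:
  fixes f :: "nat \<Rightarrow> nat \<Rightarrow> 'a::comm_ring_1"
  assumes e: "bij_betw e {..<k} J" and e': "bij_betw e' {..<k} J"
  obtains s :: 'a where "s * s = 1" "fdet k (\<lambda>r c. f r (e' c)) = s * fdet k (\<lambda>r c. f r (e c))"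
proof -
  define p where "p c = (if c < k then the_inv_into {..<k} e (e' c) else c)" for c
  have "bij_betw (the_inv_into {..<k} e \<circ> e') {..<k} {..<k}"
    using bij_betw_trans[OF e' bij_betw_the_inv_into[OF e]] .
  then have "bij_betw p {..<k} {..<k}" by (rule bij_betw_cong[THEN iffD1, rotated]) (simp add: p_def)
  then have p: "p permutes {0..<k}"
    by (intro bij_imp_permutes) (auto simp: p_def atLeast0LessThan)
  have "e (p c) = e' c" if "c < k" for c
  proof -
    have "e' c \<in> e ` {..<k}" using e e' that by (auto simp: bij_betw_def)
    then show ?thesis using e that by (simp add: p_def f_the_inv_into_f bij_betw_def)
  qed
  then have "fdet k (\<lambda>r c. f r (e' c)) = fdet k (\<lambda>r c. f r (e (p c)))" by (intro fdet_cong) simp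
  also have "\<dots> = signof p * fdet k (\<lambda>r c. f r (e c))"
    by (rule fdet_permute_cols[OF p, of "\<lambda>r c. f r (e c)"])
  finally have "fdet k (\<lambda>r c. f r (e' c)) = signof p * fdet k (\<lambda>r c. f r (e c))" .
  moreover have "signof p * signof p = (1 :: 'a)" by (metis of_int_1 of_int_mult sign_idempotent)
  ultimately show thesis using that by blast
qed

lemma minor_enum_zero:
  fixes a :: "nat \<Rightarrow> nat \<Rightarrow> 'a::comm_ring_1"
  assumes "bij_betw e {..<k} J"
  shows "fdet k (\<lambda>r c. a r (e c)) = 0 \<longleftrightarrow> minor k a J = 0"
proof -
  have "finite J" "card J = k" using assms bij_betw_finite bij_betw_same_card by fastforce+
  from fdet_reenumerate[OF enum_sorted(3)[OF this] assms, of a]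
  obtain s where "s * s = 1" "fdet k (\<lambda>r c. a r (e c)) = s * minor k a J"
    unfolding minor_def by blast
  then show ?thesis by (metis mult.assoc mult_1 mult_zero_right)
qed

lemma fdet_inverse:
  fixes a :: "nat \<Rightarrow> nat \<Rightarrow> 'a::field"
  assumes "fdet k a \<noteq> 0"
  shows "\<exists>b. (\<forall>r<k. \<forall>c<k. (\<Sum>l<k. b r l * a l c) = (if r = c then 1 else 0)) \<and>
    (\<forall>r<k. \<forall>c<k. (\<Sum>l<k. a r l * b l c) = (if r = c then 1 else 0)) \<and> fdet k b * fdet k a = 1"
proof -
  let ?A = "mat k k (\<lambda>(i, j). a i j)"
  define b where "b r l = adj_mat ?A $$ (r, l) / det ?A" for r l
  have A: "?A \<in> carrier_mat k k" by simp
  have d: "det ?A \<noteq> 0" using assms by (simp add: fdet_def)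
  have 1: "(\<Sum>l<k. b r l * a l c) = (if r = c then 1 else 0)" if rc: "r < k" "c < k" for r c
  proof -
    have "(\<Sum>l<k. adj_mat ?A $$ (r, l) * a l c) = (adj_mat ?A * ?A) $$ (r, c)"
      using rc adj_mat(1)[OF A] by (auto simp: scalar_prod_def atLeast0LessThan)
    also have "\<dots> = (if r = c then det ?A else 0)"
      unfolding adj_mat(3)[OF A] using rc by simp
    finally show ?thesis using d by (simp add: b_def sum_divide_distrib[symmetric])
  qed
  have 2: "(\<Sum>l<k. a r l * b l c) = (if r = c then 1 else 0)" if rc: "r < k" "c < k" for r c
  proof -
    have "(\<Sum>l<k. a r l * adj_mat ?A $$ (l, c)) = (?A * adj_mat ?A) $$ (r, c)"
      using rc adj_mat(1)[OF A] by (auto simp: scalar_prod_def atLeast0LessThan)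
    also have "\<dots> = (if r = c then det ?A else 0)"
      unfolding adj_mat(2)[OF A] using rc by simp
    finally show ?thesis using d by (simp add: b_def sum_divide_distrib[symmetric])
  qed
  have "fdet k b * fdet k a = fdet k (\<lambda>i j. \<Sum>l<k. b i l * a l j)" by (rule fdet_mult[symmetric])
  also have "\<dots> = fdet k (\<lambda>i j. if i = j then 1 else 0)" using 1 by (intro fdet_cong) simp
  also have "\<dots> = det (1\<^sub>m k)" unfolding fdet_def by (rule arg_cong[of _ _ det]) (auto intro!: eq_matI)
  finally have "fdet k b * fdet k a = 1" by simp
  then show ?thesis using 1 2 by blast
qed

lemma fdet_unit_but_one:
  assumes i: "i < k" and unit: "\<And>r c. r < k \<Longrightarrow> c < k \<Longrightarrow> c \<noteq> i \<Longrightarrow> f r c = (if r = c then 1 else 0)"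
  shows "fdet k f = f i i"
proof -
  let ?g = "\<lambda>r c. if r = c then (if r = i then f i i else 1) else 0"
  have "fdet k f = fdet k ?g"
  proof (rule fdet_unit_columns[where R = "{..<k} - {i}" and \<kappa> = "\<lambda>c. c"])
    fix r c assume "r < k" "r \<notin> {..<k} - {i}" "c < k"
    then show "f r c = ?g r c" using unit[of r c] by auto
  qed (use unit i in auto)
  also have "\<dots> = det (mat k k (\<lambda>(r, c). ?g r c))" by (simp add: fdet_def)
  also have "\<dots> = prod_list (diag_mat (mat k k (\<lambda>(r, c). ?g r c)))"
    by (rule det_upper_triangular) auto
  also have "\<dots> = (\<Prod>r = 0..<k. if r = i then f i i else 1)"
    by (simp add: prod_list_diag_prod)
  also have "\<dots> = f i i" using i by simp
  finally show ?thesis .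
qed

lemma bij_betw_exchange:
  assumes e: "bij_betw e {..<k} J" and p: "p < k" "e p = y" and x: "x \<notin> J"
  shows "bij_betw (e(p := x)) {..<k} (insert x (J - {y}))"
proof -
  have "bij_betw e ({..<k} - {p}) (J - {y})"
    using e p by (auto simp: bij_betw_def inj_on_def)
  then have "bij_betw (e(p := x)) ({..<k} - {p}) (J - {y})"
    by (rule bij_betw_cong[THEN iffD1, rotated]) auto
  then have "bij_betw (e(p := x)) (({..<k} - {p}) \<union> {p}) ((J - {y}) \<union> {x})"
    using x by (intro bij_betw_combine) (auto simp: bij_betw_def)
  then show ?thesis using p(1) by (simp add: insert_absorb)
qed

text \<open>Normalise the columns of \<open>K\<close> to the identity. If every exchange fails, the
  entries with row in \<open>K - W\<close> and column in \<open>J \<inter> W\<close> all vanish;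
  this zero block is too large for the minor \<open>J\<close> to be nonzero.\<close>

lemma basis_exchange:
  fixes a :: "nat \<Rightarrow> nat \<Rightarrow> 'a::field"
  assumes K: "finite K" "card K = k" "minor k a K \<noteq> 0"
    and J: "finite J" "card J = k" "minor k a J \<noteq> 0"
    and less: "card (K \<inter> W) < card (J \<inter> W)"
  obtains x y where "x \<in> J \<inter> W - K" "y \<in> K - W" "minor k a (insert x (K - {y})) \<noteq> 0"
proof (rule ccontr)
  assume n: "\<not> thesis"
  note found = that
  have zero: "minor k a (insert x (K - {y})) = 0" if "x \<in> J \<inter> W - K" "y \<in> K - W" for x y
    using n found[OF that] by blast
  let ?e = "nth (sorted_list_of_set K)" and ?f = "nth (sorted_list_of_set J)"
  note eK = enum_sorted[OF K(1,2)] and fJ = enum_sorted[OF J(1,2)]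
  have K': "fdet k (\<lambda>r c. a r (?e c)) \<noteq> 0" using K(3) by (simp add: minor_def)
  obtain b where b: "\<forall>r<k. \<forall>c<k. (\<Sum>l<k. b r l * a l (?e c)) = (if r = c then 1 else 0)"
    and bdet: "fdet k b * fdet k (\<lambda>r c. a r (?e c)) = 1"
    using fdet_inverse[OF K'] by (elim exE conjE) (rule that)
  define a' where "a' r j = (\<Sum>l<k. b r l * a l j)" for r j
  have mult: "fdet k (\<lambda>r c. a' r (h c)) = fdet k b * fdet k (\<lambda>r c. a r (h c))" for h
    unfolding a'_def by (rule fdet_mult)
  have a'_zero: "a' r x = 0" if r: "r < k" "?e r \<notin> W" and x: "x \<in> J \<inter> W" for r x
  proof (cases "x \<in> K")
    case True
    then obtain c where "c < k" "x = ?e c" using eK(2) by auto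
    then show ?thesis using b r x unfolding a'_def by auto
  next
    case False
    \<comment> \<open>After normalisation all other columns of this exchange minor are unit columns,
      so it equals the entry \<open>a' r x\<close>.\<close>
    let ?h = "?e(r := x)"
    have eK': "?e r \<in> K" using eK(2) r(1) by auto
    have "bij_betw ?h {..<k} (insert x (K - {?e r}))"
      by (rule bij_betw_exchange[OF eK(3) r(1) refl False])
    then have "fdet k (\<lambda>i c. a i (?h c)) = 0"
      using zero[of x "?e r"] False r x eK' minor_enum_zero by blast
    then have "fdet k (\<lambda>i c. a' i (?h c)) = 0" using mult by simp
    moreover have "fdet k (\<lambda>i c. a' i (?h c)) = a' r (?h r)"
      by (rule fdet_unit_but_one) (use r b in \<open>auto simp: a'_def\<close>)
    ultimately show ?thesis by simp
  qed
  have "fdet k (\<lambda>i c. a' i (?f c)) = 0"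
  proof (rule fdet_zero_block[where R = "{r \<in> {..<k}. ?e r \<in> K - W}" and C = "{c \<in> {..<k}. ?f c \<in> J \<inter> W}"])
    have card_eq: "card {c \<in> {..<k}. h c \<in> S} = card S" if "bij_betw h {..<k} T" "S \<subseteq> T" for h S and T :: "nat set"
    proof (rule bij_betw_same_card)
      show "bij_betw h {c \<in> {..<k}. h c \<in> S} S"
        using that by (auto simp: bij_betw_def inj_on_def)
    qed
    have "card {r \<in> {..<k}. ?e r \<in> K - W} = card (K - W)" by (rule card_eq[OF eK(3)]) auto
    moreover have "card {c \<in> {..<k}. ?f c \<in> J \<inter> W} = card (J \<inter> W)" by (rule card_eq[OF fJ(3)]) auto
    moreover have "card (K - W) + card (K \<inter> W) = k"
      using K(1,2) by (metis Int_Diff_Un Int_Diff_disjoint card_Un_disjoint finite_Diff finite_Int add.commute)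
    ultimately show "k < card {r \<in> {..<k}. ?e r \<in> K - W} + card {c \<in> {..<k}. ?f c \<in> J \<inter> W}"
      using less by linarith
  qed (use a'_zero in auto)
  then have "fdet k b * fdet k (\<lambda>i c. a i (?f c)) = 0" using mult by simp
  moreover have "fdet k b \<noteq> 0" using bdet by auto
  ultimately show False using J(3) by (simp add: minor_def)
qed

section \<open>Lexicographic comparison of sets\<close>

lemma sorted_list_split:
  fixes K :: "nat set"
  assumes "finite K" "y \<in> K"
  shows "sorted_list_of_set K =
    sorted_list_of_set {z \<in> K. z < y} @ y # sorted_list_of_set {z \<in> K. y < z}"
proof (rule sorted_distinct_set_unique)
  show "sorted (sorted_list_of_set {z \<in> K. z < y} @ y # sorted_list_of_set {z \<in> K. y < z})"
    using assms by (auto simp: sorted_append)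
  show "distinct (sorted_list_of_set {z \<in> K. z < y} @ y # sorted_list_of_set {z \<in> K. y < z})"
    using assms by auto
qed (use assms in auto)

lemma exchange_greater:
  fixes K :: "nat set"
  assumes K: "finite K" "y \<in> K" and x: "x \<notin> K" "y < x"
  shows "sorted_list_of_set K < sorted_list_of_set (insert x (K - {y}))"
proof -
  let ?K' = "insert x (K - {y})"
  \<comment> \<open>\<open>z\<close> is the entry that follows the common prefix in the new list,
    where the old list has \<open>y\<close>; it need not be \<open>x\<close>.\<close>
  define z where "z = Min {z \<in> ?K'. y \<le> z}"
  have ne: "finite {z \<in> ?K'. y \<le> z}" "x \<in> {z \<in> ?K'. y \<le> z}" using K x by auto
  have "z \<in> {z \<in> ?K'. y \<le> z}" unfolding z_def using ne by (intro Min_in) auto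
  moreover have "z \<le> w" if "w \<in> ?K'" "y \<le> w" for w
    using that ne(1) by (auto simp: z_def)
  ultimately have z: "z \<in> ?K'" "y < z" and below: "{w \<in> ?K'. w < z} = {w \<in> K. w < y}"
    using x by (auto simp: not_le[symmetric]) 
  have "sorted_list_of_set ?K' = sorted_list_of_set {w \<in> K. w < y} @ z # sorted_list_of_set {w \<in> ?K'. z < w}"
    using sorted_list_split[of ?K' z] K z(1) unfolding below by simp
  then show ?thesis
    using sorted_list_split[OF K] z(2) by (simp add: list_less_def lexord_append_leftI)
qed

lemma lexmax_in:
  assumes "finite S" "S \<noteq> {}" "\<And>J. J \<in> S \<Longrightarrow> finite J"
  shows "lexmax S \<in> S" "J \<in> S \<Longrightarrow> sorted_list_of_set J \<le> sorted_list_of_set (lexmax S)"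
proof -
  let ?m = "Max (sorted_list_of_set ` S)"
  have "?m \<in> sorted_list_of_set ` S" using assms by (intro Max_in) auto
  then obtain K where K: "K \<in> S" "?m = sorted_list_of_set K" by (elim imageE)
  then have eq: "lexmax S = K" using assms(3) by (simp add: lexmax_def)
  then show "lexmax S \<in> S" using K by simp
  show "J \<in> S \<Longrightarrow> sorted_list_of_set J \<le> sorted_list_of_set (lexmax S)"
    using K(2) eq assms(1) by (metis Max_ge finite_imageI imageI)
qed

section \<open>The positroid as the bases of a matrix, and maximality of \<open>M'\<close>\<close>

context le_filling begin

lemma finite_path_families:
  assumes "finite J" "card J = num_rows L"
  shows "finite (path_families L J)"
proof -
  interpret S: terminal_digraph "stopped_graph J" vrank "Boundary ` J" by (rule stopped_digraph)
  show ?thesis unfolding path_families_walks[OF assms] by (rule S.finite_walk_families[OF finite_sources])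
qed

lemma positroid_subset:
  assumes "J \<in> positroid L"
  shows "J \<subseteq> {1..num_steps L}" "finite J" "card J = num_rows L"
proof -
  obtain A where A: "A \<in> path_families L J" using assms by (auto simp: positroid_def)
  have "J = target A ` sources L" using family_target(2)[OF A] by (simp add: bij_betw_def)
  show "card J = num_rows L" using bij_betw_same_card[OF family_target(2)[OF A]] card_sources by simp
  show sub: "J \<subseteq> {1..num_steps L}"
  proof
    fix j assume "j \<in> J"
    then obtain i where i: "i \<in> sources L" "j = target A i" using \<open>J = target A ` sources L\<close> by auto
    then obtain a where a: "a \<in> {1..num_rows L}" "i = source L a" by (auto simp: sources_def)
    from A a(1) have "j \<in> sources L \<union> sink L ` {1..num_cols L}"
    proof (cases rule: family_cases)
      case trivial
      then show ?thesis using family_target(1)[OF A i(1)] i a by simp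
    next
      case (run b xs)
      then have "j = sink L b" using family_target(1)[OF A i(1)] i a by (simp add: last_path_of)
      then show ?thesis using run(2) by blast
    qed
    then show "j \<in> {1..num_steps L}" using sources_sinks by blast
  qed
  show "finite J" by (rule finite_subset[OF sub]) simp
qed

lemma measurement_eq_minor:
  assumes "J \<subseteq> {1..num_steps L}" "card J = num_rows L"
  shows "measurement L T J = minor (num_rows L) (\<lambda>r. meas_entry T (source L (Suc r))) J"
proof -
  have "finite J" using assms finite_subset by blast
  then show ?thesis
    unfolding minor_def using measurement_minor[OF assms enum_sorted(1,2)] assms by simp
qed

lemma path_weight_pos:
  assumes "\<And>B. B \<in> pluses L \<Longrightarrow> 0 < T B"
  shows "0 < path_weight L T p"
  unfolding path_weight_eq using assms by (intro prod_pos) auto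

lemma measurement_pos:
  assumes "\<And>B. B \<in> pluses L \<Longrightarrow> 0 < T B" "J \<in> positroid L"
  shows "0 < measurement L T J"
  unfolding measurement_def
  using assms positroid_subset[OF assms(2)]
  by (intro sum_pos finite_path_families prod_pos) (auto simp: positroid_def path_weight_pos)

lemma measurement_zero: "J \<notin> positroid L \<Longrightarrow> measurement L T J = 0"
  by (simp add: positroid_def measurement_def)

text \<open>With all tableau entries \<open>1\<close> the measurement is a sum of positive terms, so
  nothing cancels and membership becomes nonvanishing of a minor. This gives access to the exchange
  property.\<close>

lemma positroid_iff_minor:
  assumes "J \<subseteq> {1..num_steps L}" "card J = num_rows L"
  shows "J \<in> positroid L \<longleftrightarrow> minor (num_rows L) (\<lambda>r. meas_entry (\<lambda>_. 1) (source L (Suc r))) J \<noteq> 0"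
  using measurement_pos[of "\<lambda>_. 1" J] measurement_zero[of J "\<lambda>_. 1"]
  unfolding measurement_eq_minor[OF assms, symmetric] by auto

lemma sources_positroid: "sources L \<in> positroid L"
proof -
  have "(\<lambda>i\<in>sources L. [Boundary i]) \<in> path_families L (sources L)"
    by (auto simp: path_families_def gamma_path_def disjoint_family_on_def)
  then show ?thesis by (auto simp: positroid_def)
qed

text \<open>The counting form of lexicographic maximality. A competitor with more elements in the
  tail set would allow an exchange into that set, which replaces an element below \<open>m\<close>
  by one at least \<open>m\<close> and so raises the sorted sequence.\<close>

lemma M'_max:
  shows "M' L B \<in> positroid L" "M' L B \<inter> fixed_labels L B = sources L \<inter> fixed_labels L B"
    and "J \<in> positroid L \<Longrightarrow> J \<inter> fixed_labels L B = sources L \<inter> fixed_labels L B \<Longrightarrow>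
      card (J \<inter> (fixed_labels L B \<union> {m..})) \<le> card (M' L B \<inter> (fixed_labels L B \<union> {m..}))"
proof -
  let ?F = "fixed_labels L B"
  let ?S = "{J \<in> positroid L. J \<inter> ?F = sources L \<inter> ?F}"
  have fin: "finite ?S"
    by (rule finite_subset[of _ "Pow {1..num_steps L}"]) (use positroid_subset in auto)
  have ne: "?S \<noteq> {}" using sources_positroid by auto
  have K: "M' L B \<in> ?S" unfolding M'_def by (rule lexmax_in[OF fin ne]) (use positroid_subset in auto)
  then show K': "M' L B \<in> positroid L" "M' L B \<inter> ?F = sources L \<inter> ?F" by auto
  assume J: "J \<in> positroid L" "J \<inter> ?F = sources L \<inter> ?F"
  let ?W = "?F \<union> {m..}"
  show "card (J \<inter> ?W) \<le> card (M' L B \<inter> ?W)"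
  proof (rule ccontr)
    assume "\<not> card (J \<inter> ?W) \<le> card (M' L B \<inter> ?W)"
    then have less: "card (M' L B \<inter> ?W) < card (J \<inter> ?W)" by simp
    note Kp = positroid_subset[OF K'(1)] and Jp = positroid_subset[OF J(1)]
    obtain x y where xy: "x \<in> J \<inter> ?W - M' L B" "y \<in> M' L B - ?W"
      "minor (num_rows L) (\<lambda>r. meas_entry (\<lambda>_. 1) (source L (Suc r))) (insert x (M' L B - {y})) \<noteq> 0"
      using basis_exchange[OF Kp(2,3) _ Jp(2,3) _ less] positroid_iff_minor K'(1) J(1) Kp Jp by metis
    \<comment> \<open>Both sets agree with the sources on the fixed labels, so the element gained
      must come from \<open>{m..}\<close>.\<close>
    have xF: "x \<notin> ?F" using xy(1) J(2) K'(2) by blast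
    then have less: "y < x" using xy by auto
    have card: "card (insert x (M' L B - {y})) = num_rows L"
      using xy Kp by (metis DiffD1 DiffD2 DiffE card_Diff_singleton card_Suc_Diff1 card_insert_disjoint finite_Diff)
    have sub: "insert x (M' L B - {y}) \<subseteq> {1..num_steps L}" using xy Jp Kp by auto
    have "insert x (M' L B - {y}) \<in> positroid L" using positroid_iff_minor[OF sub card] xy(3) by simp
    moreover have "insert x (M' L B - {y}) \<inter> ?F = sources L \<inter> ?F" using xF xy K'(2) by blast
    ultimately have "sorted_list_of_set (insert x (M' L B - {y})) \<le> sorted_list_of_set (M' L B)"
      unfolding M'_def by (intro lexmax_in(2)[OF fin ne]) (use positroid_subset in auto)
    moreover have "sorted_list_of_set (M' L B) < sorted_list_of_set (insert x (M' L B - {y}))"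
      using exchange_greater[OF Kp(2)] xy less by auto
    ultimately show False by simp
  qed
qed

end

section \<open>The path families of \<open>M(B)\<close> and \<open>M'(B)\<close>\<close>

context le_filling begin

lemma hooks_disjoint:
  assumes "(r, c) \<in> pluses L" "(s, d) \<in> pluses L" "r < s" "d < c"
  shows "set (path_of r c (hook_boxes (r, c))) \<inter> set (path_of s d (hook_boxes (s, d))) = {}"
proof -
  have "set (hook_boxes (r, c)) \<inter> set (hook_boxes (s, d)) = {}"
    unfolding hook_boxes_set[OF assms(1)] hook_boxes_set[OF assms(2)] using assms(3,4) by auto
  moreover have "source L r \<noteq> source L s" "sink L c \<noteq> sink L d" "source L r \<noteq> sink L d" "source L s \<noteq> sink L c"
    using source_eq_iff sink_eq_iff source_neq_sink plus_row plus_col assms by (metis less_irrefl)+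
  ultimately show ?thesis by (auto simp: path_of_def simp del: hook_boxes.simps)
qed

text \<open>The hooks of a chain are nested and disjoint; with trivial paths at the other sources
  they form a family.\<close>

lemma chain_positroid:
  assumes C: "C \<subseteq> pluses L" "chain C"
  shows "(sources L - source L ` fst ` C) \<union> sink L ` snd ` C \<in> positroid L"
proof -
  let ?J = "(sources L - source L ` fst ` C) \<union> sink L ` snd ` C"
  let ?g = "\<lambda>x. source L (fst x)"
  define A where "A = (\<lambda>i\<in>sources L. if i \<in> ?g ` C then hook L (the_inv_into C ?g i) else [Boundary i])"
  have src: "source L r \<in> sources L" if "r \<in> {1..num_rows L}" for r using that by (auto simp: sources_def)
  have rowC: "fst x \<in> {1..num_rows L}" if "x \<in> C" for x
    using that C(1) plus_row by (cases x) auto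
  have g_eq: "?g x = source L r \<longleftrightarrow> fst x = r" if "x \<in> C" "r \<in> {1..num_rows L}" for x r
    using source_eq_iff rowC[OF that(1)] that(2) by blast
  have "inj_on ?g C"
  proof (rule inj_onI)
    fix x y assume xy: "x \<in> C" "y \<in> C" "source L (fst x) = source L (fst y)"
    then have "fst x = fst y" using g_eq rowC by blast
    then show "x = y" using C(2) xy unfolding chain_def by fastforce
  qed
  then have inv: "the_inv_into C ?g (source L r) = (r, c)" if "(r, c) \<in> C" for r c
    using the_inv_into_f_f[of ?g C "(r, c)"] that by simp
  have A_hook: "A (source L r) = path_of r c (hook_boxes (r, c))" if rc: "(r, c) \<in> C" for r c
  proof -
    have "source L r \<in> sources L" using src rowC[OF rc] by simp
    moreover have "source L r \<in> ?g ` C" using rc by force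
    ultimately have "A (source L r) = hook L (the_inv_into C ?g (source L r))"
      by (simp only: A_def restrict_apply if_True)
    then show ?thesis by (simp only: inv[OF rc] hook_path_of)
  qed
  have A_trivial: "A (source L r) = [Boundary (source L r)]" if r: "r \<in> {1..num_rows L}" "r \<notin> fst ` C" for r
  proof -
    have "source L r \<notin> ?g ` C"
    proof
      assume "source L r \<in> ?g ` C"
      then obtain x where x: "x \<in> C" "source L r = ?g x" by (elim imageE)
      then have "fst x = r" using g_eq[OF x(1) r(1)] by simp
      then show False using x(1) r(2) by blast
    qed
    then show ?thesis using src[OF r(1)] by (simp add: A_def)
  qed
  have cases: "(r \<notin> fst ` C \<and> A (source L r) = [Boundary (source L r)]) \<or>
      (\<exists>c. (r, c) \<in> C \<and> (r, c) \<in> pluses L \<and> A (source L r) = path_of r c (hook_boxes (r, c)))"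
    if "r \<in> {1..num_rows L}" for r
  proof (cases "r \<in> fst ` C")
    case True
    then obtain c where "(r, c) \<in> C" by auto
    then show ?thesis using A_hook C(1) by blast
  next
    case False
    then show ?thesis using A_trivial[OF that] by blast
  qed
  have path: "gamma_path L (A i) \<and> hd (A i) = Boundary i" if "i \<in> sources L" for i
  proof -
    obtain r where r: "r \<in> {1..num_rows L}" "i = source L r" using \<open>i \<in> sources L\<close> by (auto simp: sources_def)
    from cases[OF r(1)] show ?thesis
    proof (elim disjE exE conjE)
      assume "A (source L r) = [Boundary (source L r)]"
      then show ?thesis using r by (simp add: gamma_path_def)
    next
      fix c assume "(r, c) \<in> pluses L" "A (source L r) = path_of r c (hook_boxes (r, c))"
      then show ?thesis using r full_run_gamma_path[OF hook_full_run] by (simp add: path_of_def del: hook_boxes.simps)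
    qed
  qed
  have dis: "set (A (source L r)) \<inter> set (A (source L s)) = {}"
    if rs: "r \<in> {1..num_rows L}" "s \<in> {1..num_rows L}" "r \<noteq> s" for r s
  proof -
    have ne: "source L r \<noteq> source L s" using rs source_eq_iff by blast
    have hk: "Boundary (source L a) \<notin> set (path_of b c (hook_boxes (b, c)))"
      if "a \<in> {1..num_rows L}" "source L a \<noteq> source L b" "(b, c) \<in> pluses L" for a b c
      using that source_neq_sink plus_col by (auto simp: path_of_def simp del: hook_boxes.simps)
    have two: "set (path_of r c (hook_boxes (r, c))) \<inter> set (path_of s d (hook_boxes (s, d))) = {}"
      if "(r, c) \<in> C" "(s, d) \<in> C" for c d
    proof -
      have "(r < s \<and> d < c) \<or> (s < r \<and> c < d)" using C(2) that rs(3) unfolding chain_def by fastforce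
      then show ?thesis using hooks_disjoint[of r c s d] hooks_disjoint[of s d r c] that C(1) by blast
    qed
    from cases[OF rs(1)] cases[OF rs(2)] show ?thesis
      by (elim disjE exE conjE) (simp_all only:, use ne hk rs two in \<open>auto simp del: hook_boxes.simps\<close>)
  qed
  have "disjoint_family_on (\<lambda>i. set (A i)) (sources L)"
    unfolding disjoint_family_on_def
  proof (intro ballI impI)
    fix i j assume ij: "i \<in> sources L" "j \<in> sources L" "i \<noteq> j"
    then obtain r s where "r \<in> {1..num_rows L}" "i = source L r" "s \<in> {1..num_rows L}" "j = source L s"
      by (auto simp: sources_def)
    then show "set (A i) \<inter> set (A j) = {}" using dis[of r s] ij(3) by blast
  qed
  moreover have "(\<lambda>i. last (A i)) ` sources L = Boundary ` ?J"
  proof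
    show "(\<lambda>i. last (A i)) ` sources L \<subseteq> Boundary ` ?J"
    proof
      fix v assume "v \<in> (\<lambda>i. last (A i)) ` sources L"
      then obtain r where r: "r \<in> {1..num_rows L}" "v = last (A (source L r))" by (auto simp: sources_def)
      from cases[OF r(1)] show "v \<in> Boundary ` ?J"
      proof (elim disjE exE conjE)
        assume a: "r \<notin> fst ` C" "A (source L r) = [Boundary (source L r)]"
        have "source L r \<notin> source L ` fst ` C"
        proof
          assume "source L r \<in> source L ` fst ` C"
          then obtain r' c where "(r', c) \<in> C" "source L r = source L r'" by auto
          then show False using a(1) source_eq_iff[OF r(1)] plus_row C(1) by (metis fst_conv imageI subsetD)
        qed
        then show ?thesis using r a src by simp
      next
        fix c assume "(r, c) \<in> C" "A (source L r) = path_of r c (hook_boxes (r, c))"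
        then show ?thesis using r by (force simp: last_path_of simp del: hook_boxes.simps)
      qed
    qed
    show "Boundary ` ?J \<subseteq> (\<lambda>i. last (A i)) ` sources L"
    proof
      fix v assume "v \<in> Boundary ` ?J"
      then consider r where "r \<in> {1..num_rows L}" "source L r \<notin> source L ` fst ` C" "v = Boundary (source L r)"
        | r c where "(r, c) \<in> C" "v = Boundary (sink L c)"
        by (auto simp: sources_def)
      then show "v \<in> (\<lambda>i. last (A i)) ` sources L"
      proof cases
        case (1 r)
        then have "A (source L r) = [Boundary (source L r)]" using A_trivial by blast
        then show ?thesis using 1 src by (intro image_eqI[of _ _ "source L r"]) auto
      next
        case (2 r c)
        then have "r \<in> {1..num_rows L}" using C(1) plus_row by blast
        then show ?thesis using 2 A_hook[OF 2(1)] src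
          by (intro image_eqI[of _ _ "source L r"]) (auto simp: last_path_of simp del: hook_boxes.simps)
      qed
    qed
  qed
  moreover have "A \<in> extensional (sources L)" by (simp add: A_def)
  ultimately have "A \<in> path_families L ?J" using path by (auto simp: path_families_def)
  then show ?thesis by (auto simp: positroid_def)
qed

lemma chain_inj:
  assumes "chain C"
  shows "inj_on fst C" "inj_on snd C"
proof -
  have *: "x = y \<or> (fst x < fst y \<and> snd y < snd x) \<or> (fst y < fst x \<and> snd x < snd y)"
    if "x \<in> C" "y \<in> C" for x y
    using assms that unfolding chain_def by blast
  show "inj_on fst C" "inj_on snd C" by (rule inj_onI, use * in fastforce)+
qed

section \<open>Labels moved by \<open>M'(B)\<close> and the paths to \<open>M(B)\<close>\<close>

context
  fixes r c :: nat
  assumes B: "(r, c) \<in> boxes L"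
begin

lemma B_row: "r \<in> {1..num_rows L}" and B_col: "c \<in> {1..num_cols L}"
  using B by (simp_all add: box_iff)

lemma fixed_iff: "j \<in> fixed_labels L (r, c) \<longleftrightarrow> j \<in> {1..num_steps L} \<and> \<not> (source L r < j \<and> j < sink L c)"
  by auto

lemma source_label: "a \<in> {1..num_rows L} \<Longrightarrow> source L a \<in> {1..num_steps L}"
  and sink_label: "b \<in> {1..num_cols L} \<Longrightarrow> sink L b \<in> {1..num_steps L}"
  using sources_sinks by (auto simp: sources_def simp del: atLeastAtMost_iff)

lemma source_in_sources: "a \<in> {1..num_rows L} \<Longrightarrow> source L a \<in> sources L"
  by (auto simp: sources_def)

lemma M'_source: "source L r \<in> M' L (r, c)"
  using M'_max(2)[of "(r, c)"] source_label[OF B_row] source_in_sources[OF B_row] fixed_iff by blast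

lemma M'_sink: "sink L c \<notin> M' L (r, c)"
  using M'_max(2)[of "(r, c)"] sink_label[OF B_col] sink_not_source[OF B_col] fixed_iff by blast

lemma M_eq: "M L (r, c) = insert (sink L c) (M' L (r, c) - {source L r})"
  by auto

lemma M_card: "M L (r, c) \<subseteq> {1..num_steps L}" "card (M L (r, c)) = num_rows L" "finite (M L (r, c))"
proof -
  note K = positroid_subset[OF M'_max(1)[of "(r, c)"]]
  show "M L (r, c) \<subseteq> {1..num_steps L}" using K(1) sink_label[OF B_col] unfolding M_eq by blast
  show "card (M L (r, c)) = num_rows L"
    using K(2,3) M'_source M'_sink unfolding M_eq
    by (metis DiffE card_Suc_Diff1 card_insert_disjoint finite_Diff)
  show "finite (M L (r, c))" using K(2) unfolding M_eq by simp
qed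

lemma moved_source:
  assumes "a \<in> {1..num_rows L}" "source L a \<notin> M' L (r, c)"
  shows "source L r < source L a" "source L a < sink L c" "r < a"
proof -
  have "source L a \<notin> fixed_labels L (r, c)"
    using M'_max(2)[of "(r, c)"] assms source_in_sources by blast
  then show "source L r < source L a" "source L a < sink L c"
    using source_label[OF assms(1)] fixed_iff by blast+
  then show "r < a" using source_less_iff[OF B_row assms(1)] by simp
qed

lemma moved_sink:
  assumes "b \<in> {1..num_cols L}" "sink L b \<in> M' L (r, c)"
  shows "source L r < sink L b" "sink L b < sink L c" "b < c"
proof -
  have "sink L b \<notin> fixed_labels L (r, c)"
    using M'_max(2)[of "(r, c)"] assms sink_not_source by blast
  then show "source L r < sink L b" "sink L b < sink L c"
    using sink_label[OF assms(1)] fixed_iff by blast+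
  then show "b < c" using sink_less_iff[OF assms(1) B_col] by simp
qed

text \<open>
  A chain in the strict southeast quadrant of \<open>B\<close> gives nested hooks, so by maximality of \<open>M'(B)\<close>
  it is at most as long as the number of paths to \<open>M'(B)\<close> that pass over the label \<open>m\<close>.
\<close>

lemma chain_le_M':
  assumes m: "source L r < m" "m \<le> sink L c" and C: "C \<subseteq> pluses L" "chain C"
    and Cm: "\<forall>(s, d)\<in>C. r < s \<and> d < c \<and> source L s < m \<and> m \<le> sink L d"
  shows "card (M' L (r, c) \<inter> {source L r<..<m}) + card C \<le> card (sources L \<inter> {source L r<..<m})"
proof -
  let ?F = "fixed_labels L (r, c)" and ?K = "M' L (r, c)" and ?O = "{source L r<..<m}"
  let ?W = "?F \<union> {m..}"
  let ?J = "(sources L - source L ` fst ` C) \<union> sink L ` snd ` C"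
  have finC: "finite C" using C(1) finite_pluses[OF le] finite_subset by blast
  have rows: "s \<in> {1..num_rows L}" "d \<in> {1..num_cols L}" if "(s, d) \<in> C" for s d
    using that C(1) plus_row plus_col by blast+
  \<comment> \<open>The labels outside \<open>?W\<close> are exactly those of \<open>?O\<close>, so
    more elements in \<open>?W\<close> means fewer strictly between the source of \<open>r\<close>
    and \<open>m\<close>.\<close>
  have split: "card (X \<inter> ?W) + card (X \<inter> ?O) = num_rows L" if "X \<subseteq> {1..num_steps L}" "card X = num_rows L" for X
  proof -
    have "finite X" using that finite_subset by blast
    have "X = (X \<inter> ?W) \<union> (X \<inter> ?O)"
    proof (intro equalityI subsetI)
      fix j assume "j \<in> X"
      then show "j \<in> (X \<inter> ?W) \<union> (X \<inter> ?O)" using that(1) m fixed_iff[of j] by (cases "m \<le> j") auto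
    qed blast
    moreover have "(X \<inter> ?W) \<inter> (X \<inter> ?O) = {}"
    proof (rule equals0I)
      fix j assume "j \<in> (X \<inter> ?W) \<inter> (X \<inter> ?O)"
      then show False using m fixed_iff[of j] by auto
    qed
    ultimately have "card X = card (X \<inter> ?W) + card (X \<inter> ?O)"
      using \<open>finite X\<close> card_Un_disjoint[of "X \<inter> ?W" "X \<inter> ?O"] by (metis finite_Int)
    then show ?thesis using that by simp
  qed
  have s_out: "source L s \<notin> ?W" if "(s, d) \<in> C" for s d
  proof -
    have "r < s" "source L s < m" using that Cm by auto
    then show ?thesis using m source_less_iff[OF B_row rows(1)[OF that]] fixed_iff[of "source L s"] by simp
  qed
  have d_in: "m \<le> sink L d" "sink L d \<notin> ?F" if "(s, d) \<in> C" for s d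
  proof -
    have "d < c" "m \<le> sink L d" using that Cm by auto
    then show "m \<le> sink L d" "sink L d \<notin> ?F"
      using m sink_less_iff[OF rows(2)[OF that] B_col] fixed_iff[of "sink L d"] by simp_all
  qed
  have out: "source L ` fst ` C \<inter> ?W = {}"
  proof (rule equals0I)
    fix i assume i: "i \<in> source L ` fst ` C \<inter> ?W"
    then obtain s d where "(s, d) \<in> C" "i = source L s" by auto
    then show False using s_out i by blast
  qed
  have into: "sink L d \<notin> ?F \<and> sink L d \<in> ?W \<and> sink L d \<notin> sources L" if "d \<in> snd ` C" for d
  proof -
    obtain s where "(s, d) \<in> C" using \<open>d \<in> snd ` C\<close> by auto
    then show ?thesis using d_in sink_not_source rows(2) by blast
  qed
  have "?J \<inter> ?F = sources L \<inter> ?F" using out into by blast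
  then have le: "card (?J \<inter> ?W) \<le> card (?K \<inter> ?W)"
    by (rule M'_max(3)[OF chain_positroid[OF C]])
  have "?J \<inter> ?W = (sources L \<inter> ?W) \<union> sink L ` snd ` C" using out into by blast
  moreover have "(sources L \<inter> ?W) \<inter> sink L ` snd ` C = {}" using into by blast
  moreover have "card (sink L ` snd ` C) = card C"
  proof -
    have "inj_on (sink L) (snd ` C)" using rows(2) by (intro inj_on_subset[OF sink_inj]) auto
    then show ?thesis using chain_inj(2)[OF C(2)] by (simp add: card_image)
  qed
  ultimately have "card (?J \<inter> ?W) = card (sources L \<inter> ?W) + card C"
    using finC finite_sources by (simp add: card_Un_disjoint)
  then show ?thesis
    using le split[of ?K] split[of "sources L"] positroid_subset[OF M'_max(1)[of "(r, c)"]] sources_sinks card_sources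
    by fastforce
qed

text \<open>Here \<open>Q\<close> consists of the rows whose sources are left, \<open>S a\<close> is
  the final column and \<open>X a\<close> the run of row \<open>a\<close>. If no run passes over
  \<open>(r, c)\<close>, the paths crossing some \<open>m\<close> number at most the size of a
  chain, whereas counting departures and arrivals before \<open>m\<close> gives at least one
  more.\<close>

lemma M_family_hook:
  assumes A: "A \<in> path_families L (M L (r, c))"
  shows "A (source L r) = path_of r c (hook_boxes (r, c))" "(r, c) \<in> pluses L"
proof -
  let ?J = "M L (r, c)" and ?K = "M' L (r, c)"
  define Q where "Q = {a \<in> {1..num_rows L}. source L a \<notin> ?J}"
  have "\<forall>a. \<exists>b xs. a \<in> Q \<longrightarrow> b \<in> {1..num_cols L} \<and> sink L b \<in> ?J \<and> full_run a b xs \<and> A (source L a) = path_of a b xs"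
  proof
    fix a
    show "\<exists>b xs. a \<in> Q \<longrightarrow> b \<in> {1..num_cols L} \<and> sink L b \<in> ?J \<and> full_run a b xs \<and> A (source L a) = path_of a b xs"
    proof (cases "a \<in> Q")
      case True
      then have "a \<in> {1..num_rows L}" by (simp add: Q_def)
      with A show ?thesis by (cases rule: family_cases) (use True in \<open>auto simp: Q_def\<close>)
    qed simp
  qed
  then obtain S X where SX: "\<And>a. a \<in> Q \<Longrightarrow> S a \<in> {1..num_cols L} \<and> sink L (S a) \<in> ?J \<and> full_run a (S a) (X a) \<and>
      A (source L a) = path_of a (S a) (X a)" by metis
  have Q_rows: "a \<in> {1..num_rows L}" if "a \<in> Q" for a using that by (simp add: Q_def)
  have rQ: "r \<in> Q" using B_row source_neq_sink[OF B_row B_col] by (auto simp: Q_def M_eq)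
  have Q_cases: "a = r \<or> (r < a \<and> source L a \<notin> ?K)" if "a \<in> Q" for a
  proof (cases "a = r")
    case False
    then have "source L a \<notin> ?K" using that source_eq_iff[OF _ B_row] by (auto simp: Q_def M_eq)
    then show ?thesis using moved_source(3) that by (simp add: Q_def)
  qed simp
  have S_cases: "S a = c \<or> (S a < c \<and> sink L (S a) \<in> ?K)" if "a \<in> Q" for a
  proof (cases "S a = c")
    case False
    then have "sink L (S a) \<in> ?K" using SX[OF that] sink_eq_iff[OF _ B_col] by (auto simp: M_eq)
    then show ?thesis using moved_sink(3) SX[OF that] by blast
  qed simp
  have dis: "set (X a) \<inter> set (X a') = {}" if "a \<in> Q" "a' \<in> Q" "a \<noteq> a'" for a a'
    using family_disjoint[OF A _ _ that(3)] SX that Q_rows by blast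
  have "\<exists>a\<in>Q. (r, c) \<in> se (X a)"
  proof (rule ccontr)
    assume "\<not> (\<exists>a\<in>Q. (r, c) \<in> se (X a))"
    then have all: "{a \<in> Q. source L a < m \<and> m \<le> sink L (S a) \<and> (r, c) \<notin> se (X a)} =
        {a \<in> Q. source L a < m \<and> m \<le> sink L (S a)}" for m by blast
    have "Q \<subseteq> {1..num_rows L}" "\<And>a. a \<in> Q \<Longrightarrow> full_run a (S a) (X a)" using Q_rows SX by blast+
    from crossing_bound[of Q S X, OF this dis B, unfolded all]
    obtain m C where m: "source L r < m" "m \<le> sink L c" and C: "C \<subseteq> pluses L" "chain C"
      "\<forall>(s, d)\<in>C. r < s \<and> d < c \<and> source L s < m \<and> m \<le> sink L d"
      and card: "card {a \<in> Q. source L a < m \<and> m \<le> sink L (S a)} \<le> card C" by blast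
    let ?O = "{source L r<..<m}"
    let ?Q1 = "{a \<in> Q. source L a < m \<and> m \<le> sink L (S a)}" and ?Q2 = "{a \<in> Q. sink L (S a) < m}"
    have finQ: "finite Q" by (simp add: Q_def)
    have finK: "finite ?K" using positroid_subset M'_max(1) by blast
    have inj: "inj_on (\<lambda>a. sink L (S a)) Q"
    proof (rule inj_onI)
      fix a a' assume aa: "a \<in> Q" "a' \<in> Q" "sink L (S a) = sink L (S a')"
      then have "target A (source L a) = target A (source L a')" using SX by (simp add: target_def last_path_of)
      then have "source L a = source L a'"
        using family_target(2)[OF A] source_in_sources Q_rows aa by (meson bij_betw_imp_inj_on inj_onD)
      then show "a = a'" using source_eq_iff Q_rows aa by blast
    qed
    \<comment> \<open>Arrivals before \<open>m\<close> are arrivals of \<open>M'(B)\<close> as well,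
      since the extra sink of column \<open>c\<close> is not before \<open>m\<close>.\<close>
    have "(\<lambda>a. sink L (S a)) ` ?Q2 \<subseteq> (?K - sources L) \<inter> ?O"
    proof
      fix j assume "j \<in> (\<lambda>a. sink L (S a)) ` ?Q2"
      then obtain a where a: "a \<in> Q" "sink L (S a) < m" "j = sink L (S a)" by auto
      then have "S a \<noteq> c" using m by auto
      then have "sink L (S a) \<in> ?K" using S_cases[OF a(1)] by simp
      then show "j \<in> (?K - sources L) \<inter> ?O"
        using a moved_sink(1) SX[OF a(1)] sink_not_source by auto
    qed
    then have Q2: "card ?Q2 \<le> card ((?K - sources L) \<inter> ?O)"
      using inj finK by (metis (no_types, lifting) card_image card_mono finite_Diff finite_Int inj_on_subset mem_Collect_eq subsetI)
    \<comment> \<open>Departures before \<open>m\<close> are those of \<open>M'(B)\<close> together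
      with the source of row \<open>r\<close>. This is the additional crossing.\<close>
    have "source L ` {a \<in> Q. source L a < m} = insert (source L r) ((sources L - ?K) \<inter> ?O)"
    proof (intro equalityI subsetI)
      fix i assume "i \<in> source L ` {a \<in> Q. source L a < m}"
      then obtain a where a: "a \<in> Q" "source L a < m" "i = source L a" by auto
      then show "i \<in> insert (source L r) ((sources L - ?K) \<inter> ?O)"
        using Q_cases[OF a(1)] moved_source(1) Q_rows source_in_sources by auto
    next
      fix i assume "i \<in> insert (source L r) ((sources L - ?K) \<inter> ?O)"
      then show "i \<in> source L ` {a \<in> Q. source L a < m}"
      proof
        assume "i = source L r"
        then show ?thesis using rQ m by auto
      next
        assume i: "i \<in> (sources L - ?K) \<inter> ?O"
        then obtain a where a: "a \<in> {1..num_rows L}" "i = source L a" by (auto simp: sources_def)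
        then have "a \<in> Q" using i source_neq_sink B_col by (auto simp: Q_def M_eq)
        then show ?thesis using a i by auto
      qed
    qed
    moreover have "inj_on (source L) {a \<in> Q. source L a < m}"
      by (rule inj_on_subset[OF source_inj]) (auto simp: Q_def)
    ultimately have "card {a \<in> Q. source L a < m} = Suc (card ((sources L - ?K) \<inter> ?O))"
      using finite_sources by (metis (no_types, lifting) Int_iff card_image card_insert_disjoint finite_Diff finite_Int greaterThanLessThan_iff less_irrefl)
    moreover have "card {a \<in> Q. source L a < m} \<le> card ?Q1 + card ?Q2"
      using finQ by (intro order_trans[OF card_mono card_Un_le]) auto
    ultimately have "Suc (card ((sources L - ?K) \<inter> ?O)) \<le> card C + card ((?K - sources L) \<inter> ?O)"
      using Q2 card by linarith
    moreover have "card (X \<inter> ?O) = card ((X - Y) \<inter> ?O) + card (X \<inter> Y \<inter> ?O)" if "finite X" for X Y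
    proof -
      have "X \<inter> ?O = ((X - Y) \<inter> ?O) \<union> (X \<inter> Y \<inter> ?O)" "((X - Y) \<inter> ?O) \<inter> (X \<inter> Y \<inter> ?O) = {}" by auto
      then show ?thesis using that by (metis card_Un_disjoint finite_Diff finite_Int)
    qed
    from this[OF finK, of "sources L"] this[OF finite_sources, of ?K]
    have "card (?K \<inter> ?O) + card ((sources L - ?K) \<inter> ?O) = card (sources L \<inter> ?O) + card ((?K - sources L) \<inter> ?O)"
      by (simp add: Int_commute Int_left_commute)
    ultimately show False using chain_le_M'[OF m C] by linarith
  qed
  \<comment> \<open>Every run of the family starts weakly below row \<open>r\<close> and ends weakly
    east of column \<open>c\<close>. One that has \<open>(r, c)\<close> on it or to its southeast
    therefore passes through \<open>(r, c)\<close> itself, from row \<open>r\<close> to column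
    \<open>c\<close>.\<close>
  then obtain a where a: "a \<in> Q" "(r, c) \<in> se (X a)" by blast
  then obtain r' c' where rc: "(r', c') \<in> set (X a)" "r' \<le> r" "c \<le> c'" by (auto simp: se_def)
  have run: "run (S a) (X a)" "hd (X a) = (a, first_col a)" using SX[OF a(1)] by (auto simp: full_run_def)
  have "a \<le> r'" "c' \<le> S a" using run_bounds[OF run(1) rc(1)] run(2) by auto
  then have eq: "a = r" "S a = c" "r' = r" "c' = c" using Q_cases[OF a(1)] S_cases[OF a(1)] rc by auto
  then have "full_run r c (X r)" "(r, c) \<in> set (X r)" "A (source L r) = path_of r c (X r)"
    using SX[OF a(1)] rc by auto
  then show "A (source L r) = path_of r c (hook_boxes (r, c))" "(r, c) \<in> pluses L"
    using full_run_hook by auto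
qed

end

lemma hook_weight:
  assumes "(r, c) \<in> pluses L"
  shows "path_weight L T (path_of r c (hook_boxes (r, c))) = (\<Prod>D | D \<in> pluses L \<and> ((r, c), D) \<in> face_order L. T D)"
proof -
  have "pluses L \<inter> se (hook_boxes (r, c)) = {D. D \<in> pluses L \<and> ((r, c), D) \<in> face_order L}"
    unfolding hook_boxes_se[OF assms] using face_order_iff[OF le assms] by auto
  then show ?thesis unfolding path_weight_eq southeast_path_of by simp
qed

text \<open>All nontrivial paths to \<open>M'(B)\<close> start strictly below row \<open>r\<close>
  and end strictly east of column \<open>c\<close>, so they avoid the hook of
  \<open>B\<close>.\<close>

lemma family_extend_hook:
  assumes B: "(r, c) \<in> pluses L" and A: "A \<in> path_families L (M' L (r, c))"
  shows "A(source L r := path_of r c (hook_boxes (r, c))) \<in> path_families L (M L (r, c))"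
    "A (source L r) = [Boundary (source L r)]"
proof -
  let ?p = "path_of r c (hook_boxes (r, c))"
  let ?A = "A(source L r := ?p)"
  note box = plus_box[OF B]
  have r: "r \<in> {1..num_rows L}" and c: "c \<in> {1..num_cols L}" using plus_row plus_col B by blast+
  from A r show triv: "A (source L r) = [Boundary (source L r)]"
    by (cases rule: family_cases) (use M'_source[OF box] in auto)
  have dis: "set ?p \<inter> set (A i) = {}" if i: "i \<in> sources L" "i \<noteq> source L r" for i
  proof -
    obtain a where a: "a \<in> {1..num_rows L}" "i = source L a" using i by (auto simp: sources_def)
    have ne: "source L a \<noteq> sink L c" using source_neq_sink a(1) c by blast
    from A a(1) show ?thesis
    proof (cases rule: family_cases)
      case trivial
      then show ?thesis using a i ne by (auto simp: path_of_def simp del: hook_boxes.simps)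
    next
      case (run b xs)
      have "r < a" "b < c" using moved_source(3)[OF box a(1) run(1)] moved_sink(3)[OF box run(2,3)] by auto
      have "set (hook_boxes (r, c)) \<inter> set xs = {}"
      proof (rule equals0I)
        fix x assume x: "x \<in> set (hook_boxes (r, c)) \<inter> set xs"
        have "run b xs" "hd xs = (a, first_col a)" using run(4) by (auto simp: full_run_def)
        then have "a \<le> fst x" "snd x \<le> b" using run_bounds[of b xs x] x by auto
        then show False using x \<open>r < a\<close> \<open>b < c\<close> hook_boxes_set[OF B] by auto
      qed
      moreover have "sink L b \<noteq> sink L c" using sink_eq_iff[OF run(2) c] \<open>b < c\<close> by simp
      moreover have "source L r \<noteq> sink L b" using source_neq_sink r run(2) by blast
      ultimately show ?thesis using a i ne run(5) by (auto simp: path_of_def simp del: hook_boxes.simps)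
    qed
  qed
  have "disjoint_family_on (\<lambda>i. set (?A i)) (sources L)"
    unfolding disjoint_family_on_def
  proof (intro ballI impI)
    fix i j assume ij: "i \<in> sources L" "j \<in> sources L" "i \<noteq> j"
    consider "i = source L r" | "j = source L r" | "i \<noteq> source L r" "j \<noteq> source L r" by blast
    then show "set (?A i) \<inter> set (?A j) = {}"
    proof cases
      case 1
      then show ?thesis using dis[OF ij(2)] ij(3) by auto
    next
      case 2
      then show ?thesis using dis[OF ij(1)] ij(3) by auto
    next
      case 3
      then show ?thesis using A ij by (auto simp: path_families_def disjoint_family_on_def)
    qed
  qed
  moreover have "gamma_path L (?A i) \<and> hd (?A i) = Boundary i" if "i \<in> sources L" for i
  proof (cases "i = source L r")
    case True
    then show ?thesis using full_run_gamma_path[OF hook_full_run[OF B]]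
      by (simp add: path_of_def del: hook_boxes.simps)
  next
    case False
    then show ?thesis using A that by (auto simp: path_families_def)
  qed
  moreover have "(\<lambda>i. last (?A i)) ` sources L = Boundary ` M L (r, c)"
  proof -
    let ?t = "target A"
    have t: "bij_betw ?t (sources L) (M' L (r, c))" by (rule family_target(2)[OF A])
    have rs: "source L r \<in> sources L" using r by (auto simp: sources_def)
    have tr: "?t (source L r) = source L r" using triv by (simp add: target_def)
    have "(\<lambda>i. last (?A i)) ` sources L = insert (Boundary (sink L c)) ((\<lambda>i. last (A i)) ` (sources L - {source L r}))"
      using rs by (auto simp: last_path_of simp del: hook_boxes.simps)
    also have "(\<lambda>i. last (A i)) ` (sources L - {source L r}) = Boundary ` ?t ` (sources L - {source L r})"
      using family_target(1)[OF A] by (force simp: image_image)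
    also have "?t ` (sources L - {source L r}) = M' L (r, c) - {source L r}"
      using t rs tr by (auto simp: bij_betw_def inj_on_def)
    finally show ?thesis unfolding M_eq[OF box] by simp
  qed
  moreover have "?A \<in> extensional (sources L)"
    using A r by (auto simp: path_families_def extensional_def sources_def)
  ultimately show "?A \<in> path_families L (M L (r, c))" by (auto simp: path_families_def)
qed

lemma family_remove_hook:
  assumes B: "(r, c) \<in> boxes L" and A: "A \<in> path_families L (M L (r, c))"
  shows "A(source L r := [Boundary (source L r)]) \<in> path_families L (M' L (r, c))"
proof -
  let ?A = "A(source L r := [Boundary (source L r)])"
  have r: "r \<in> {1..num_rows L}" using B by (simp add: box_iff)
  have rs: "source L r \<in> sources L" using r by (auto simp: sources_def)
  note hook = M_family_hook(1)[OF B A]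
  have sub: "set (?A i) \<subseteq> set (A i)" for i using hook by (simp add: path_of_def del: hook_boxes.simps)
  have "disjoint_family_on (\<lambda>i. set (?A i)) (sources L)"
    unfolding disjoint_family_on_def
  proof (intro ballI impI)
    fix i j assume ij: "i \<in> sources L" "j \<in> sources L" "i \<noteq> j"
    then have "set (A i) \<inter> set (A j) = {}" using A by (auto simp: path_families_def disjoint_family_on_def)
    then show "set (?A i) \<inter> set (?A j) = {}" using sub[of i] sub[of j] by blast
  qed
  moreover have "gamma_path L (?A i) \<and> hd (?A i) = Boundary i" if "i \<in> sources L" for i
    using A that by (auto simp: path_families_def gamma_path_def)
  moreover have "(\<lambda>i. last (?A i)) ` sources L = Boundary ` M' L (r, c)"
  proof -
    let ?t = "target A"
    have t: "bij_betw ?t (sources L) (M L (r, c))" by (rule family_target(2)[OF A])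
    have tr: "?t (source L r) = sink L c" using hook by (simp add: target_def last_path_of del: hook_boxes.simps)
    have "(\<lambda>i. last (?A i)) ` sources L = insert (Boundary (source L r)) ((\<lambda>i. last (A i)) ` (sources L - {source L r}))"
      using rs by auto
    also have "(\<lambda>i. last (A i)) ` (sources L - {source L r}) = Boundary ` ?t ` (sources L - {source L r})"
      using family_target(1)[OF A] by (force simp: image_image)
    also have "?t ` (sources L - {source L r}) = M L (r, c) - {sink L c}"
      using t rs tr by (auto simp: bij_betw_def inj_on_def simp del: M.simps)
    also have "insert (Boundary (source L r)) (Boundary ` (M L (r, c) - {sink L c})) = Boundary ` M' L (r, c)"
      using M'_source[OF B] M'_sink[OF B] unfolding M_eq[OF B] by auto
    finally show ?thesis .
  qed
  moreover have "?A \<in> extensional (sources L)"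
    using A rs by (auto simp: path_families_def extensional_def)
  ultimately show ?thesis by (auto simp: path_families_def)
qed

text \<open>Replacing the trivial path at the source of \<open>B\<close> by the hook is a bijection
  from the families of \<open>M'(B)\<close> to those of \<open>M(B)\<close>, and it multiplies every
  weight by that of the hook.\<close>

lemma measurement_M:
  assumes B: "B \<in> pluses L"
  shows "measurement L T (M L B) = (\<Prod>D | D \<in> pluses L \<and> (B, D) \<in> face_order L. T D) * measurement L T (M' L B)"
proof -
  obtain r c where rc: "B = (r, c)" by (cases B)
  have B': "(r, c) \<in> pluses L" using B rc by simp
  note box = plus_box[OF B']
  let ?p = "path_of r c (hook_boxes (r, c))"
  have rs: "source L r \<in> sources L" using plus_row[OF B'] by (auto simp: sources_def)
  have "measurement L T (M L (r, c)) =
    (\<Sum>A\<in>path_families L (M' L (r, c)). path_weight L T ?p * (\<Prod>i\<in>sources L. path_weight L T (A i)))"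
    unfolding measurement_def
  proof (rule sum.reindex_bij_witness[where i = "\<lambda>A. A(source L r := ?p)"
        and j = "\<lambda>A. A(source L r := [Boundary (source L r)])"], goal_cases)
    case (1 A)
    then show ?case using M_family_hook(1)[OF box 1] by (metis fun_upd_triv fun_upd_upd)
  next
    case (2 A)
    then show ?case by (rule family_remove_hook[OF box])
  next
    case (3 A)
    then show ?case using family_extend_hook(2)[OF B' 3] by (metis fun_upd_triv fun_upd_upd)
  next
    case (4 A)
    then show ?case by (rule family_extend_hook(1)[OF B'])
  next
    case (5 A)
    let ?A' = "A(source L r := [Boundary (source L r)])"
    have split: "(\<Prod>i\<in>sources L. path_weight L T (X i)) =
        path_weight L T (X (source L r)) * (\<Prod>i\<in>sources L - {source L r}. path_weight L T (X i))" for X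
      using rs finite_sources by (simp add: prod.remove)
    have "path_weight L T (?A' (source L r)) = 1" by (simp add: path_weight_eq southeast_trivial)
    moreover have "(\<Prod>i\<in>sources L - {source L r}. path_weight L T (?A' i)) =
        (\<Prod>i\<in>sources L - {source L r}. path_weight L T (A i))" by (intro prod.cong) auto
    ultimately show ?case unfolding split[of A] split[of ?A'] M_family_hook(1)[OF box 5] by simp
  qed
  then show ?thesis unfolding rc hook_weight[OF B', symmetric]
    by (simp add: measurement_def sum_distrib_left del: M.simps hook_boxes.simps)
qed

text \<open>This justifies the case distinction in \<open>tableau_of\<close>: on the cell,
  \<open>P(M(B))\<close> vanishes exactly at the \<open>0\<close> boxes.\<close>

lemma M_positroid_iff:
  assumes "B \<in> boxes L"
  shows "M L B \<in> positroid L \<longleftrightarrow> B \<in> pluses L"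
proof
  obtain r c where rc: "B = (r, c)" by (cases B)
  assume "M L B \<in> positroid L"
  then obtain A where "A \<in> path_families L (M L (r, c))" using rc by (auto simp: positroid_def simp del: M.simps)
  then show "B \<in> pluses L" using M_family_hook(2) assms rc by blast
next
  assume "B \<in> pluses L"
  from measurement_M[OF this, of "\<lambda>_. 1"] measurement_pos[OF _ M'_max(1), of "\<lambda>_. 1" B]
  have "measurement L (\<lambda>_. 1) (M L B) \<noteq> 0" by simp
  then show "M L B \<in> positroid L" using measurement_zero by blast
qed

end

section \<open>Moebius inversion\<close>

lemma powi_sum:
  fixes x :: "'a::field"
  assumes "x \<noteq> 0"
  shows "finite A \<Longrightarrow> x powi (\<Sum>a\<in>A. f a) = (\<Prod>a\<in>A. x powi f a)"
  by (induction A rule: finite_induct) (use assms in \<open>simp_all add: power_int_add\<close>)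

lemma powi_prod:
  fixes g :: "'b \<Rightarrow> 'a::field"
  shows "finite A \<Longrightarrow> (\<Prod>a\<in>A. g a) powi n = (\<Prod>a\<in>A. g a powi n)"
  by (induction A rule: finite_induct) (simp_all add: power_int_mult_distrib)

lemma moebius_outside: "(x, y) \<notin> R \<Longrightarrow> moebius E R x y = 0"
  by (subst moebius.simps) simp

lemma moebius_sum:
  assumes "finite E" "partial_order_on E R" "x \<in> E" "y \<in> E"
  shows "(\<Sum>z | z \<in> E \<and> (z, y) \<in> R. moebius E R x z) = (if x = y then 1 else 0)"
proof -
  from assms(2) have tr: "trans R" and re: "refl_on E R"
    by (auto simp: partial_order_on_def preorder_on_def)
  let ?S = "{z \<in> E. (x, z) \<in> R \<and> (z, y) \<in> R}"
  have "(\<Sum>z | z \<in> E \<and> (z, y) \<in> R. moebius E R x z) = (\<Sum>z\<in>?S. moebius E R x z)"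
  proof (rule sum.mono_neutral_right)
    show "\<forall>z\<in>{z. z \<in> E \<and> (z, y) \<in> R} - ?S. moebius E R x z = 0"
      using moebius_outside[of x _ R E] by blast
  qed (use assms(1) in auto)
  also have "\<dots> = (if x = y then 1 else 0)"
  proof (cases "(x, y) \<in> R")
    case True
    have "y \<in> ?S" using True assms(4) re by (auto simp: refl_on_def)
    then have "(\<Sum>z\<in>?S. moebius E R x z) = moebius E R x y + (\<Sum>z\<in>?S - {y}. moebius E R x z)"
      using assms(1) by (simp add: sum.remove)
    also have "?S - {y} = {z \<in> E. (x, z) \<in> R \<and> (z, y) \<in> R \<and> z \<noteq> y}" by auto
    finally have sum: "(\<Sum>z\<in>?S. moebius E R x z) =
        moebius E R x y + (\<Sum>z\<in>{z \<in> E. (x, z) \<in> R \<and> (z, y) \<in> R \<and> z \<noteq> y}. moebius E R x z)" .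
    show ?thesis
    proof (cases "x = y")
      case eq: True
      have "antisym R" using assms(2) by (auto simp: partial_order_on_def)
      then have empty: "{z \<in> E. (x, z) \<in> R \<and> (z, y) \<in> R \<and> z \<noteq> y} = {}" using eq by (auto dest: antisymD)
      have one: "moebius E R x y = 1" using assms True eq by (subst moebius.simps) simp
      show ?thesis unfolding sum empty one using eq by simp
    next
      case False
      then have "moebius E R x y = - (\<Sum>z\<in>{z \<in> E. (x, z) \<in> R \<and> (z, y) \<in> R \<and> z \<noteq> y}. moebius E R x z)"
        using assms True by (subst moebius.simps) simp
      then show ?thesis using sum False by simp
    qed
  next
    case False
    then have empty: "?S = {}" and "x \<noteq> y" using tr re assms(3) by (auto dest: transD simp: refl_on_def)
    show ?thesis unfolding empty using \<open>x \<noteq> y\<close> by simp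
  qed
  finally show ?thesis .
qed

text \<open>Exchanging the products collects at each \<open>z\<close> the exponent
  \<open>\<Sum>\<close> of \<open>moebius E R x y\<close> over \<open>y\<close> below
  \<open>z\<close>, which is \<open>1\<close> at \<open>z = x\<close> and \<open>0\<close>
  elsewhere.\<close>

lemma moebius_inversion:
  fixes T :: "'b \<Rightarrow> 'a::field"
  assumes E: "finite E" "partial_order_on E R" and x: "x \<in> E" and T: "\<And>z. z \<in> E \<Longrightarrow> T z \<noteq> 0"
  shows "(\<Prod>y\<in>E. (\<Prod>z | z \<in> E \<and> (y, z) \<in> R. T z) powi moebius E R x y) = T x"
proof -
  let ?h = "\<lambda>y z. T z powi moebius E R x y"
  have "(\<Prod>y\<in>E. (\<Prod>z | z \<in> E \<and> (y, z) \<in> R. T z) powi moebius E R x y) =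
      (\<Prod>y\<in>E. \<Prod>z\<in>{z \<in> E. (y, z) \<in> R}. ?h y z)"
    using E(1) by (simp add: powi_prod)
  also have "\<dots> = (\<Prod>y\<in>E. \<Prod>z\<in>E. if (y, z) \<in> R then ?h y z else 1)"
    by (intro prod.cong refl prod.inter_filter E(1))
  also have "\<dots> = (\<Prod>z\<in>E. \<Prod>y\<in>E. if (y, z) \<in> R then ?h y z else 1)" by (rule prod.swap)
  also have "\<dots> = (\<Prod>z\<in>E. \<Prod>y\<in>{y \<in> E. (y, z) \<in> R}. ?h y z)"
    by (intro prod.cong refl prod.inter_filter[symmetric] E(1))
  also have "\<dots> = (\<Prod>z\<in>E. T z powi (\<Sum>y | y \<in> E \<and> (y, z) \<in> R. moebius E R x y))"
    using E(1) T by (intro prod.cong refl powi_sum[symmetric]) auto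
  also have "\<dots> = (\<Prod>z\<in>E. if x = z then T z else 1)"
    using moebius_sum[OF E x] by (intro prod.cong refl) simp
  also have "\<dots> = T x" using E(1) x by simp
  finally show ?thesis .
qed

text \<open>The system is triangular. Elements are added by increasing \<open>f\<close>, hence from
  the top of the order downwards: a new \<open>x\<close> occurs in no earlier equation, and its own
  determines \<open>T x\<close> as a quotient of positive numbers.\<close>

lemma zeta_solvable:
  fixes \<rho> :: "'b \<Rightarrow> real" and f :: "'b \<Rightarrow> 'c::linorder"
  assumes "finite E" "\<And>x. x \<in> E \<Longrightarrow> (x, x) \<in> R" "\<And>x y. (x, y) \<in> R \<Longrightarrow> x \<noteq> y \<Longrightarrow> f y < f x" "\<And>x. x \<in> E \<Longrightarrow> 0 < \<rho> x"
  shows "\<exists>T. (\<forall>x\<in>E. 0 < T x) \<and> (\<forall>y\<in>E. (\<Prod>z | z \<in> E \<and> (y, z) \<in> R. T z) = \<rho> y)"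
  using assms(1,2,4)
proof (induction E rule: finite_ranking_induct[where f = f])
  case (insert x S)
  show ?case
  proof (cases "x \<in> S")
    case True
    then show ?thesis using insert by (simp add: insert_absorb)
  next
    case False
    obtain T where T: "\<forall>x\<in>S. 0 < T x" "\<forall>y\<in>S. (\<Prod>z | z \<in> S \<and> (y, z) \<in> R. T z) = \<rho> y"
      using insert by auto
    let ?P = "\<Prod>z | z \<in> S \<and> (x, z) \<in> R. T z"
    let ?T = "T(x := \<rho> x / ?P)"
    have P: "0 < ?P" using T(1) by (intro prod_pos) auto
    have rest: "(\<Prod>z | z \<in> S \<and> (y, z) \<in> R. ?T z) = (\<Prod>z | z \<in> S \<and> (y, z) \<in> R. T z)" for y
      using False by (intro prod.cong) auto
    have "(\<Prod>z | z \<in> insert x S \<and> (y, z) \<in> R. ?T z) = \<rho> y" if "y \<in> insert x S" for y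
    proof (cases "y = x")
      case True
      have "{z. z \<in> insert x S \<and> (x, z) \<in> R} = insert x {z. z \<in> S \<and> (x, z) \<in> R}" using insert.prems(1) by auto
      then have "(\<Prod>z | z \<in> insert x S \<and> (x, z) \<in> R. ?T z) = ?T x * (\<Prod>z | z \<in> S \<and> (x, z) \<in> R. ?T z)"
        using False insert(1) by simp
      then show ?thesis using True P unfolding rest by simp
    next
      case ne: False
      then have "y \<in> S" using that by simp
      then have "(y, x) \<notin> R" using assms(3)[of y x] insert(2)[of y] ne by auto
      then have "{z. z \<in> insert x S \<and> (y, z) \<in> R} = {z. z \<in> S \<and> (y, z) \<in> R}" by auto
      then show ?thesis using T(2) \<open>y \<in> S\<close> rest by simp
    qed
    moreover have "\<forall>z\<in>insert x S. 0 < ?T z" using T(1) P insert.prems(2)[of x] by auto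
    ultimately show ?thesis by blast
  qed
qed simp

section \<open>Row spaces and Pluecker coordinates\<close>

definition label_mat :: "nat \<Rightarrow> nat \<Rightarrow> (nat \<Rightarrow> nat \<Rightarrow> real) \<Rightarrow> real mat" where
  "label_mat k n a = mat k n (\<lambda>(r, j). a r (Suc j))"

text \<open>\<open>pick\<close> enumerates the shifted label set increasingly, so it matches the
  sorted list of \<open>J\<close> up to the index shift.\<close>

lemma minor_submatrix:
  assumes J: "J \<subseteq> {1..n}" "card J = k"
  shows "det (submatrix (label_mat k n a) UNIV (Suc -` J)) = minor k a J"
proof -
  let ?S = "Suc -` J"
  have fin: "finite J" using J finite_subset by blast
  have img: "Suc ` ?S = J" using J(1) by (auto simp: image_iff) (metis Suc_pred' Suc_le_eq subsetD atLeastAtMost_iff One_nat_def)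
  have finS: "finite ?S" using img fin finite_imageD[of Suc ?S] by simp
  have cardS: "card ?S = k" using img J(2) card_image[of Suc ?S] by simp
  have "{j. j < n \<and> j \<in> ?S} = ?S" using J(1) by auto
  then have dims: "dim_row (submatrix (label_mat k n a) UNIV ?S) = k" "dim_col (submatrix (label_mat k n a) UNIV ?S) = k"
    using cardS by (simp_all add: dim_submatrix label_mat_def)
  have pick_in: "pick ?S c \<in> ?S" if "c < k" for c using pick_in_set_le that cardS by blast
  have pick_less: "pick ?S c < pick ?S d" if "c < d" "d < k" for c d using pick_mono_le that cardS by blast
  have "sorted_list_of_set J = map (\<lambda>c. Suc (pick ?S c)) [0..<k]"
  proof (rule sorted_distinct_set_unique)
    have "strict_mono_on {..<k} (pick ?S)" by (rule strict_mono_onI) (use pick_less in auto)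
    then have inj: "inj_on (pick ?S) {..<k}" by (rule strict_mono_on_imp_inj_on)
    show "sorted (map (\<lambda>c. Suc (pick ?S c)) [0..<k])"
      by (auto simp: sorted_iff_nth_mono_less intro: less_imp_le pick_less)
    show "distinct (map (\<lambda>c. Suc (pick ?S c)) [0..<k])"
      using inj by (auto simp: distinct_map inj_on_def)
    have "pick ?S ` {..<k} = ?S"
      using pick_in finS cardS card_image[OF inj] by (intro card_subset_eq) auto
    then have "Suc ` pick ?S ` {..<k} = J" using img by simp
    then show "set (sorted_list_of_set J) = set (map (\<lambda>c. Suc (pick ?S c)) [0..<k])"
      using fin by (simp add: image_image atLeast0LessThan)
  qed (use fin in simp_all)
  then have nth: "sorted_list_of_set J ! c = Suc (pick ?S c)" if "c < k" for c using that by simp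
  have "submatrix (label_mat k n a) UNIV ?S = mat k k (\<lambda>(r, c). a r (sorted_list_of_set J ! c))"
  proof (rule eq_matI)
    fix r c assume "r < dim_row (mat k k (\<lambda>(r, c). a r (sorted_list_of_set J ! c)))"
      "c < dim_col (mat k k (\<lambda>(r, c). a r (sorted_list_of_set J ! c)))"
    then have rc: "r < k" "c < k" by simp_all
    have "pick ?S c < n" using pick_in[OF rc(2)] J(1) by auto
    then have "submatrix (label_mat k n a) UNIV ?S $$ (r, c) = a r (Suc (pick ?S c))"
      using rc dims unfolding dim_submatrix by (subst submatrix_index) (auto simp: pick_UNIV label_mat_def)
    then show "submatrix (label_mat k n a) UNIV ?S $$ (r, c) = mat k k (\<lambda>(r, c). a r (sorted_list_of_set J ! c)) $$ (r, c)"
      using nth rc by simp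
  qed (use dims in simp_all)
  then show ?thesis by (simp add: minor_def fdet_def)
qed

definition row_span :: "nat \<Rightarrow> nat \<Rightarrow> (nat \<Rightarrow> nat \<Rightarrow> real) \<Rightarrow> real vec set" where
  "row_span k n a = {vec n (\<lambda>j. \<Sum>r<k. y r * a r (Suc j)) |y. True}"

lemma row_spanI: "w = vec n (\<lambda>j. \<Sum>r<k. y r * a r (Suc j)) \<Longrightarrow> w \<in> row_span k n a"
  unfolding row_span_def by (intro CollectI exI[of _ y] conjI TrueI)

lemma row_space_label_mat: "vec_space.row_space n (label_mat k n a) = row_span k n a"
proof -
  have A: "label_mat k n a \<in> carrier_mat k n" by (simp add: label_mat_def)
  have mult: "(label_mat k n a)\<^sup>T *\<^sub>v y = vec n (\<lambda>j. \<Sum>r<k. y $ r * a r (Suc j))" if "y \<in> carrier_vec k" for y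
    using that by (auto intro!: eq_vecI sum.cong simp: label_mat_def scalar_prod_def atLeast0LessThan mult.commute)
  show ?thesis
    unfolding vec_space.row_space_eq[OF A] row_span_def
  proof (intro equalityI subsetI)
    fix w assume "w \<in> {w \<in> carrier_vec (dim_col (label_mat k n a)). \<exists>y\<in>carrier_vec (dim_row (label_mat k n a)). (label_mat k n a)\<^sup>T *\<^sub>v y = w}"
    then obtain y where "y \<in> carrier_vec k" "(label_mat k n a)\<^sup>T *\<^sub>v y = w" using A by auto
    then show "w \<in> {vec n (\<lambda>j. \<Sum>r<k. y r * a r (Suc j)) |y. True}"
      using mult by (auto intro!: exI[of _ "\<lambda>r. y $ r"])
  next
    fix w assume "w \<in> {vec n (\<lambda>j. \<Sum>r<k. y r * a r (Suc j)) |y. True}"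
    then obtain y where w: "w = vec n (\<lambda>j. \<Sum>r<k. y r * a r (Suc j))" by auto
    have "(label_mat k n a)\<^sup>T *\<^sub>v vec k y = w"
      using mult[of "vec k y"] w by (auto intro!: eq_vecI sum.cong)
    then show "w \<in> {w \<in> carrier_vec (dim_col (label_mat k n a)). \<exists>y\<in>carrier_vec (dim_row (label_mat k n a)). (label_mat k n a)\<^sup>T *\<^sub>v y = w}"
      using A w by auto
  qed
qed

lemma plucker_iff:
  "plucker_coordinates k n x P \<longleftrightarrow>
    (\<exists>a. x = row_span k n a \<and> (\<forall>J. J \<subseteq> {1..n} \<and> card J = k \<longrightarrow> P J = minor k a J))"
proof
  assume "plucker_coordinates k n x P"
  then obtain A where A: "A \<in> carrier_mat k n" "vec_space.row_space n A = x"
    "\<forall>J. J \<subseteq> {1..n} \<and> card J = k \<longrightarrow> P J = det (submatrix A UNIV (Suc -` J))"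
    by (auto simp: plucker_coordinates_def)
  have eq: "A = label_mat k n (\<lambda>r j. A $$ (r, j - 1))"
    using A(1) by (auto intro!: eq_matI simp: label_mat_def)
  show "\<exists>a. x = row_span k n a \<and> (\<forall>J. J \<subseteq> {1..n} \<and> card J = k \<longrightarrow> P J = minor k a J)"
    using A(2,3) row_space_label_mat minor_submatrix eq by metis
next
  assume "\<exists>a. x = row_span k n a \<and> (\<forall>J. J \<subseteq> {1..n} \<and> card J = k \<longrightarrow> P J = minor k a J)"
  then obtain a where a: "x = row_span k n a" "\<forall>J. J \<subseteq> {1..n} \<and> card J = k \<longrightarrow> P J = minor k a J" by blast
  have "label_mat k n a \<in> carrier_mat k n" by (simp add: label_mat_def)
  then show "plucker_coordinates k n x P"
    unfolding plucker_coordinates_def using a row_space_label_mat minor_submatrix by metis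
qed

text \<open>A nonvanishing maximal minor forces rank \<open>k\<close>. The transpose turns the span
  of the rows into a column space, to which \<open>rank\<close> refers.\<close>

lemma row_span_grassmannian:
  assumes J: "J \<subseteq> {1..n}" "card J = k" and nz: "minor k a J \<noteq> 0"
  shows "row_span k n a \<in> grassmannian k n"
proof -
  interpret vec_space "TYPE(real)" n .
  let ?A = "label_mat k n a"
  have A: "?A \<in> carrier_mat k n" "?A\<^sup>T \<in> carrier_mat n k" by (simp_all add: label_mat_def)
  have sub: "set (rows ?A) \<subseteq> carrier_vec n" by (auto simp: rows_def label_mat_def)
  have rs: "row_space ?A = row_span k n a" by (rule row_space_label_mat)
  have "VectorSpace.subspace class_ring (row_space ?A) V" unfolding row_space_def by (rule span_is_subspace[OF sub])
  moreover have "vectorspace.dim class_ring (vs (row_space ?A)) = rank ?A\<^sup>T"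
    by (simp add: rank_def row_space_def)
  moreover have "rank ?A\<^sup>T = k"
  proof (rule antisym)
    show "rank ?A\<^sup>T \<le> k" using rank_le_nc[OF A(2)] .
    have dims: "dim_row (submatrix ?A UNIV (Suc -` J)) = dim_col (submatrix ?A UNIV (Suc -` J))"
      using nz minor_submatrix[OF J, of a] by (auto simp: det_def split: if_splits)
    have "submatrix ?A\<^sup>T (Suc -` J) UNIV = (submatrix ?A UNIV (Suc -` J))\<^sup>T"
    proof (rule eq_matI)
      fix i j assume "i < dim_row ((submatrix ?A UNIV (Suc -` J))\<^sup>T)" "j < dim_col ((submatrix ?A UNIV (Suc -` J))\<^sup>T)"
      then have ij: "i < card {i. i < n \<and> i \<in> Suc -` J}" "j < card {i. i < k \<and> i \<in> (UNIV :: nat set)}"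
        using A by (simp_all add: dim_submatrix)
      then have "pick (Suc -` J) i < n" "j < k" using pick_le[of i n "Suc -` J"] by simp_all
      then show "submatrix ?A\<^sup>T (Suc -` J) UNIV $$ (i, j) = (submatrix ?A UNIV (Suc -` J))\<^sup>T $$ (i, j)"
        using ij A by (simp add: submatrix_def pick_UNIV)
    qed (simp_all add: dim_submatrix)
    then have "det (submatrix ?A\<^sup>T (Suc -` J) UNIV) = minor k a J"
      using minor_submatrix[OF J, of a] dims by (metis carrier_matI det_transpose)
    then have "card {j. j < k \<and> j \<in> (UNIV :: nat set)} \<le> rank ?A\<^sup>T"
      using rank_gt_minor[OF A(2)] nz by metis
    then show "k \<le> rank ?A\<^sup>T" by simp
  qed
  ultimately show ?thesis unfolding grassmannian_def rs by simp
qed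

section \<open>Echelon form at the sources\<close>

context le_filling begin

abbreviation "nrows \<equiv> num_rows L"

definition echelon :: "(nat \<Rightarrow> nat \<Rightarrow> real) \<Rightarrow> bool" where
  "echelon a \<longleftrightarrow> (\<forall>r<nrows. \<forall>s<nrows. a r (source L (Suc s)) = (if r = s then 1 else 0))"

lemma sorted_sources: "c < nrows \<Longrightarrow> sorted_list_of_set (sources L) ! c = source L (Suc c)"
proof -
  have "sorted_list_of_set (sources L) = map (\<lambda>r. source L (Suc r)) [0..<nrows]"
  proof (rule sorted_distinct_set_unique)
    show "sorted (map (\<lambda>r. source L (Suc r)) [0..<nrows])"
      by (auto simp: sorted_iff_nth_mono_less row_mono intro!: less_imp_le)
    show "distinct (map (\<lambda>r. source L (Suc r)) [0..<nrows])"
      using row_bij by (simp add: distinct_map bij_betw_def atLeast0LessThan)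
    show "set (sorted_list_of_set (sources L)) = set (map (\<lambda>r. source L (Suc r)) [0..<nrows])"
      using row_bij finite_sources by (simp add: bij_betw_def atLeast0LessThan)
  qed simp_all
  then show "c < nrows \<Longrightarrow> sorted_list_of_set (sources L) ! c = source L (Suc c)" by simp
qed

text \<open>Multiplying by the inverse of the source columns keeps the row space and divides every
  maximal minor by \<open>P (sources L)\<close>.\<close>

lemma echelon_form:
  assumes P: "plucker_coordinates nrows n x P" "P (sources L) \<noteq> 0" and n: "n = num_steps L"
  obtains a where "echelon a" "x = row_span nrows n a"
    "\<And>J. J \<subseteq> {1..n} \<Longrightarrow> card J = nrows \<Longrightarrow> P J = P (sources L) * minor nrows a J"
proof -
  obtain a where x: "x = row_span nrows n a" and Pa: "\<And>J. J \<subseteq> {1..n} \<Longrightarrow> card J = nrows \<Longrightarrow> P J = minor nrows a J"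
    using P(1) unfolding plucker_iff by blast
  let ?f = "\<lambda>r c. a r (source L (Suc c))"
  have I: "sources L \<subseteq> {1..n}" "card (sources L) = nrows" using sources_sinks card_sources n by auto
  have fI: "fdet nrows ?f = P (sources L)"
    unfolding Pa[OF I] minor_def using sorted_sources by (intro fdet_cong) simp
  then have nz: "fdet nrows ?f \<noteq> 0" using P(2) by simp
  obtain b where
    b: "\<forall>r<nrows. \<forall>c<nrows. (\<Sum>l<nrows. b r l * ?f l c) = (if r = c then 1 else 0)"
      "\<forall>r<nrows. \<forall>c<nrows. (\<Sum>l<nrows. ?f r l * b l c) = (if r = c then 1 else 0)"
      "fdet nrows b * fdet nrows ?f = 1"
    using fdet_inverse[OF nz] by (elim exE conjE) (rule that)
  define a' where "a' r j = (\<Sum>l<nrows. b r l * a l j)" for r j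
  have "echelon a'" using b(1) by (simp add: echelon_def a'_def)
  moreover have recover: "a r j = (\<Sum>s<nrows. ?f r s * a' s j)" if "r < nrows" for r j
  proof -
    have "(\<Sum>s<nrows. ?f r s * a' s j) = (\<Sum>s<nrows. \<Sum>l<nrows. ?f r s * b s l * a l j)"
      by (simp add: a'_def sum_distrib_left mult.assoc)
    also have "\<dots> = (\<Sum>l<nrows. \<Sum>s<nrows. ?f r s * b s l * a l j)" by (rule sum.swap)
    also have "\<dots> = (\<Sum>l<nrows. (if r = l then 1 else 0) * a l j)"
      using b(2) that by (intro sum.cong refl) (simp add: sum_distrib_right[symmetric])
    also have "\<dots> = (\<Sum>l<nrows. if r = l then a l j else 0)" by (intro sum.cong) auto
    also have "\<dots> = a r j" using that by simp
    finally show ?thesis ..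
  qed
  have swap: "(\<Sum>r<nrows. y r * (\<Sum>l<nrows. g r l * h l j)) = (\<Sum>l<nrows. (\<Sum>r<nrows. y r * g r l) * h l j)"
    for y :: "nat \<Rightarrow> real" and g and h :: "nat \<Rightarrow> nat \<Rightarrow> real" and j
    unfolding sum_distrib_left sum_distrib_right by (subst sum.swap) (simp only: mult.assoc)
  have "row_span nrows n a = row_span nrows n a'"
  proof (intro equalityI subsetI)
    fix w assume "w \<in> row_span nrows n a"
    then obtain y where w: "w = vec n (\<lambda>j. \<Sum>r<nrows. y r * a r (Suc j))" by (auto simp: row_span_def)
    have "w = vec n (\<lambda>j. \<Sum>r<nrows. y r * (\<Sum>s<nrows. ?f r s * a' s (Suc j)))"
      unfolding w
    proof (rule arg_cong[of _ _ "vec n"], rule ext, rule sum.cong[OF refl])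
      fix j r assume "r \<in> {..<nrows}"
      then show "y r * a r (Suc j) = y r * (\<Sum>s<nrows. ?f r s * a' s (Suc j))"
        using recover[of r "Suc j"] by simp
    qed
    then have "w = vec n (\<lambda>j. \<Sum>s<nrows. (\<Sum>r<nrows. y r * ?f r s) * a' s (Suc j))"
      by (simp only: swap[of y ?f a'])
    then show "w \<in> row_span nrows n a'" by (rule row_spanI)
  next
    fix w assume "w \<in> row_span nrows n a'"
    then obtain y where w: "w = vec n (\<lambda>j. \<Sum>r<nrows. y r * a' r (Suc j))" by (auto simp: row_span_def)
    then have "w = vec n (\<lambda>j. \<Sum>l<nrows. (\<Sum>r<nrows. y r * b r l) * a l (Suc j))"
      by (simp only: a'_def swap[of y b a])
    then show "w \<in> row_span nrows n a" by (rule row_spanI)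
  qed
  moreover have "P J = P (sources L) * minor nrows a' J" if "J \<subseteq> {1..n}" "card J = nrows" for J
  proof -
    have "minor nrows a' J = fdet nrows b * minor nrows a J"
      unfolding minor_def a'_def by (rule fdet_mult)
    then have "P (sources L) * minor nrows a' J = (fdet nrows b * fdet nrows ?f) * minor nrows a J"
      using fI by simp
    then show ?thesis using b(3) Pa[OF that] by simp
  qed
  ultimately show thesis using that x by blast
qed

text \<open>A row of \<open>a\<close> is a combination of the rows of \<open>a'\<close>; comparing
  source columns shows that only the row with the same index occurs, with coefficient
  \<open>1\<close>.\<close>

lemma echelon_unique:
  assumes a: "echelon a" and a': "echelon a'" and eq: "row_span nrows n a = row_span nrows n a'" and n: "n = num_steps L"
    and r: "r < nrows" and j: "j \<in> {1..n}"
  shows "a r j = a' r j"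
proof -
  have "vec n (\<lambda>j. a r (Suc j)) = vec n (\<lambda>j. \<Sum>s<nrows. (if s = r then 1 else 0) * a s (Suc j))"
    using r by (auto intro!: eq_vecI simp: if_distrib[of "\<lambda>x. x * _"] cong: if_cong)
  then have "vec n (\<lambda>j. a r (Suc j)) \<in> row_span nrows n a"
    unfolding row_span_def by (intro CollectI exI[of _ "\<lambda>s. if s = r then 1 else 0"]) simp
  then have "vec n (\<lambda>j. a r (Suc j)) \<in> row_span nrows n a'" unfolding eq .
  then obtain y where y: "vec n (\<lambda>j. a r (Suc j)) = vec n (\<lambda>j. \<Sum>s<nrows. y s * a' s (Suc j))"
    by (auto simp: row_span_def)
  have entry: "a r j = (\<Sum>s<nrows. y s * a' s j)" if "j \<in> {1..n}" for j
  proof -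
    have "j - 1 < n" "Suc (j - 1) = j" using that by auto
    then show ?thesis using arg_cong[OF y, of "\<lambda>v. v $ (j - 1)"] by simp
  qed
  have "y s = (if r = s then 1 else 0)" if s: "s < nrows" for s
  proof -
    have "source L (Suc s) \<in> {1..n}" using sources_sinks s n by (auto simp: sources_def)
    from entry[OF this] have "(if r = s then 1 else 0) = (\<Sum>t<nrows. y t * (if t = s then 1 else 0))"
      using a a' r s by (simp add: echelon_def)
    also have "\<dots> = (\<Sum>t<nrows. if t = s then y t else 0)" by (intro sum.cong) auto
    also have "\<dots> = y s" using s by simp
    finally show ?thesis ..
  qed
  then have "(\<Sum>s<nrows. y s * a' s j) = (\<Sum>s<nrows. if s = r then a' s j else 0)" by (intro sum.cong) auto
  then show ?thesis using entry[OF j] r by simp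
qed

end

lemma row_span_cong:
  assumes "\<And>r j. r < k \<Longrightarrow> j \<in> {1..n} \<Longrightarrow> a r j = a' r j"
  shows "row_span k n a = row_span k n a'"
proof -
  have "vec n (\<lambda>j. \<Sum>r<k. y r * a r (Suc j)) = vec n (\<lambda>j. \<Sum>r<k. y r * a' r (Suc j))" for y
    using assms by (intro eq_vecI) (auto intro!: sum.cong)
  then show ?thesis by (simp add: row_span_def)
qed

text \<open>A contributing permutation sends row \<open>i\<close> to column \<open>p\<close>, so it
  never uses column \<open>p\<close> in another row.\<close>

lemma fdet_unit_row:
  assumes i: "i < k" and fg: "f i p = g i p"
    and unit: "\<And>c. c < k \<Longrightarrow> c \<noteq> p \<Longrightarrow> f i c = 0 \<and> g i c = 0"
    and rest: "\<And>r c. r < k \<Longrightarrow> c < k \<Longrightarrow> r \<noteq> i \<Longrightarrow> c \<noteq> p \<Longrightarrow> f r c = g r c"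
  shows "fdet k f = fdet k g"
proof -
  have "(\<Prod>r = 0..<k. f r (q r)) = (\<Prod>r = 0..<k. g r (q r))" if q: "q permutes {0..<k}" for q
  proof (cases "q i = p")
    case True
    show ?thesis
    proof (intro prod.cong refl)
      fix r assume "r \<in> {0..<k}"
      then have "r < k" "q r < k" using permutes_in_image[OF q, of r] by simp_all
      moreover have "r \<noteq> i \<Longrightarrow> q r \<noteq> p" using True permutes_inj[OF q] by (auto dest: injD)
      ultimately show "f r (q r) = g r (q r)" using rest fg True by (cases "r = i") auto
    qed
  next
    case False
    have "q i < k" using i permutes_in_image[OF q, of i] by simp
    then have "f i (q i) = 0" "g i (q i) = 0" using unit False by auto
    then have "(\<Prod>r = 0..<k. f r (q r)) = 0" "(\<Prod>r = 0..<k. g r (q r)) = 0"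
      using i by (auto intro!: prod_zero)
    then show ?thesis by simp
  qed
  then show ?thesis unfolding fdet_leibniz by (intro sum.cong) auto
qed

context le_filling begin

text \<open>In the minor \<open>J\<close> the row of a source in \<open>J\<close> may be replaced by
  a unit row. Then the minor visibly depends only on rows of sources outside \<open>J\<close>, which
  for \<open>M'(B)\<close> and \<open>M(B)\<close> confines it to the quadrant of
  \<open>B\<close>.\<close>

definition reduced :: "(nat \<Rightarrow> nat \<Rightarrow> real) \<Rightarrow> nat set \<Rightarrow> nat \<Rightarrow> nat \<Rightarrow> real" where
  "reduced a J r j = (if source L (Suc r) \<in> J then (if j = source L (Suc r) then 1 else 0) else a r j)"

lemma reduced_minor:
  assumes a: "echelon a" and e: "bij_betw e {..<nrows} J"
  shows "fdet nrows (\<lambda>r c. reduced a J r (e c)) = fdet nrows (\<lambda>r c. a r (e c))"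
proof -
  have "\<forall>r. \<exists>c. r < nrows \<and> source L (Suc r) \<in> J \<longrightarrow> c < nrows \<and> e c = source L (Suc r)"
    using e by (metis bij_betw_def imageE lessThan_iff)
  then obtain col where col: "\<And>r. r < nrows \<Longrightarrow> source L (Suc r) \<in> J \<Longrightarrow> col r < nrows \<and> e (col r) = source L (Suc r)"
    by metis
  have inj: "source L (Suc r) = source L (Suc s) \<longleftrightarrow> r = s" if "r < nrows" "s < nrows" for r s
    using that source_eq_iff[of "Suc r" "Suc s"] by simp
  show ?thesis
    by (rule fdet_unit_columns[where R = "{r. r < nrows \<and> source L (Suc r) \<in> J}" and \<kappa> = col])
      (use col a inj in \<open>auto simp: reduced_def echelon_def\<close>)
qed

lemma echelon_entry_minor:
  assumes a: "echelon a" and r: "r < nrows" and j: "j \<notin> sources L"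
    and zero: "minor nrows a (insert j (sources L - {source L (Suc r)})) = 0"
  shows "a r j = 0"
proof -
  let ?e = "(\<lambda>r. source L (Suc r))(r := j)"
  have bij: "bij_betw ?e {..<nrows} (insert j (sources L - {source L (Suc r)}))"
    by (rule bij_betw_exchange[OF row_bij r refl j])
  have "fdet nrows (\<lambda>i c. a i (?e c)) = a r (?e r)"
    by (rule fdet_unit_but_one[OF r]) (use a in \<open>simp add: echelon_def\<close>)
  then show ?thesis using minor_enum_zero[OF bij, of a] zero by simp
qed

text \<open>A path from row \<open>r\<close> to column \<open>c\<close> needs the box
  \<open>(r, c)\<close>. So points of the cell have zero echelon entries outside the
  diagram.\<close>

lemma exchange_not_positroid:
  assumes r: "r \<in> {1..num_rows L}" and c: "c \<in> {1..num_cols L}" and n: "(r, c) \<notin> boxes L"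
  shows "insert (sink L c) (sources L - {source L r}) \<notin> positroid L"
proof
  let ?J = "insert (sink L c) (sources L - {source L r})"
  assume "?J \<in> positroid L"
  then obtain A where A: "A \<in> path_families L ?J" by (auto simp: positroid_def)
  have nJ: "source L r \<notin> ?J" using source_neq_sink[OF r c] by simp
  from A r show False
  proof (cases rule: family_cases)
    case (run b xs)
    then have "sink L b = sink L c" using sink_not_source[OF run(2)] by simp
    then have "b = c" using sink_eq_iff[OF run(2) c] by simp
    then show False using full_run_box[OF run(4)] n by simp
  qed (use nJ in simp)
qed

text \<open>
  Expanding the minor \<open>M(B)\<close> along the row and column of the box \<open>B\<close>, the entry of \<open>B\<close> has the
  cofactor \<open>\<plusminus>M'(B)\<close> and everything else involves only entries strictly southeast of \<open>B\<close>. So the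
  entries are determined recursively, starting at the southeast border.
\<close>

lemma echelon_determined:
  assumes a: "echelon a" and a': "echelon a'"
    and out: "\<And>r c. r \<in> {1..num_rows L} \<Longrightarrow> c \<in> {1..num_cols L} \<Longrightarrow> (r, c) \<notin> boxes L \<Longrightarrow>
      a (r - 1) (sink L c) = a' (r - 1) (sink L c)"
    and nz: "\<And>B. B \<in> boxes L \<Longrightarrow> minor nrows a (M' L B) \<noteq> 0"
    and ratio: "\<And>B. B \<in> boxes L \<Longrightarrow>
      minor nrows a (M L B) * minor nrows a' (M' L B) = minor nrows a' (M L B) * minor nrows a (M' L B)"
  shows "r \<in> {1..num_rows L} \<Longrightarrow> c \<in> {1..num_cols L} \<Longrightarrow> a (r - 1) (sink L c) = a' (r - 1) (sink L c)"
proof (induction "num_rows L - r + c" arbitrary: r c rule: less_induct)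
  case less
  note [simp del] = M.simps
  note r = less.prems(1) and c = less.prems(2)
  show ?case
  proof (cases "(r, c) \<in> boxes L")
    case False
    then show ?thesis using out r c by blast
  next
    case B: True
    have IH: "a (s - 1) (sink L d) = a' (s - 1) (sink L d)"
      if "s \<in> {1..num_rows L}" "d \<in> {1..num_cols L}" "r \<le> s" "d \<le> c" "(s, d) \<noteq> (r, c)" for s d
    proof (rule less.hyps[OF _ that(1,2)])
      have "r < s \<or> d < c" using that by auto
      then show "num_rows L - s + d < num_rows L - r + c" using that r by auto
    qed
    let ?K = "M' L (r, c)" and ?J = "M L (r, c)"
    let ?i = "r - 1"
    have i: "?i < nrows" "Suc ?i = r" using r by auto
    have K: "?K \<subseteq> {1..num_steps L}" "finite ?K" "card ?K = nrows"
      using positroid_subset[OF M'_max(1)[of "(r, c)"]] .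
    have src: "a s (source L q) = a' s (source L q)" if s: "s < nrows" and q: "q \<in> {1..num_rows L}" for s q
    proof -
      obtain t where "q = Suc t" "t < nrows" using q by (cases q) auto
      then show ?thesis using a a' s by (simp add: echelon_def)
    qed
    have redK: "reduced a ?K s j = reduced a' ?K s j" if s: "s < nrows" and j: "j \<in> ?K" for s j
    proof (cases "source L (Suc s) \<in> ?K")
      case False
      have row: "Suc s \<in> {1..num_rows L}" using s by auto
      have "r < Suc s" using moved_source(3)[OF B row False] .
      have "j \<in> {1..num_steps L}" using j K by blast
      then have "a s j = a' s j"
      proof (cases rule: label_cases)
        case (source q)
        then show ?thesis using src s by simp
      next
        case (sink d)
        then have "d < c" using moved_sink(3)[OF B] j by blast
        then show ?thesis using IH[OF row sink(1)] \<open>r < Suc s\<close> sink(2) by simp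
      qed
      then show ?thesis using False by (simp add: reduced_def)
    qed (simp add: reduced_def)
    let ?eK = "nth (sorted_list_of_set ?K)" and ?e = "nth (sorted_list_of_set ?J)"
    have eK: "bij_betw ?eK {..<nrows} ?K" by (rule enum_sorted(3)[OF K(2,3)])
    have e: "bij_betw ?e {..<nrows} ?J" by (rule enum_sorted(3)[OF M_card(3,2)[OF B]])
    have "minor nrows a ?K = minor nrows a' ?K"
    proof -
      have "minor nrows a ?K = fdet nrows (\<lambda>s t. reduced a ?K s (?eK t))"
        unfolding minor_def reduced_minor[OF a eK] ..
      also have "\<dots> = fdet nrows (\<lambda>s t. reduced a' ?K s (?eK t))"
        using eK by (intro fdet_cong redK) (auto dest: bij_betwE)
      also have "\<dots> = minor nrows a' ?K" unfolding minor_def reduced_minor[OF a' eK] ..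
      finally show ?thesis .
    qed
    \<comment> \<open>The minors of \<open>M'(B)\<close> agree and do not vanish, so equality of the
      ratios becomes equality of the minors of \<open>M(B)\<close>.\<close>
    then have J_eq: "minor nrows a ?J = minor nrows a' ?J" using ratio[OF B] nz[OF B] by simp
    let ?X = "\<lambda>s t. reduced a ?J s (?e t)" and ?X' = "\<lambda>s t. reduced a' ?J s (?e t)"
    obtain p where p: "p < nrows" "?e p = sink L c"
    proof -
      have "sink L c \<in> ?e ` {..<nrows}" using e unfolding bij_betw_def M_eq[OF B] by blast
      then show thesis using that by auto
    qed
    have p_only: "t = p" if "t < nrows" "?e t = sink L c" for t
      using inj_onD[OF bij_betw_imp_inj_on[OF e], of t p] p that by (simp del: M.simps)
    have iJ: "source L r \<notin> ?J" using source_neq_sink[OF r c] unfolding M_eq[OF B] by simp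
    have X_eq: "?X s t = ?X' s t" if st: "s < nrows" "t < nrows" "(s, t) \<noteq> (?i, p)" for s t
    proof (cases "source L (Suc s) \<in> ?J")
      case False
      have row: "Suc s \<in> {1..num_rows L}" using st by auto
      have rs: "r \<le> Suc s"
      proof (cases "Suc s = r")
        case ne: False
        then have "source L (Suc s) \<noteq> source L r" using source_eq_iff[OF row r] by simp
        then have "source L (Suc s) \<notin> ?K" using False unfolding M_eq[OF B] by blast
        then show ?thesis using moved_source(3)[OF B row] by simp
      qed simp
      have tJ: "?e t \<in> ?J" using e st(2) by (auto dest: bij_betwE)
      then have "?e t \<in> {1..num_steps L}" using M_card(1)[OF B] by blast
      then have "a s (?e t) = a' s (?e t)"
      proof (cases rule: label_cases)
        case (source q)
        then show ?thesis using src st by simp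
      next
        case (sink d)
        have "d < c \<or> d = c" using moved_sink(3)[OF B sink(1)] tJ sink sink_eq_iff[OF sink(1) c] unfolding M_eq[OF B] by auto
        moreover have "d = c \<Longrightarrow> s \<noteq> ?i" using p_only[OF st(2)] sink(2) st(3) by auto
        ultimately have "d \<le> c" "(Suc s, d) \<noteq> (r, c)" by auto
        then show ?thesis using IH[OF row sink(1) rs] sink(2) by simp
      qed
      then show ?thesis using False by (simp add: reduced_def)
    qed (simp add: reduced_def)
    let ?unit = "\<lambda>t. if t = p then 1 else 0 :: real"
    \<comment> \<open>Row \<open>?i\<close> differs from its counterpart only in column
      \<open>p\<close>. It is written as the counterpart plus a multiple of a unit row; the booleans
      index the two summands.\<close>
    have "fdet nrows ?X = (\<Sum>b\<in>{True, False}. (if b then 1 else a ?i (sink L c) - a' ?i (sink L c)) *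
        fdet nrows (?X(?i := (if b then ?X' ?i else ?unit))))"
    proof (rule fdet_row_sum[OF i(1)])
      fix t assume t: "t < nrows"
      show "?X ?i t = (\<Sum>b\<in>{True, False}. (if b then 1 else a ?i (sink L c) - a' ?i (sink L c)) *
          (if b then ?X' ?i else ?unit) t)"
      proof (cases "t = p")
        case True
        then show ?thesis using iJ i p(2) by (simp add: reduced_def)
      next
        case False
        then show ?thesis using X_eq[of ?i t] t i by simp
      qed
    qed
    also have "\<dots> = fdet nrows (?X(?i := ?X' ?i)) +
        (a ?i (sink L c) - a' ?i (sink L c)) * fdet nrows (?X(?i := ?unit))" by simp
    also have "fdet nrows (?X(?i := ?X' ?i)) = fdet nrows ?X'"
      by (rule fdet_cong) (use X_eq in auto)
    finally have expand: "fdet nrows ?X = fdet nrows ?X' +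
        (a ?i (sink L c) - a' ?i (sink L c)) * fdet nrows (?X(?i := ?unit))" .
    \<comment> \<open>Relabelling column \<open>p\<close> by the source of \<open>r\<close> turns
      the cofactor into the minor of \<open>M'(B)\<close> in another column order, which preserves
      nonvanishing.\<close>
    let ?e' = "?e(p := source L r)"
    have e': "bij_betw ?e' {..<nrows} ?K"
    proof -
      have "insert (source L r) (?J - {sink L c}) = ?K"
        using M'_source[OF B] M'_sink[OF B] unfolding M_eq[OF B] by auto
      then show ?thesis using bij_betw_exchange[OF e p iJ] by simp
    qed
    have "fdet nrows (?X(?i := ?unit)) = fdet nrows (\<lambda>s t. reduced a ?K s (?e' t))"
    proof (rule fdet_unit_row[OF i(1), of _ p])
      have iK: "source L r \<in> ?K" by (rule M'_source[OF B])
      show "(?X(?i := ?unit)) ?i p = reduced a ?K ?i (?e' p)" using iK i by (simp add: reduced_def)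
      show "(?X(?i := ?unit)) ?i t = 0 \<and> reduced a ?K ?i (?e' t) = 0" if "t < nrows" "t \<noteq> p" for t
      proof -
        have "?e t \<in> ?J" using e that(1) by (auto dest: bij_betwE)
        then have "?e t \<noteq> source L r" using iJ by metis
        then show ?thesis using iK i that by (simp add: reduced_def)
      qed
      show "(?X(?i := ?unit)) s t = reduced a ?K s (?e' t)" if "s < nrows" "t < nrows" "s \<noteq> ?i" "t \<noteq> p" for s t
      proof -
        have row: "Suc s \<in> {1..num_rows L}" "Suc s \<noteq> r" using that i by auto
        have "source L (Suc s) \<in> ?J \<longleftrightarrow> source L (Suc s) \<in> ?K"
          using source_eq_iff[OF row(1) r] row source_neq_sink[OF row(1) c] unfolding M_eq[OF B] by simp
        then show ?thesis using that by (simp add: reduced_def)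
      qed
    qed
    also have "\<dots> \<noteq> 0"
      unfolding reduced_minor[OF a e'] using minor_enum_zero[OF e', of a] nz[OF B] by simp
    finally have "fdet nrows (?X(?i := ?unit)) \<noteq> 0" .
    moreover have "fdet nrows ?X = fdet nrows ?X'"
      using J_eq unfolding minor_def reduced_minor[OF a e] reduced_minor[OF a' e] .
    ultimately show ?thesis using expand by simp
  qed
qed

section \<open>Reconstruction of points of the cell\<close>

lemma k_subset_positroid: "J \<in> positroid L \<Longrightarrow> J \<subseteq> {1..num_steps L} \<and> card J = num_rows L"
  using positroid_subset by blast

text \<open>The ratios are given at the \<open>+\<close> boxes only. At a \<open>0\<close> box both
  minors of \<open>M(B)\<close> vanish by the zero pattern, and outside the diagram both echelon
  entries vanish, so all entries are covered.\<close>

lemma plucker_determined: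
  assumes x: "plucker_coordinates (num_rows L) (num_steps L) x P"
    and x': "plucker_coordinates (num_rows L) (num_steps L) x' P'"
    and P: "\<And>J. J \<subseteq> {1..num_steps L} \<Longrightarrow> card J = num_rows L \<Longrightarrow> P J \<noteq> 0 \<longleftrightarrow> J \<in> positroid L"
    and P': "\<And>J. J \<subseteq> {1..num_steps L} \<Longrightarrow> card J = num_rows L \<Longrightarrow> P' J \<noteq> 0 \<longleftrightarrow> J \<in> positroid L"
    and ratio: "\<And>B. B \<in> pluses L \<Longrightarrow> P (M L B) / P (M' L B) = P' (M L B) / P' (M' L B)"
  shows "x = x'"
proof -
  let ?n = "num_steps L"
  have I: "sources L \<subseteq> {1..?n}" "card (sources L) = nrows" using k_subset_positroid[OF sources_positroid] by auto
  have PI: "P (sources L) \<noteq> 0" "P' (sources L) \<noteq> 0" using P[OF I] P'[OF I] sources_positroid by auto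
  obtain a where a: "echelon a" "x = row_span nrows ?n a"
    "\<And>J. J \<subseteq> {1..?n} \<Longrightarrow> card J = nrows \<Longrightarrow> P J = P (sources L) * minor nrows a J"
    using echelon_form[OF x PI(1) refl] by metis
  obtain a' where a': "echelon a'" "x' = row_span nrows ?n a'"
    "\<And>J. J \<subseteq> {1..?n} \<Longrightarrow> card J = nrows \<Longrightarrow> P' J = P' (sources L) * minor nrows a' J"
    using echelon_form[OF x' PI(2) refl] by metis
  have out: "b (r - 1) (sink L c) = 0"
    if b: "echelon b" "\<And>J. J \<subseteq> {1..?n} \<Longrightarrow> card J = nrows \<Longrightarrow> J \<notin> positroid L \<Longrightarrow> minor nrows b J = 0"
      and rc: "r \<in> {1..num_rows L}" "c \<in> {1..num_cols L}" "(r, c) \<notin> boxes L" for b r c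
  proof -
    let ?J = "insert (sink L c) (sources L - {source L r})"
    have rI: "source L r \<in> sources L" using rc(1) by (auto simp: sources_def)
    have sub: "?J \<subseteq> {1..?n}" using I(1) sources_sinks rc(2) by blast
    have card: "card ?J = nrows"
      using I(2) finite_sources rI sink_not_source[OF rc(2)]
      by (metis DiffE card_Suc_Diff1 card_insert_disjoint finite_Diff)
    have "minor nrows b ?J = 0" by (rule b(2)[OF sub card exchange_not_positroid[OF rc]])
    moreover have "r - 1 < nrows" "Suc (r - 1) = r" using rc(1) by auto
    ultimately show ?thesis using echelon_entry_minor[OF b(1), of "r - 1" "sink L c"] sink_not_source[OF rc(2)] by simp
  qed
  have za: "minor nrows a J = 0 \<longleftrightarrow> J \<notin> positroid L" "minor nrows a' J = 0 \<longleftrightarrow> J \<notin> positroid L"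
    if "J \<subseteq> {1..?n}" "card J = nrows" for J
    using P[OF that] P'[OF that] a(3)[OF that] a'(3)[OF that] PI by auto
  have entries: "a (r - 1) (sink L c) = a' (r - 1) (sink L c)"
    if rc: "r \<in> {1..num_rows L}" "c \<in> {1..num_cols L}" for r c
  proof (rule echelon_determined[OF a(1) a'(1) _ _ _ rc])
    fix r c assume "r \<in> {1..num_rows L}" "c \<in> {1..num_cols L}" "(r, c) \<notin> boxes L"
    then show "a (r - 1) (sink L c) = a' (r - 1) (sink L c)"
      using out[OF a(1)] out[OF a'(1)] za by metis
  next
    fix B assume B: "B \<in> boxes L"
    have K: "M' L B \<in> positroid L" by (rule M'_max(1))
    note K' = k_subset_positroid[OF K]
    show nz: "minor nrows a (M' L B) \<noteq> 0" using za(1) K K' by blast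
    have nz': "minor nrows a' (M' L B) \<noteq> 0" using za(2) K K' by blast
    have J: "M L B \<subseteq> {1..?n}" "card (M L B) = nrows" using B M_card by (cases B; blast)+
    show "minor nrows a (M L B) * minor nrows a' (M' L B) = minor nrows a' (M L B) * minor nrows a (M' L B)"
    proof (cases "B \<in> pluses L")
      case True
      have "P (M L B) / P (M' L B) = minor nrows a (M L B) / minor nrows a (M' L B)"
        using a(3)[of "M L B"] a(3)[of "M' L B"] J K' PI by simp
      moreover have "P' (M L B) / P' (M' L B) = minor nrows a' (M L B) / minor nrows a' (M' L B)"
        using a'(3)[of "M L B"] a'(3)[of "M' L B"] J K' PI by simp
      ultimately show ?thesis using ratio[OF True] nz nz' by (simp add: frac_eq_eq)
    next
      case False
      then show ?thesis using za[OF J] M_positroid_iff[OF B] by simp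
    qed
  qed
  have "a r j = a' r j" if "r < nrows" "j \<in> {1..?n}" for r j
    using that(2)
  proof (cases rule: label_cases)
    case (source q)
    then obtain t where "q = Suc t" "t < nrows" by (cases q) auto
    then show ?thesis using source a(1) a'(1) that(1) by (simp add: echelon_def)
  next
    case (sink c)
    then show ?thesis using entries[of "Suc r" c] that(1) by simp
  qed
  then have "row_span nrows ?n a = row_span nrows ?n a'" by (rule row_span_cong)
  then show ?thesis using a(2) a'(2) by simp
qed

lemma Meas_plucker:
  assumes T: "T \<in> le_tableaux L"
  shows "Meas L T \<in> grassmannian (num_rows L) (num_steps L)"
    "plucker_coordinates (num_rows L) (num_steps L) (Meas L T) (measurement L T)"
    and "\<And>J. measurement L T J \<noteq> 0 \<longleftrightarrow> J \<in> positroid L"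
proof -
  let ?n = "num_steps L"
  let ?a = "\<lambda>r. meas_entry T (source L (Suc r))"
  have nz: "measurement L T J \<noteq> 0 \<longleftrightarrow> J \<in> positroid L" for J
    using measurement_pos[of T J] measurement_zero[of J T] T by (fastforce simp: le_tableaux_def)
  then show "\<And>J. measurement L T J \<noteq> 0 \<longleftrightarrow> J \<in> positroid L" by blast
  let ?y = "row_span nrows ?n ?a"
  have y: "plucker_coordinates nrows ?n ?y (measurement L T)"
    unfolding plucker_iff using measurement_eq_minor by blast
  have I: "sources L \<subseteq> {1..?n}" "card (sources L) = nrows" using k_subset_positroid[OF sources_positroid] by auto
  have "?y \<in> grassmannian nrows ?n"
    by (rule row_span_grassmannian[OF I])
      (use nz[of "sources L"] sources_positroid measurement_eq_minor[OF I, of T] in simp)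
  \<comment> \<open>Uniqueness for the definite description: two points with the same coordinates
    have the same zero pattern and ratios.\<close>
  moreover have "z = ?y" if "plucker_coordinates nrows ?n z (measurement L T)" for z
    by (rule plucker_determined[OF that y]) (use nz in auto)
  ultimately have "Meas L T = ?y" unfolding Meas_def using y by (intro the_equality) blast+
  then show "Meas L T \<in> grassmannian nrows ?n" "plucker_coordinates nrows ?n (Meas L T) (measurement L T)"
    using \<open>?y \<in> grassmannian nrows ?n\<close> y by simp_all
qed

text \<open>Both systems come from the same echelon matrix, each scaled by its value at the
  sources.\<close>

lemma plucker_proportional:
  assumes "plucker_coordinates nrows (num_steps L) x P" "plucker_coordinates nrows (num_steps L) x P'"
    and "P (sources L) \<noteq> 0" "P' (sources L) \<noteq> 0"
    and J: "J \<subseteq> {1..num_steps L}" "card J = nrows"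
  shows "P J = P (sources L) / P' (sources L) * P' J"
proof -
  let ?n = "num_steps L"
  obtain a where a: "echelon a" "x = row_span nrows ?n a"
    "\<And>J. J \<subseteq> {1..?n} \<Longrightarrow> card J = nrows \<Longrightarrow> P J = P (sources L) * minor nrows a J"
    using echelon_form[OF assms(1,3) refl] by metis
  obtain a' where a': "echelon a'" "x = row_span nrows ?n a'"
    "\<And>J. J \<subseteq> {1..?n} \<Longrightarrow> card J = nrows \<Longrightarrow> P' J = P' (sources L) * minor nrows a' J"
    using echelon_form[OF assms(2,4) refl] by metis
  have "finite J" using J finite_subset by blast
  then have mem: "sorted_list_of_set J ! c \<in> {1..?n}" if "c < nrows" for c
    using enum_sorted(2)[of J nrows] J that by blast
  have "minor nrows a J = minor nrows a' J"
    unfolding minor_def using echelon_unique[OF a(1) a'(1) _ refl] a(2) a'(2) mem by (intro fdet_cong) simp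
  then show ?thesis using a(3)[OF J] a'(3)[OF J] assms(4) by simp
qed

lemma measurement_moebius:
  assumes T: "T \<in> le_tableaux L" and B: "B \<in> pluses L"
  shows "(\<Prod>C\<in>pluses L. (measurement L T (M L C) / measurement L T (M' L C)) powi mu L B C) = T B"
proof -
  have "measurement L T (M' L C) \<noteq> 0" for C using Meas_plucker(3)[OF T] M'_max(1) by blast
  then have "(\<Prod>C\<in>pluses L. (measurement L T (M L C) / measurement L T (M' L C)) powi mu L B C) =
      (\<Prod>C\<in>pluses L. (\<Prod>D | D \<in> pluses L \<and> (C, D) \<in> face_order L. T D) powi mu L B C)"
    by (intro prod.cong refl) (simp add: measurement_M)
  also have "\<dots> = T B"
    unfolding mu_def
    by (rule moebius_inversion[OF finite_pluses[OF le] face_order_partial_order[OF le] B])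
      (use T in \<open>auto simp: le_tableaux_def\<close>)
  finally show ?thesis .
qed

lemma tableau_of_eq:
  assumes P: "\<And>J. J \<subseteq> {1..num_steps L} \<Longrightarrow> card J = num_rows L \<Longrightarrow> P J \<noteq> 0 \<longleftrightarrow> J \<in> positroid L"
  shows "tableau_of L P B =
    (if B \<in> pluses L then \<Prod>C\<in>pluses L. (P (M L C) / P (M' L C)) powi mu L B C else 0)"
proof (cases "B \<in> boxes L")
  case True
  then have "M L B \<subseteq> {1..num_steps L}" "card (M L B) = num_rows L" using M_card by (cases B; blast)+
  then have "P (M L B) \<noteq> 0 \<longleftrightarrow> B \<in> pluses L" using P M_positroid_iff[OF True] by simp
  then show ?thesis using True by (auto simp: tableau_of_def)
next
  case False
  then have "B \<notin> pluses L" using plus_box by blast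
  then show ?thesis using False by (simp add: tableau_of_def)
qed

text \<open>The ratios of \<open>x\<close> are prescribed for a tableau \<open>T0\<close>, and
  determinacy gives that its image is \<open>x\<close>. Any tableau with these ratios is recovered
  from them by Moebius inversion, which yields both the formula for \<open>T0\<close> and
  uniqueness.\<close>

theorem le_coordinates:
  assumes x: "x \<in> nonneg_cell (num_rows L) (num_steps L) (positroid L)"
    and P: "plucker_coordinates (num_rows L) (num_steps L) x P"
  shows "tableau_of L P \<in> le_tableaux L" "Meas L (tableau_of L P) = x"
    and "T \<in> le_tableaux L \<Longrightarrow> Meas L T = x \<Longrightarrow> T = tableau_of L P"
proof -
  let ?n = "num_steps L"
  let ?\<rho> = "\<lambda>B. P (M L B) / P (M' L B)"
  have nz: "Q J \<noteq> 0 \<longleftrightarrow> J \<in> positroid L"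
    if "plucker_coordinates nrows ?n x Q" "J \<subseteq> {1..?n}" "card J = nrows" for Q J
    using x that unfolding nonneg_cell_def by blast
  have I: "sources L \<subseteq> {1..?n}" "card (sources L) = nrows" using k_subset_positroid[OF sources_positroid] by auto
  have ratio_eq: "?\<rho> B = Q (M L B) / Q (M' L B)"
    if Q: "plucker_coordinates nrows ?n x Q" and B: "B \<in> pluses L" for Q B
  proof -
    have ne: "P (sources L) \<noteq> 0" "Q (sources L) \<noteq> 0" using nz[OF P I] nz[OF Q I] sources_positroid by auto
    have "M L B \<in> positroid L" using M_positroid_iff plus_box B by blast
    then have "M L B \<subseteq> {1..?n} \<and> card (M L B) = nrows" "M' L B \<subseteq> {1..?n} \<and> card (M' L B) = nrows"
      using k_subset_positroid M'_max(1) by blast+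
    then show ?thesis
      using plucker_proportional[OF P Q ne, of "M L B"] plucker_proportional[OF P Q ne, of "M' L B"] ne by simp
  qed
  \<comment> \<open>The given \<open>P\<close> may have negative coordinates. Nonnegativity holds
    for some system \<open>P0\<close>, and the ratios are the same for both.\<close>
  obtain P0 where P0: "plucker_coordinates nrows ?n x P0" "\<forall>J. J \<subseteq> {1..?n} \<and> card J = nrows \<longrightarrow> 0 \<le> P0 J"
    using x unfolding nonneg_cell_def nonneg_grassmannian_def by blast
  have pos: "0 < ?\<rho> B" if B: "B \<in> pluses L" for B
  proof -
    have "M L B \<in> positroid L" "M' L B \<in> positroid L" using M_positroid_iff plus_box B M'_max(1) by blast+
    then have "0 < P0 (M L B)" "0 < P0 (M' L B)"
      using nz[OF P0(1)] P0(2) k_subset_positroid by (metis less_le)+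
    then show ?thesis using ratio_eq[OF P0(1) B] by simp
  qed
  have "\<exists>T. (\<forall>B\<in>pluses L. 0 < T B) \<and> (\<forall>C\<in>pluses L. (\<Prod>D | D \<in> pluses L \<and> (C, D) \<in> face_order L. T D) = ?\<rho> C)"
  \<comment> \<open>Moving weakly southeast raises the row or lowers the column, so
    \<open>c - r\<close> strictly decreases along the order.\<close>
  proof (rule zeta_solvable[where f = "\<lambda>(r, c). int c - int r"])
    show "finite (pluses L)" by (rule finite_pluses[OF le])
    show "(B, B) \<in> face_order L" if "B \<in> pluses L" for B
      using that face_order_iff[OF le] by (cases B) auto
    show "(case C of (r, c) \<Rightarrow> int c - int r) < (case B of (r, c) \<Rightarrow> int c - int r)"
      if BC: "(B, C) \<in> face_order L" "B \<noteq> C" for B C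
    proof -
      obtain r c s d where B: "B = (r, c)" and C: "C = (s, d)" by (metis surj_pair)
      have "B \<in> pluses L" "C \<in> pluses L" using BC by (auto simp: face_order_def)
      then have "r \<le> s" "d \<le> c" using face_order_iff[OF le] BC B C by blast+
      moreover have "r \<noteq> s \<or> c \<noteq> d" using BC B C by auto
      ultimately show ?thesis using B C by auto
    qed
    show "0 < ?\<rho> B" if "B \<in> pluses L" for B using pos[OF that] .
  qed
  then obtain \<tau> where \<tau>: "\<forall>B\<in>pluses L. 0 < \<tau> B"
    "\<forall>C\<in>pluses L. (\<Prod>D | D \<in> pluses L \<and> (C, D) \<in> face_order L. \<tau> D) = ?\<rho> C" by blast
  define T0 where "T0 B = (if B \<in> pluses L then \<tau> B else 0)" for B
  have T0: "T0 \<in> le_tableaux L" using \<tau>(1) by (auto simp: le_tableaux_def T0_def)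
  have T0_ratio: "measurement L T0 (M L B) / measurement L T0 (M' L B) = ?\<rho> B" if B: "B \<in> pluses L" for B
  proof -
    have "(\<Prod>D | D \<in> pluses L \<and> (B, D) \<in> face_order L. T0 D) = ?\<rho> B"
      using \<tau>(2) B by (simp add: T0_def)
    moreover have "measurement L T0 (M' L B) \<noteq> 0" using Meas_plucker(3)[OF T0] M'_max(1) by blast
    ultimately show ?thesis using measurement_M[OF B, of T0] by simp
  qed
  have eq: "T = tableau_of L P"
    if T: "T \<in> le_tableaux L" and r: "\<And>B. B \<in> pluses L \<Longrightarrow> measurement L T (M L B) / measurement L T (M' L B) = ?\<rho> B" for T
  proof
    fix B
    show "T B = tableau_of L P B"
    proof (cases "B \<in> pluses L")
      case True
      then have "tableau_of L P B = (\<Prod>C\<in>pluses L. ?\<rho> C powi mu L B C)"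
        using tableau_of_eq[OF nz[OF P]] by simp
      also have "\<dots> = (\<Prod>C\<in>pluses L. (measurement L T (M L C) / measurement L T (M' L C)) powi mu L B C)"
        using r by (intro prod.cong) auto
      also have "\<dots> = T B" by (rule measurement_moebius[OF T True])
      finally show ?thesis ..
    next
      case False
      then have "T B = 0" using T unfolding le_tableaux_def by blast
      then show ?thesis using tableau_of_eq[OF nz[OF P]] False by simp
    qed
  qed
  have T0_eq: "T0 = tableau_of L P" by (rule eq[OF T0 T0_ratio])
  then show "tableau_of L P \<in> le_tableaux L" using T0 by simp
  have "Meas L T0 = x"
    by (rule plucker_determined[OF Meas_plucker(2)[OF T0] P Meas_plucker(3)[OF T0] nz[OF P] T0_ratio])
  then show "Meas L (tableau_of L P) = x" using T0_eq by simp
  assume T: "T \<in> le_tableaux L" "Meas L T = x"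
  then have "plucker_coordinates nrows ?n x (measurement L T)" using Meas_plucker(2) by blast
  then show "T = tableau_of L P" using eq[OF T(1)] ratio_eq by simp
qed

end

theorem theorem3p3:
  fixes L :: le_diagram and x :: "real vec set" and P :: "nat set \<Rightarrow> real"
  assumes "is_le_diagram L"
    and "x \<in> nonneg_cell (num_rows L) (num_steps L) (positroid L)"
    and "plucker_coordinates (num_rows L) (num_steps L) x P"
  shows "tableau_of L P \<in> le_tableaux L \<and>
         Meas L (tableau_of L P) = x \<and>
         (\<forall>T \<in> le_tableaux L. Meas L T = x \<longrightarrow> T = tableau_of L P)"
proof -
  interpret le_filling L by unfold_locales (rule assms(1))
  show ?thesis using le_coordinates[OF assms(2,3)] by blast
qed

end
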